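(* Assume that $a_0,a_1$ are bounded on $V\times V$, that $a_0(v,v)\ge 0$ for all $v\in V$ (no positive lower bound is assumed), that $a_1(v,v)\ge\beta|v|_V^2$ for all $v\in V$ with some $\beta>0$, and that $0<M_0=\nu([0,\infty))<\infty$. Then for every $\varepsilon\in[0,1]$ the operator $\mathcal A_\varepsilon$ is densely defined and $m$-dissipative on $\mathcal W$. Furthermore, there exists a constant $C_{\mathrm{res}}>0$, depending only on the forms $a_1$, $a_{\mathrm v}$, the measure $\nu$ and the embedding constants of $V\hookrightarrow H$, but independent of $\varepsilon$, such that $$\left\|(I-\mathcal A_\varepsilon)^{-1}-(I-\mathcal A_0)^{-1}\right\|_{\mathcal L(\mathcal W)}\le C_{\mathrm{res}}\,\varepsilon\qquad\text{for all }\varepsilon\in[0,1].$$ In particular, $(I-\mathcal A_\varepsilon)^{-1}Y\to(I-\mathcal A_0)^{-1}Y$ in $\mathcal W$ as $\varepsilon\downarrow0$ for every $Y\in\mathcal W$.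
   Context: Setting. $\Omega\subset\mathbb R^d$, $d\in\{1,2,3\}$, is a bounded Lipschitz domain; $H=L^2(\Omega)$, $V=H^1_0(\Omega)$ (real spaces), $|v|_V=\|\nabla v\|_{L^2(\Omega)}$, $\|v\|_V^2=\|v\|_H^2+|v|_V^2$; $H$ is identified with a subspace of $V'$. $A_0,A_1\in L^\infty(\Omega)^{d\times d}$ are symmetric matrix fields, $A_1$ pointwise positive semidefinite a.e., $a_i(w,v)=\int_\Omega A_i\nabla w\cdot\nabla v\,dx$, and $\mathsf A_i:V\to V'$ is given by $\langle\mathsf A_iw,v\rangle=a_i(w,v)$, $i=0,1$. $\nu$ is a non-zero non-negative Borel measure on $[0,\infty)$ (the Bernstein representing measure of the completely monotone kernel $k(t)=\int e^{-\lambda t}d\nu(\lambda)$). Spaces and operators. $\mathcal K$ is the Hilbert space of strongly $\nu$-measurable $\zeta:[0,\infty)\to V$ with $\|\zeta\|_{\mathcal K}^2=\int_{[0,\infty)}a_1(\zeta(\lambda),\zeta(\lambda))\,d\nu(\lambda)<\infty$; $\mathcal W=H\times\mathcal K$ with $\|(u,\zeta)\|_{\mathcal W}^2=\|u\|_H^2+\|\zeta\|_{\mathcal K}^2$. $J:\mathcal K\to V$, $J\zeta=\int\zeta\,d\nu$; $E:V\to\mathcal K$, $(Eu)(\lambda)=u$; $(\Lambda\zeta)(\lambda)=\lambda\zeta(\lambda)$. Perturbed family. $a_{\mathrm v}:V\times V\to\mathbb R$ is a bounded symmetric coercive bilinear form: $|a_{\mathrm v}(v,w)|\le C_{\mathrm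 v}\|v\|_V\|w\|_V$ and $a_{\mathrm v}(v,v)\ge\beta_{\mathrm v}|v|_V^2$ with $C_{\mathrm v},\beta_{\mathrm v}>0$; $\mathsf B:V\to V'$, $\langle\mathsf Bv,w\rangle=a_{\mathrm v}(v,w)$. For $\varepsilon\in[0,1]$, $\mathsf A_0^\varepsilon=\mathsf A_0+\varepsilon\mathsf B$, and $\mathcal A_\varepsilon(u,\zeta)=(-\mathsf A_0^\varepsilon u-\mathsf A_1J\zeta,\;Eu-\Lambda\zeta)$ with domain $D(\mathcal A_\varepsilon)=\{(u,\zeta)\in V\times\mathcal K:\ \mathsf A_0^\varepsilon u+\mathsf A_1J\zeta\in H,\ Eu-\Lambda\zeta\in\mathcal K\}$. "$m$-dissipative" means $\langle\mathcal A_\varepsilon X,X\rangle_{\mathcal W}\le0$ for all $X\in D(\mathcal A_\varepsilon)$ and $\operatorname{Ran}(I-\mathcal A_\varepsilon)=\mathcal W$. *)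

theory Defs
  imports "HOL-Analysis.Analysis"
begin

section \<open>The Hilbert space of square integrable functions\<close>

definition sq_integrable :: "('a::euclidean_space \<Rightarrow> 'b::euclidean_space) \<Rightarrow> bool" where
  "sq_integrable f \<longleftrightarrow>
     f \<in> borel_measurable lebesgue \<and> integrable lebesgue (\<lambda>x. (norm (f x))\<^sup>2)"

lemma sq_integrable_zero: "sq_integrable (\<lambda>_. 0)"
  by (simp add: sq_integrable_def)

lemma sq_integrable_bound:
  fixes f :: "'a::euclidean_space \<Rightarrow> 'b::euclidean_space"
  assumes "f \<in> borel_measurable lebesgue" "integrable lebesgue h"
    and "\<And>x. (norm (f x))\<^sup>2 \<le> h x"
  shows "sq_integrable f"
  unfolding sq_integrable_def
proof
  show "integrable lebesgue (\<lambda>x. (norm (f x))\<^sup>2)"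
  proof (rule Bochner_Integration.integrable_bound[OF assms(2)])
    show "(\<lambda>x. (norm (f x))\<^sup>2) \<in> borel_measurable lebesgue"
      using assms(1) by measurable
    show "AE x in lebesgue. norm ((norm (f x))\<^sup>2) \<le> norm (h x)"
      using assms(3) by (intro AE_I2) (simp add: abs_of_nonneg order_trans[OF _ abs_ge_self])
  qed
qed (rule assms(1))

lemma norm_add_sq_le:
  fixes x y :: "'b::real_normed_vector"
  shows "(norm (x + y))\<^sup>2 \<le> 2 * (norm x)\<^sup>2 + 2 * (norm y)\<^sup>2"
proof -
  have "(norm (x + y))\<^sup>2 \<le> (norm x + norm y)\<^sup>2"
    by (intro power_mono norm_triangle_ineq norm_ge_zero)
  also have "\<dots> \<le> 2 * (norm x)\<^sup>2 + 2 * (norm y)\<^sup>2"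
    using sum_squares_bound[of "norm x" "norm y"] by (simp add: power2_sum)
  finally show ?thesis .
qed

lemma sq_integrable_add:
  assumes "sq_integrable f" "sq_integrable g"
  shows "sq_integrable (\<lambda>x. f x + g x)"
proof (rule sq_integrable_bound)
  show "(\<lambda>x. f x + g x) \<in> borel_measurable lebesgue"
    using assms unfolding sq_integrable_def by (intro borel_measurable_add) auto
  show "integrable lebesgue (\<lambda>x. 2 * (norm (f x))\<^sup>2 + 2 * (norm (g x))\<^sup>2)"
    using assms by (simp add: sq_integrable_def)
qed (rule norm_add_sq_le)

lemma sq_integrable_scaleR:
  assumes "sq_integrable f"
  shows "sq_integrable (\<lambda>x. c *\<^sub>R f x)"
  using assms unfolding sq_integrable_def
  by (auto simp: power_mult_distrib intro!: borel_measurable_scaleR)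

lemma sq_integrable_uminus: "sq_integrable f \<Longrightarrow> sq_integrable (\<lambda>x. - f x)"
  using sq_integrable_scaleR[of f "-1"] by simp

lemma sq_integrable_diff:
  "sq_integrable f \<Longrightarrow> sq_integrable g \<Longrightarrow> sq_integrable (\<lambda>x. f x - g x)"
  using sq_integrable_add[of f "\<lambda>x. - g x"] sq_integrable_uminus[of g] by simp

lemma sq_integrable_inner:
  assumes "sq_integrable f" "sq_integrable g"
  shows "integrable lebesgue (\<lambda>x. f x \<bullet> g x)"
proof (rule Bochner_Integration.integrable_bound)
  show "integrable lebesgue (\<lambda>x. (norm (f x))\<^sup>2 + (norm (g x))\<^sup>2)"
    using assms by (simp add: sq_integrable_def)
  show "(\<lambda>x. f x \<bullet> g x) \<in> borel_measurable lebesgue"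
    using assms unfolding sq_integrable_def by (intro borel_measurable_inner) auto
  have "\<bar>f x \<bullet> g x\<bar> \<le> (norm (f x))\<^sup>2 + (norm (g x))\<^sup>2" for x
  proof -
    have "\<bar>f x \<bullet> g x\<bar> \<le> norm (f x) * norm (g x)"
      by (rule Cauchy_Schwarz_ineq2)
    also have "\<dots> \<le> 2 * norm (f x) * norm (g x)" by simp
    also have "\<dots> \<le> (norm (f x))\<^sup>2 + (norm (g x))\<^sup>2" by (rule sum_squares_bound)
    finally show ?thesis .
  qed
  then show "AE x in lebesgue. norm (f x \<bullet> g x) \<le> norm ((norm (f x))\<^sup>2 + (norm (g x))\<^sup>2)"
    by (auto intro!: AE_I2)
qed

definition L2_rel :: "('a::euclidean_space \<Rightarrow> 'b::euclidean_space) \<Rightarrow> ('a \<Rightarrow> 'b) \<Rightarrow> bool" where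
  "L2_rel f g \<longleftrightarrow> sq_integrable f \<and> sq_integrable g \<and> (AE x in lebesgue. f x = g x)"

quotient_type (overloaded) ('a, 'b) L2 =
  "'a::euclidean_space \<Rightarrow> 'b::euclidean_space" / partial: L2_rel
proof (rule part_equivpI)
  show "\<exists>x :: 'a \<Rightarrow> 'b. L2_rel x x"
    using sq_integrable_zero unfolding L2_rel_def by auto
  show "symp (L2_rel :: ('a \<Rightarrow> 'b) \<Rightarrow> _)"
    by (rule sympI) (auto simp: L2_rel_def elim: eventually_mono)
  show "transp (L2_rel :: ('a \<Rightarrow> 'b) \<Rightarrow> _)"
    by (rule transpI) (auto simp: L2_rel_def elim: eventually_elim2)
qed

lemma sq_integrable_rep: "sq_integrable (rep_L2 u)"
  using Quotient3_rep_reflp[OF Quotient3_L2] by (auto simp: L2_rel_def)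

lemma abs_rep_L2: "abs_L2 (rep_L2 u) = u"
  by (rule Quotient3_abs_rep[OF Quotient3_L2])

lemma rep_abs_L2: "sq_integrable f \<Longrightarrow> AE x in lebesgue. rep_L2 (abs_L2 f) x = f x"
  using rep_abs_rsp_left[OF Quotient3_L2, of f f] by (auto simp: L2_rel_def)

lemma abs_L2_eqI:
  "sq_integrable f \<Longrightarrow> sq_integrable g \<Longrightarrow> AE x in lebesgue. f x = g x \<Longrightarrow> abs_L2 f = abs_L2 g"
  using Quotient3_rel_abs[OF Quotient3_L2, of f g] by (auto simp: L2_rel_def)

lemma L2_eqI: "AE x in lebesgue. rep_L2 u x = rep_L2 v x \<Longrightarrow> u = v"
  using abs_L2_eqI[of "rep_L2 u" "rep_L2 v"] by (simp add: sq_integrable_rep abs_rep_L2)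

instantiation L2 :: (euclidean_space, euclidean_space) real_inner
begin

definition "0 = abs_L2 (\<lambda>_. 0)"
definition "u + v = abs_L2 (\<lambda>x. rep_L2 u x + rep_L2 v x)"
definition "u - v = abs_L2 (\<lambda>x. rep_L2 u x - rep_L2 v x)"
definition "- u = abs_L2 (\<lambda>x. - rep_L2 u x)"
definition "c *\<^sub>R u = abs_L2 (\<lambda>x. c *\<^sub>R rep_L2 u x)"
definition "u \<bullet> v = (\<integral>x. rep_L2 u x \<bullet> rep_L2 v x \<partial>lebesgue)"
definition "norm (u :: ('a, 'b) L2) = sqrt (u \<bullet> u)"
definition "sgn (u :: ('a, 'b) L2) = inverse (norm u) *\<^sub>R u"
definition "dist (u :: ('a, 'b) L2) v = norm (u - v)"
definition "uniformity = (INF e\<in>{0<..}. principal {(u, v :: ('a, 'b) L2). dist u v < e})"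
definition "open (S :: ('a, 'b) L2 set) =
  (\<forall>u\<in>S. \<forall>\<^sub>F (u', v) in uniformity. u' = u \<longrightarrow> v \<in> S)"

lemma rep_zero_L2: "AE x in lebesgue. rep_L2 (0 :: ('a, 'b) L2) x = 0"
  unfolding zero_L2_def by (rule rep_abs_L2 sq_integrable_zero)+

lemma rep_add_L2: "AE x in lebesgue. rep_L2 (u + v :: ('a, 'b) L2) x = rep_L2 u x + rep_L2 v x"
  unfolding plus_L2_def by (intro rep_abs_L2 sq_integrable_add sq_integrable_rep)

lemma rep_diff_L2: "AE x in lebesgue. rep_L2 (u - v :: ('a, 'b) L2) x = rep_L2 u x - rep_L2 v x"
  unfolding minus_L2_def by (intro rep_abs_L2 sq_integrable_diff sq_integrable_rep)

lemma rep_uminus_L2: "AE x in lebesgue. rep_L2 (- u :: ('a, 'b) L2) x = - rep_L2 u x"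
  unfolding uminus_L2_def by (intro rep_abs_L2 sq_integrable_uminus sq_integrable_rep)

lemma rep_scaleR_L2: "AE x in lebesgue. rep_L2 (c *\<^sub>R u :: ('a, 'b) L2) x = c *\<^sub>R rep_L2 u x"
  unfolding scaleR_L2_def by (intro rep_abs_L2 sq_integrable_scaleR sq_integrable_rep)

lemma rep_measurable_L2 [measurable]: "rep_L2 u \<in> borel_measurable lebesgue"
  using sq_integrable_rep[of u] by (simp add: sq_integrable_def)

instance
proof
  fix u v w :: "('a, 'b) L2" and a b :: real
  show "u + v + w = u + (v + w)"
    using rep_add_L2[of "u + v" w] rep_add_L2[of u v] rep_add_L2[of u "v + w"] rep_add_L2[of v w]
    by (intro L2_eqI, eventually_elim) (simp add: algebra_simps)
  show "u + v = v + u"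
    using rep_add_L2[of u v] rep_add_L2[of v u]
    by (intro L2_eqI, eventually_elim) (simp add: algebra_simps)
  show "0 + u = u"
    using rep_add_L2[of 0 u] rep_zero_L2
    by (intro L2_eqI, eventually_elim) (simp add: algebra_simps)
  show "- u + u = 0"
    using rep_add_L2[of "- u" u] rep_zero_L2 rep_uminus_L2[of u]
    by (intro L2_eqI, eventually_elim) (simp add: algebra_simps)
  show "u - v = u + - v"
    using rep_add_L2[of u "- v"] rep_diff_L2[of u v] rep_uminus_L2[of v]
    by (intro L2_eqI, eventually_elim) simp
  show "a *\<^sub>R (u + v) = a *\<^sub>R u + a *\<^sub>R v"
    using rep_add_L2[of u v] rep_scaleR_L2[of a "u + v"] rep_add_L2[of "a *\<^sub>R u" "a *\<^sub>R v"]
      rep_scaleR_L2[of a u] rep_scaleR_L2[of a v]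
    by (intro L2_eqI, eventually_elim) (simp add: algebra_simps)
  show "(a + b) *\<^sub>R u = a *\<^sub>R u + b *\<^sub>R u"
    using rep_scaleR_L2[of "a + b" u] rep_add_L2[of "a *\<^sub>R u" "b *\<^sub>R u"]
      rep_scaleR_L2[of a u] rep_scaleR_L2[of b u]
    by (intro L2_eqI, eventually_elim) (simp add: algebra_simps)
  show "a *\<^sub>R b *\<^sub>R u = (a * b) *\<^sub>R u"
    using rep_scaleR_L2[of "a * b" u] rep_scaleR_L2[of a "b *\<^sub>R u"] rep_scaleR_L2[of b u]
    by (intro L2_eqI, eventually_elim) (simp add: algebra_simps)
  show "1 *\<^sub>R u = u"
    using rep_scaleR_L2[of 1 u] by (intro L2_eqI, eventually_elim) simp
  show "u \<bullet> v = v \<bullet> u"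
    by (simp add: inner_L2_def inner_commute)
  show "(u + v) \<bullet> w = u \<bullet> w + v \<bullet> w"
  proof -
    have "(u + v) \<bullet> w =
        (\<integral>x. rep_L2 u x \<bullet> rep_L2 w x + rep_L2 v x \<bullet> rep_L2 w x \<partial>lebesgue)"
      unfolding inner_L2_def
    proof (rule integral_cong_AE)
      show "AE x in lebesgue. rep_L2 (u + v) x \<bullet> rep_L2 w x =
          rep_L2 u x \<bullet> rep_L2 w x + rep_L2 v x \<bullet> rep_L2 w x"
        using rep_add_L2[of u v] by eventually_elim (simp add: inner_add_left)
    qed measurable
    then show ?thesis
      by (simp add: inner_L2_def sq_integrable_inner sq_integrable_rep)
  qed
  show "(a *\<^sub>R u) \<bullet> v = a * (u \<bullet> v)"
  proof -
    have "(a *\<^sub>R u) \<bullet> v = (\<integral>x. a * (rep_L2 u x \<bullet> rep_L2 v x) \<partial>lebesgue)"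
      unfolding inner_L2_def
    proof (rule integral_cong_AE)
      show "AE x in lebesgue. rep_L2 (a *\<^sub>R u) x \<bullet> rep_L2 v x = a * (rep_L2 u x \<bullet> rep_L2 v x)"
        using rep_scaleR_L2[of a u] by eventually_elim simp
    qed measurable
    then show ?thesis by (simp add: inner_L2_def)
  qed
  show "0 \<le> u \<bullet> u"
    by (simp add: inner_L2_def)
  show "(u \<bullet> u = 0) = (u = 0)"
  proof
    assume "u \<bullet> u = 0"
    then have "AE x in lebesgue. rep_L2 u x \<bullet> rep_L2 u x = 0"
      unfolding inner_L2_def
      by (subst (asm) integral_nonneg_eq_0_iff_AE) (auto simp: sq_integrable_inner sq_integrable_rep)
    then show "u = 0"
      using rep_zero_L2 by (intro L2_eqI, eventually_elim) simp
  next
    assume "u = 0"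
    have "AE x in lebesgue. rep_L2 (0 :: ('a, 'b) L2) x \<bullet> rep_L2 (0 :: ('a, 'b) L2) x = 0"
      using rep_zero_L2 by eventually_elim simp
    then show "u \<bullet> u = 0"
      unfolding inner_L2_def \<open>u = 0\<close> by (rule integral_eq_zero_AE)
  qed
qed (simp_all add: norm_L2_def sgn_L2_def dist_L2_def uniformity_L2_def open_L2_def)

end

lemma nn_integral_rep_L2:
  "(\<integral>\<^sup>+x. ennreal ((norm (rep_L2 u x))\<^sup>2) \<partial>lebesgue) = ennreal ((norm u)\<^sup>2)"
proof -
  have "(norm u)\<^sup>2 = (\<integral>x. (norm (rep_L2 u x))\<^sup>2 \<partial>lebesgue)"
    unfolding power2_norm_eq_inner by (simp add: inner_L2_def)
  moreover have "integrable lebesgue (\<lambda>x. (norm (rep_L2 u x))\<^sup>2)"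
    using sq_integrable_rep[of u] by (simp add: sq_integrable_def)
  ultimately show ?thesis
    by (simp add: nn_integral_eq_integral)
qed

lemma nn_integral_diff_L2:
  "(\<integral>\<^sup>+x. ennreal ((norm (rep_L2 u x - rep_L2 v x))\<^sup>2) \<partial>lebesgue) = ennreal ((norm (u - v))\<^sup>2)"
  unfolding nn_integral_rep_L2[symmetric]
  by (rule nn_integral_cong_AE) (use rep_diff_L2[of u v] in \<open>eventually_elim, simp\<close>)

lemma nn_integral_diff_abs_L2:
  assumes "sq_integrable f"
  shows "(\<integral>\<^sup>+x. ennreal ((norm (f x - rep_L2 v x))\<^sup>2) \<partial>lebesgue) = ennreal ((norm (abs_L2 f - v))\<^sup>2)"
  unfolding nn_integral_diff_L2[symmetric]
  by (rule nn_integral_cong_AE) (use rep_abs_L2[OF assms] in \<open>eventually_elim, simp\<close>)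

instance L2 :: (euclidean_space, euclidean_space) complete_space
proof
  fix X :: "nat \<Rightarrow> ('a, 'b) L2"
  assume X: "Cauchy X"
  have "\<exists>N. \<forall>m\<ge>N. \<forall>n\<ge>N. norm (X m - X n) < (1/2) ^ k" for k
    using CauchyD[OF X, of "(1/2) ^ k"] by simp
  then obtain N where N: "\<And>k m n. m \<ge> N k \<Longrightarrow> n \<ge> N k \<Longrightarrow> norm (X m - X n) < (1/2) ^ k"
    by metis
  define r where "r k = k + (\<Sum>i\<le>k. N i)" for k
  have r_N: "N k \<le> r k" for k
    unfolding r_def by (simp add: member_le_sum trans_le_add2)
  have r_Suc: "r k \<le> r (Suc k)" for k
    unfolding r_def by simp
  have r_ge: "k \<le> r k" for k
    unfolding r_def by simp
  define f where "f k = rep_L2 (X (r k))" for k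
  have [measurable]: "f k \<in> borel_measurable lebesgue" for k
    unfolding f_def by (rule rep_measurable_L2)
  define d where "d k x = norm (f (Suc k) x - f k x)" for k x
  have [measurable]: "d k \<in> borel_measurable lebesgue" for k
    unfolding d_def by measurable
  have d_int: "(\<integral>\<^sup>+x. ennreal ((d k x)\<^sup>2) \<partial>lebesgue) \<le> ennreal ((1/4) ^ k)" for k
  proof -
    have "norm (X (r (Suc k)) - X (r k)) \<le> (1/2) ^ k"
      using N[of k "r (Suc k)" "r k"] r_N[of k] r_Suc[of k] by simp
    then have "(norm (X (r (Suc k)) - X (r k)))\<^sup>2 \<le> ((1/2) ^ k)\<^sup>2"
      by (intro power_mono) auto
    also have "((1/2) ^ k)\<^sup>2 = ((1/4) ^ k :: real)"
      by (simp add: power2_eq_square flip: power_mult_distrib)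
    finally show ?thesis
      unfolding d_def f_def nn_integral_diff_L2 by (rule ennreal_leI)
  qed
  have "(\<integral>\<^sup>+x. (\<Sum>k. ennreal (2 ^ k * (d k x)\<^sup>2)) \<partial>lebesgue)
      = (\<Sum>k. \<integral>\<^sup>+x. ennreal (2 ^ k * (d k x)\<^sup>2) \<partial>lebesgue)"
    by (rule nn_integral_suminf) measurable
  also have "\<dots> \<le> (\<Sum>k. ennreal ((1/2) ^ k))"
  proof (rule suminf_le)
    fix k
    have "(\<integral>\<^sup>+x. ennreal (2 ^ k * (d k x)\<^sup>2) \<partial>lebesgue)
        = ennreal (2 ^ k) * (\<integral>\<^sup>+x. ennreal ((d k x)\<^sup>2) \<partial>lebesgue)"
      by (subst nn_integral_cmult[symmetric]) (auto simp: ennreal_mult')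
    also have "\<dots> \<le> ennreal (2 ^ k) * ennreal ((1/4) ^ k)"
      by (intro mult_left_mono d_int) auto
    also have "\<dots> = ennreal ((1/2) ^ k)"
      by (simp add: flip: ennreal_mult' power_mult_distrib)
    finally show "(\<integral>\<^sup>+x. ennreal (2 ^ k * (d k x)\<^sup>2) \<partial>lebesgue) \<le> ennreal ((1/2) ^ k)" .
  qed auto
  also have "\<dots> = ennreal (\<Sum>k. (1/2) ^ k)"
    by (rule suminf_ennreal2) auto
  also have "\<dots> < \<infinity>" by simp
  finally have "AE x in lebesgue. (\<Sum>k. ennreal (2 ^ k * (d k x)\<^sup>2)) \<noteq> \<infinity>"
    by (intro nn_integral_PInf_AE) auto
  then have conv: "AE x in lebesgue. (\<lambda>k. f k x) \<longlonglongrightarrow> lim (\<lambda>k. f k x)"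
  proof eventually_elim
    case (elim x)
    define S where "S = enn2real (\<Sum>k. ennreal (2 ^ k * (d k x)\<^sup>2))"
    have bound: "d k x \<le> sqrt S * (sqrt (1/2)) ^ k" for k
    proof -
      have "ennreal (2 ^ k * (d k x)\<^sup>2) \<le> (\<Sum>k. ennreal (2 ^ k * (d k x)\<^sup>2))"
        by (rule order_trans[OF _ sum_le_suminf[OF summableI, of "{k}"]]) auto
      also have "\<dots> = ennreal S"
        using elim unfolding S_def by (simp add: less_top)
      finally have "2 ^ k * (d k x)\<^sup>2 \<le> S"
        by (subst (asm) ennreal_le_iff) (auto simp: S_def)
      then have "(d k x)\<^sup>2 \<le> S * (1/2) ^ k"
        by (simp add: power_one_over field_simps)
      then have "sqrt ((d k x)\<^sup>2) \<le> sqrt (S * (1/2) ^ k)"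
        by (rule real_sqrt_le_mono)
      then show ?thesis
        by (simp only: real_sqrt_mult real_sqrt_power real_sqrt_abs) (simp add: d_def)
    qed
    have "summable (\<lambda>k. sqrt S * (sqrt (1/2)) ^ k)"
      by (intro summable_mult summable_geometric) (simp add: real_sqrt_lt_1_iff)
    then have "summable (\<lambda>k. f (Suc k) x - f k x)"
      by (rule summable_comparison_test') (use bound in \<open>simp add: d_def\<close>)
    then have "convergent (\<lambda>n. \<Sum>k<n. f (Suc k) x - f k x)"
      by (simp add: summable_iff_convergent)
    then have "convergent (\<lambda>n. f n x - f 0 x)"
      by (simp only: sum_lessThan_telescope[of "\<lambda>k. f k x"])
    then have "convergent (\<lambda>n. f n x - f 0 x + f 0 x)"
      by (intro convergent_add convergent_const)
    then show ?case
      by (simp add: convergent_LIMSEQ_iff)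
  qed
  define g where "g x = lim (\<lambda>k. f k x)" for x
  have [measurable]: "g \<in> borel_measurable lebesgue"
    unfolding g_def by (intro borel_measurable_lim_metric) measurable
  have fatou: "(\<integral>\<^sup>+x. ennreal ((norm (g x - rep_L2 (X m) x))\<^sup>2) \<partial>lebesgue) \<le> ennreal (((1/2) ^ k)\<^sup>2)"
    if m: "m \<ge> N k" for m k
  proof -
    have [measurable]: "rep_L2 (X m) \<in> borel_measurable lebesgue"
      by (rule rep_measurable_L2)
    have "(\<integral>\<^sup>+x. ennreal ((norm (g x - rep_L2 (X m) x))\<^sup>2) \<partial>lebesgue)
        = (\<integral>\<^sup>+x. liminf (\<lambda>j. ennreal ((norm (f j x - rep_L2 (X m) x))\<^sup>2)) \<partial>lebesgue)"
    proof (rule nn_integral_cong_AE)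
      show "AE x in lebesgue. ennreal ((norm (g x - rep_L2 (X m) x))\<^sup>2) =
          liminf (\<lambda>j. ennreal ((norm (f j x - rep_L2 (X m) x))\<^sup>2))"
        using conv
      proof eventually_elim
        case (elim x)
        then have "(\<lambda>j. ennreal ((norm (f j x - rep_L2 (X m) x))\<^sup>2)) \<longlonglongrightarrow>
            ennreal ((norm (g x - rep_L2 (X m) x))\<^sup>2)"
          unfolding g_def by (intro tendsto_intros)
        then show ?case
          by (intro lim_imp_Liminf[symmetric]) auto
      qed
    qed
    also have "\<dots> \<le> liminf (\<lambda>j. \<integral>\<^sup>+x. ennreal ((norm (f j x - rep_L2 (X m) x))\<^sup>2) \<partial>lebesgue)"
      by (rule nn_integral_liminf) measurable
    also have "\<dots> \<le> ennreal (((1/2) ^ k)\<^sup>2)"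
    proof (rule Liminf_le)
      show "\<forall>\<^sub>F j in sequentially. (\<integral>\<^sup>+x. ennreal ((norm (f j x - rep_L2 (X m) x))\<^sup>2) \<partial>lebesgue)
          \<le> ennreal (((1/2) ^ k)\<^sup>2)"
        using eventually_ge_at_top[of "N k"]
      proof eventually_elim
        case (elim j)
        have "norm (X (r j) - X m) < (1/2) ^ k"
          using N[of k "r j" m] elim r_ge[of j] m by simp
        then have "(norm (X (r j) - X m))\<^sup>2 \<le> ((1/2) ^ k)\<^sup>2"
          by (intro power_mono) auto
        then show ?case
          unfolding f_def nn_integral_diff_L2 by (rule ennreal_leI)
      qed
    qed auto
    finally show ?thesis .
  qed
  have "sq_integrable (\<lambda>x. g x - rep_L2 (X (N 0)) x)"
  proof -
    have [measurable]: "rep_L2 (X (N 0)) \<in> borel_measurable lebesgue"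
      by (rule rep_measurable_L2)
    show ?thesis
      unfolding sq_integrable_def
      using fatou[of 0 "N 0"]
      by (auto intro!: integrableI_bounded intro: le_less_trans)
  qed
  from sq_integrable_add[OF this sq_integrable_rep[of "X (N 0)"]]
  have g: "sq_integrable g" by simp
  have "X \<longlonglongrightarrow> abs_L2 g"
  proof (rule metric_LIMSEQ_I)
    fix e :: real assume "0 < e"
    then obtain k where k: "(1/2) ^ k < e"
      using real_arch_pow_inv[of e "1/2"] by auto
    have "dist (X m) (abs_L2 g) < e" if "m \<ge> N k" for m
    proof -
      have "(norm (abs_L2 g - X m))\<^sup>2 \<le> ((1/2) ^ k)\<^sup>2"
        using fatou[OF that] unfolding nn_integral_diff_abs_L2[OF g]
        by (subst (asm) ennreal_le_iff) auto
      then have "norm (abs_L2 g - X m) \<le> (1/2) ^ k"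
        by (rule power2_le_imp_le) simp
      then show ?thesis
        using k by (simp add: dist_norm norm_minus_commute)
    qed
    then show "\<exists>no. \<forall>n\<ge>no. dist (X n) (abs_L2 g) < e" by blast
  qed
  then show "convergent X" by (auto simp: convergent_def)
qed

lemma countable_dense_imp_subbasis:
  fixes D :: "'a::metric_space set"
  assumes "countable D" "closure D = UNIV"
  shows "\<exists>B :: 'a set set. countable B \<and> open = generate_topology B"
proof -
  define B where "B = (\<lambda>(d, n :: nat). ball d (1 / real (Suc n))) ` (D \<times> UNIV)"
  have "countable B"
    unfolding B_def using assms(1) by (intro countable_image countable_SIGMA) auto
  moreover have "topological_basis B"
  proof (rule topological_basisI)
    fix b assume "b \<in> B"
    then show "open b" by (auto simp: B_def)
  next
    fix S :: "'a set" and x assume "open S" "x \<in> S"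
    then obtain e where e: "0 < e" "ball x e \<subseteq> S"
      using open_contains_ball by blast
    obtain n where n: "1 / real (Suc n) < e / 2"
      using nat_approx_posE[of "e / 2"] e(1) by (auto simp: inverse_eq_divide)
    have "x \<in> closure D" using assms(2) by simp
    then obtain d where d: "d \<in> D" "dist d x < 1 / real (Suc n)"
      unfolding closure_approachable by (meson of_nat_0_less_iff zero_less_Suc zero_less_divide_1_iff)
    have "ball d (1 / real (Suc n)) \<subseteq> ball x e"
    proof
      fix y assume "y \<in> ball d (1 / real (Suc n))"
      then have "dist x y < e"
        using dist_triangle[of x y d] d(2) n by (simp add: dist_commute)
      then show "y \<in> ball x e" by simp
    qed
    then show "\<exists>b\<in>B. x \<in> b \<and> b \<subseteq> S"
      using d e(2) by (intro bexI[of _ "ball d (1 / real (Suc n))"]) (auto simp: B_def)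
  qed
  ultimately show ?thesis
    using topological_basis_imp_subbasis by blast
qed

lemma subspace_closure:
  fixes S :: "'a::real_normed_vector set"
  assumes "subspace S"
  shows "subspace (closure S)"
proof (rule subspaceI)
  show "0 \<in> closure S"
    using subspace_0[OF assms] closure_subset by blast
  fix x y c assume x: "x \<in> closure S"
  from x obtain f where f: "\<And>n. f n \<in> S" "f \<longlonglongrightarrow> x"
    unfolding closure_sequential by blast
  show "c *\<^sub>R x \<in> closure S"
    unfolding closure_sequential
    using f by (intro exI[of _ "\<lambda>n. c *\<^sub>R f n"]) (auto intro!: tendsto_intros subspace_scale assms)
  assume y: "y \<in> closure S"
  from y obtain g where g: "\<And>n. g n \<in> S" "g \<longlonglongrightarrow> y"
    unfolding closure_sequential by blast
  show "x + y \<in> closure S"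
    unfolding closure_sequential
    using f g by (intro exI[of _ "\<lambda>n. f n + g n"]) (auto intro!: tendsto_intros subspace_add assms)
qed

lemma countable_span_dense:
  fixes B :: "'a::real_normed_vector set"
  assumes "countable B" "closure (span B) = UNIV"
  obtains D :: "'a set" where "countable D" "closure D = UNIV"
proof -
  define D where "D = (\<lambda>xs. \<Sum>(q, b)\<leftarrow>xs. real_of_rat q *\<^sub>R b) ` lists (UNIV \<times> B)"
  have cD: "countable D"
    unfolding D_def using assms(1) by (intro countable_image countable_lists countable_SIGMA) auto
  have "x \<in> closure D" if "x \<in> span B" for x
    using that
  proof (induction rule: span_induct_alt)
    case base
    have "0 \<in> D" unfolding D_def by (rule image_eqI[of _ _ "[]"]) auto
    then show ?case using closure_subset by blast
  next
    case (step c b y)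
    obtain d where d: "\<And>n. d n \<in> D" "d \<longlonglongrightarrow> y"
      using step.IH unfolding closure_sequential by blast
    have "\<exists>q\<in>\<rat>. c < q \<and> q < c + 1 / real (Suc n)" for n
      by (rule Rats_dense_in_real) simp
    then obtain q where q: "\<And>n. q n \<in> \<rat>" and qc: "\<And>n. c < q n \<and> q n < c + 1 / real (Suc n)"
      by metis
    have "q \<longlonglongrightarrow> c"
    proof (rule tendsto_sandwich[of "\<lambda>_. c"])
      show "(\<lambda>n. c + 1 / real (Suc n)) \<longlonglongrightarrow> c"
        using tendsto_add[OF tendsto_const LIMSEQ_inverse_real_of_nat, of c]
        by (simp add: inverse_eq_divide)
    qed (use qc in \<open>auto intro!: always_eventually less_imp_le simp del: of_nat_Suc\<close>)
    note q = q this
    have "(\<lambda>n. q n *\<^sub>R b + d n) \<longlonglongrightarrow> c *\<^sub>R b + y"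
      by (intro tendsto_intros d q)
    moreover have "q n *\<^sub>R b + d n \<in> D" for n
    proof -
      obtain r where r: "q n = real_of_rat r" using q(1)[of n] by (auto elim: Rats_cases)
      obtain xs where xs: "xs \<in> lists (UNIV \<times> B)" "d n = (\<Sum>(q, b)\<leftarrow>xs. real_of_rat q *\<^sub>R b)"
        using d(1)[of n] unfolding D_def by blast
      show ?thesis
        unfolding D_def by (rule image_eqI[of _ _ "(r, b) # xs"]) (use r xs step.hyps in auto)
    qed
    ultimately show ?case
      unfolding closure_sequential by (intro exI[of _ "\<lambda>n. q n *\<^sub>R b + d n"]) simp
  qed
  then have "closure (span B) \<subseteq> closure D"
    by (intro closure_minimal) auto
  then have "closure D = UNIV" using assms(2) by auto
  then show thesis by (rule that[OF cD])
qed

lemma abs_L2_add: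
  assumes "sq_integrable f" "sq_integrable g"
  shows "abs_L2 (\<lambda>x. f x + g x) = abs_L2 f + abs_L2 g"
proof (rule L2_eqI)
  show "AE x in lebesgue. rep_L2 (abs_L2 (\<lambda>x. f x + g x)) x = rep_L2 (abs_L2 f + abs_L2 g) x"
    using rep_abs_L2[OF sq_integrable_add[OF assms]] rep_add_L2[of "abs_L2 f" "abs_L2 g"]
      rep_abs_L2[OF assms(1)] rep_abs_L2[OF assms(2)]
    by eventually_elim simp
qed

lemma abs_L2_scaleR:
  assumes "sq_integrable f"
  shows "abs_L2 (\<lambda>x. c *\<^sub>R f x) = c *\<^sub>R abs_L2 f"
proof (rule L2_eqI)
  show "AE x in lebesgue. rep_L2 (abs_L2 (\<lambda>x. c *\<^sub>R f x)) x = rep_L2 (c *\<^sub>R abs_L2 f) x"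
    using rep_abs_L2[OF sq_integrable_scaleR[OF assms, of c]] rep_scaleR_L2[of c "abs_L2 f"]
      rep_abs_L2[OF assms(1)]
    by eventually_elim simp
qed

lemma abs_L2_diff:
  assumes "sq_integrable f" "sq_integrable g"
  shows "abs_L2 (\<lambda>x. f x - g x) = abs_L2 f - abs_L2 g"
  using abs_L2_add[OF assms(1) sq_integrable_scaleR[OF assms(2), of "-1"]]
    abs_L2_scaleR[OF assms(2), of "-1"] by simp

lemma abs_L2_sum:
  assumes "\<And>i. i \<in> I \<Longrightarrow> sq_integrable (f i)"
  shows "sq_integrable (\<lambda>x. \<Sum>i\<in>I. f i x) \<and> abs_L2 (\<lambda>x. \<Sum>i\<in>I. f i x) = (\<Sum>i\<in>I. abs_L2 (f i))"
  using assms
proof (induction I rule: infinite_finite_induct)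
  case (insert i I)
  then show ?case by (simp add: sq_integrable_add abs_L2_add)
qed (simp_all add: sq_integrable_zero zero_L2_def)

lemma abs_L2_dominated:
  fixes f :: "nat \<Rightarrow> 'a::euclidean_space \<Rightarrow> 'b::euclidean_space"
  assumes f: "\<And>n. f n \<in> borel_measurable lebesgue" "g \<in> borel_measurable lebesgue"
    and w: "integrable lebesgue (\<lambda>x. (w x)\<^sup>2)"
    and bound: "\<And>n x. norm (f n x) \<le> w x"
    and lim: "\<And>x. (\<lambda>n. f n x) \<longlonglongrightarrow> g x"
  shows "sq_integrable (f n)" "sq_integrable g" "(\<lambda>n. abs_L2 (f n)) \<longlonglongrightarrow> abs_L2 g"
proof -
  have g_bound: "norm (g x) \<le> w x" for x
    by (rule LIMSEQ_le_const2[OF tendsto_norm[OF lim]]) (use bound in auto)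
  have sq: "(norm (h x))\<^sup>2 \<le> (w x)\<^sup>2" if "norm (h x) \<le> w x" for h :: "'a \<Rightarrow> 'b" and x
    using that by (intro power_mono) auto
  show sf: "sq_integrable (f n)" for n
    by (rule sq_integrable_bound[OF f(1) w]) (rule sq[OF bound])
  show sg: "sq_integrable g"
    by (rule sq_integrable_bound[OF f(2) w]) (rule sq[OF g_bound])
  have meas: "(\<lambda>x. (norm (f n x - g x))\<^sup>2) \<in> borel_measurable lebesgue" for n
    using sq_integrable_diff[OF sf sg, of n] unfolding sq_integrable_def
    by (auto dest: borel_measurable_integrable)
  have "(\<lambda>n. \<integral>x. (norm (f n x - g x))\<^sup>2 \<partial>lebesgue) \<longlonglongrightarrow> integral\<^sup>L lebesgue (\<lambda>x::'a. 0::real)"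
  proof (rule integral_dominated_convergence[where w = "\<lambda>x. 4 * (w x)\<^sup>2"])
    show "AE x in lebesgue. (\<lambda>n. (norm (f n x - g x))\<^sup>2) \<longlonglongrightarrow> 0"
    proof (rule AE_I2)
      fix x
      have "(\<lambda>n. (norm (f n x - g x))\<^sup>2) \<longlonglongrightarrow> (norm (g x - g x))\<^sup>2"
        by (intro tendsto_intros lim)
      then show "(\<lambda>n. (norm (f n x - g x))\<^sup>2) \<longlonglongrightarrow> 0" by simp
    qed
    show "AE x in lebesgue. norm ((norm (f n x - g x))\<^sup>2) \<le> 4 * (w x)\<^sup>2" for n
    proof (rule AE_I2)
      fix x
      have "norm (f n x - g x) \<le> 2 * w x"
        using norm_triangle_ineq4[of "f n x" "g x"] bound[of n x] g_bound[of x] by simp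
      then have "(norm (f n x - g x))\<^sup>2 \<le> (2 * w x)\<^sup>2"
        by (intro power_mono) auto
      then show "norm ((norm (f n x - g x))\<^sup>2) \<le> 4 * (w x)\<^sup>2"
        by (simp add: power_mult_distrib)
    qed
  qed (use w meas in auto)
  moreover have "(\<integral>x. (norm (f n x - g x))\<^sup>2 \<partial>lebesgue) = (norm (abs_L2 (f n) - abs_L2 g))\<^sup>2" for n
  proof -
    have "(norm (abs_L2 (f n) - abs_L2 g))\<^sup>2 =
        (\<integral>x. (norm (rep_L2 (abs_L2 (\<lambda>x. f n x - g x)) x))\<^sup>2 \<partial>lebesgue)"
      unfolding abs_L2_diff[OF sf sg, symmetric] power2_norm_eq_inner by (simp add: inner_L2_def)
    also have "\<dots> = (\<integral>x. (norm (f n x - g x))\<^sup>2 \<partial>lebesgue)"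
    proof (rule integral_cong_AE)
      show "AE x in lebesgue. (norm (rep_L2 (abs_L2 (\<lambda>x. f n x - g x)) x))\<^sup>2 = (norm (f n x - g x))\<^sup>2"
        using rep_abs_L2[OF sq_integrable_diff[OF sf sg, of n]] by eventually_elim simp
    qed (use meas in measurable)
    finally show ?thesis by simp
  qed
  ultimately have "(\<lambda>n. (norm (abs_L2 (f n) - abs_L2 g))\<^sup>2) \<longlonglongrightarrow> 0" by simp
  then have "(\<lambda>n. sqrt ((norm (abs_L2 (f n) - abs_L2 g))\<^sup>2)) \<longlonglongrightarrow> sqrt 0"
    by (rule tendsto_real_sqrt)
  then have "(\<lambda>n. norm (abs_L2 (f n) - abs_L2 g)) \<longlonglongrightarrow> 0" by simp
  then show "(\<lambda>n. abs_L2 (f n)) \<longlonglongrightarrow> abs_L2 g"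
    by (simp add: tendsto_norm_zero_iff LIM_zero_iff)
qed

lemma indicator_sq_integrable:
  assumes "A \<in> sets lebesgue" "emeasure lebesgue A < \<infinity>"
  shows "integrable lebesgue (\<lambda>x. (indicator A x * c :: real)\<^sup>2)"
proof -
  have "(\<lambda>x. (indicator A x * c)\<^sup>2) = (\<lambda>x. indicator A x *\<^sub>R c\<^sup>2)"
    by (auto simp: indicator_def)
  then show ?thesis using assms by (simp add: integrable_real_indicator)
qed

lemma sq_integrable_indicator:
  fixes y :: "'b::euclidean_space"
  assumes "A \<in> sets lebesgue" "emeasure lebesgue A < \<infinity>"
  shows "sq_integrable (\<lambda>x::'a::euclidean_space. indicator A x *\<^sub>R y)"
proof (rule sq_integrable_bound[OF _ indicator_sq_integrable[OF assms, of "norm y"]])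
  show "(\<lambda>x. indicator A x *\<^sub>R y) \<in> borel_measurable lebesgue"
    using assms(1) by measurable
qed (simp add: indicator_def)

definition indicator_L2 :: "'a::euclidean_space set \<Rightarrow> 'b::euclidean_space \<Rightarrow> ('a, 'b) L2" where
  "indicator_L2 A y = abs_L2 (\<lambda>x. indicator A x *\<^sub>R y)"

lemma indicator_L2_lim:
  assumes A: "\<And>n. A n \<in> sets lebesgue" "B \<in> sets lebesgue" "emeasure lebesgue B < \<infinity>"
    and "incseq A" "B = (\<Union>n. A n)"
  shows "(\<lambda>n. indicator_L2 (A n) y) \<longlonglongrightarrow> indicator_L2 B y"
  unfolding indicator_L2_def
proof (rule abs_L2_dominated(3))
  show "integrable lebesgue (\<lambda>x. (indicator B x * norm y)\<^sup>2)"
    by (rule indicator_sq_integrable[OF A(2,3)])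
  show "norm (indicator (A n) x *\<^sub>R y) \<le> indicator B x * norm y" for n x
    using assms(5) by (auto simp: indicator_def)
  show "(\<lambda>n. indicator (A n) x *\<^sub>R y) \<longlonglongrightarrow> indicator B x *\<^sub>R y" for x
    using LIMSEQ_indicator_incseq[OF assms(4), of x] assms(5) by (intro tendsto_intros) simp
qed (use A in measurable)

lemma indicator_L2_Un:
  assumes "A \<in> sets lebesgue" "B \<in> sets lebesgue" "A \<inter> B = {}"
    "emeasure lebesgue A < \<infinity>" "emeasure lebesgue B < \<infinity>"
  shows "indicator_L2 (A \<union> B) y = indicator_L2 A y + indicator_L2 B y"
proof -
  have "(\<lambda>x. indicator (A \<union> B) x *\<^sub>R y) = (\<lambda>x. indicator A x *\<^sub>R y + indicator B x *\<^sub>R y)"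
    using assms(3) by (auto simp: indicator_def fun_eq_iff)
  then show ?thesis
    unfolding indicator_L2_def
    by (simp only: abs_L2_add[OF sq_integrable_indicator[OF assms(1,4)] sq_integrable_indicator[OF assms(2,5)]])
qed

lemma borel_indicator_L2_dense:
  fixes S :: "('a::euclidean_space, 'b::euclidean_space) L2 set" and W :: "'a set set"
  assumes S: "subspace S" "closed S"
    and W: "topological_basis W" "countable W"
    and ind: "\<And>F. finite F \<Longrightarrow> F \<subseteq> W \<Longrightarrow> emeasure lebesgue (\<Union>F) < \<infinity> \<Longrightarrow> indicator_L2 (\<Union>F) e \<in> S"
    and A: "A \<in> sets borel"
  shows "indicator_L2 (A \<inter> ball 0 r) e \<in> S"
proof -
  have fin: "emeasure lebesgue (C \<inter> ball 0 r) < \<infinity>" for C :: "'a set"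
  proof -
    have "emeasure lebesgue (C \<inter> ball 0 r) \<le> emeasure lebesgue (ball (0 :: 'a) r)"
      by (intro emeasure_mono) auto
    also have "\<dots> < \<infinity>"
      using emeasure_bounded_finite[of "ball (0 :: 'a) r"] by simp
    finally show ?thesis .
  qed
  have leb: "C \<inter> ball 0 r \<in> sets lebesgue" if "C \<in> sets borel" for C :: "'a set"
    using that by auto
  have limit: "indicator_L2 B e \<in> S"
    if "\<And>n. C n \<in> sets lebesgue" "B \<in> sets lebesgue" "emeasure lebesgue B < \<infinity>"
      "incseq C" "B = (\<Union>n. C n)" "\<And>n. indicator_L2 (C n) e \<in> S" for B C
    by (rule closed_sequentially[OF S(2) that(6) indicator_L2_lim[OF that(1-5)]])
  have sig: "sigma_sets UNIV {S :: 'a set. open S} = sets borel"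
    by (simp add: borel_def)
  have A': "A \<in> sigma_sets UNIV {S. open S}"
    using A by (simp add: sig)
  have "Int_stable {S :: 'a set. open S}" by (auto simp: Int_stable_def)
  then show ?thesis
  proof (rule sigma_sets_induct_disjoint[OF _ _ A'])
    show "{S :: 'a set. open S} \<subseteq> Pow UNIV" by simp
    show "indicator_L2 (A \<inter> ball 0 r) e \<in> S" if "A \<in> {S. open S}" for A
    proof -
      have "open (A \<inter> ball 0 r)" using that by auto
      then obtain F where F: "F \<subseteq> W" "A \<inter> ball 0 r = \<Union>F"
        using W unfolding topological_basis_def by metis
      show ?thesis
      proof (cases "F = {}")
        case True
        then show ?thesis using F ind[of "{}"] by simp
      next
        case False
        have cF: "countable F" using F(1) W(2) countable_subset by blast
        define A' where "A' n = \<Union>(from_nat_into F ` {..n})" for n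
        have sub: "from_nat_into F ` {..n} \<subseteq> F" for n
          using from_nat_into[OF False] by auto
        have op: "open (A' n)" for n
          unfolding A'_def using sub[of n] F(1) topological_basis_open[OF W(1)]
          by (intro open_Union) blast
        have "\<Union>F = \<Union>(range (from_nat_into F))"
          by (simp add: range_from_nat_into[OF False cF])
        then have U: "A \<inter> ball 0 r = (\<Union>n. A' n)"
          unfolding F(2) A'_def by auto
        show ?thesis
        proof (rule limit[OF _ _ fin _ U])
          show "incseq A'" unfolding A'_def by (rule incseq_SucI) (auto intro: le_SucI)
          show "indicator_L2 (A' n) e \<in> S" for n
            unfolding A'_def
          proof (rule ind)
            have "emeasure lebesgue (A' n) \<le> emeasure lebesgue (A \<inter> ball 0 r)"
              using that by (intro emeasure_mono leb) (auto simp: U)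
            also have "\<dots> < \<infinity>" by (rule fin)
            finally show "emeasure lebesgue (\<Union> (from_nat_into F ` {..n})) < \<infinity>"
              by (simp add: A'_def)
          qed (use sub[of n] F in auto)
        qed (use op that in auto)
      qed
    qed
    show "indicator_L2 ({} \<inter> ball 0 r) e \<in> S"
      using ind[of "{}"] by simp
    then have open_case: "indicator_L2 (ball 0 r) e \<in> S"
      using \<open>\<And>A. A \<in> {S. open S} \<Longrightarrow> indicator_L2 (A \<inter> ball 0 r) e \<in> S\<close>[of UNIV] by simp
    show "indicator_L2 ((UNIV - A) \<inter> ball 0 r) e \<in> S"
      if "A \<in> sigma_sets UNIV {S. open S}" "indicator_L2 (A \<inter> ball 0 r) e \<in> S" for A
    proof -
      have "A \<in> sets borel" using that by (simp add: sig)
      have "indicator_L2 ((A \<inter> ball 0 r) \<union> ((UNIV - A) \<inter> ball 0 r)) e =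
          indicator_L2 (A \<inter> ball 0 r) e + indicator_L2 ((UNIV - A) \<inter> ball 0 r) e"
        using \<open>A \<in> sets borel\<close> by (intro indicator_L2_Un leb fin) auto
      moreover have "(A \<inter> ball 0 r) \<union> ((UNIV - A) \<inter> ball 0 r) = ball 0 r" by auto
      ultimately have "indicator_L2 ((UNIV - A) \<inter> ball 0 r) e =
          indicator_L2 (ball 0 r) e - indicator_L2 (A \<inter> ball 0 r) e" by simp
      then show ?thesis
        using subspace_diff[OF S(1) open_case that(2)] by simp
    qed
    show "indicator_L2 ((\<Union>i::nat. A i) \<inter> ball 0 r) e \<in> S"
      if A: "disjoint_family A" "range A \<subseteq> sigma_sets UNIV {S. open S}"
        "\<And>i. indicator_L2 (A i \<inter> ball 0 r) e \<in> S" for A :: "nat \<Rightarrow> 'a set"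
    proof (rule limit[of "\<lambda>n. (\<Union>i<n. A i) \<inter> ball 0 r"])
      have b: "A i \<in> sets borel" for i using A(2) by (auto simp: sig)
      then have b': "(\<Union>i<n. A i) \<in> sets borel" for n by auto
      show "(\<Union>i<n. A i) \<inter> ball 0 r \<in> sets lebesgue" for n
        by (rule leb[OF b'])
      show "(\<Union>i. A i) \<inter> ball 0 r \<in> sets lebesgue"
        using b by (intro leb) auto
      show "incseq (\<lambda>n. (\<Union>i<n. A i) \<inter> ball 0 r)"
        by (rule incseq_SucI) (auto intro: less_SucI)
      show "indicator_L2 ((\<Union>i<n. A i) \<inter> ball 0 r) e \<in> S" for n
      proof (induction n)
        case 0
        then show ?case using ind[of "{}"] by simp
      next
        case (Suc n)
        have "A n \<inter> A i = {}" if "i < n" for i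
          using disjoint_family_onD[OF A(1), of n i] that by simp
        then have "(A n \<inter> ball 0 r) \<inter> ((\<Union>i<n. A i) \<inter> ball 0 r) = {}" by blast
        moreover have "(\<Union>i<Suc n. A i) \<inter> ball 0 r = (A n \<inter> ball 0 r) \<union> ((\<Union>i<n. A i) \<inter> ball 0 r)"
          by (auto simp: less_Suc_eq)
        ultimately have "indicator_L2 ((\<Union>i<Suc n. A i) \<inter> ball 0 r) e =
            indicator_L2 (A n \<inter> ball 0 r) e + indicator_L2 ((\<Union>i<n. A i) \<inter> ball 0 r) e"
          using indicator_L2_Un[OF leb[OF b] leb[OF b'] _ fin fin] by simp
        then show ?case using subspace_add[OF S(1) A(3) Suc] by simp
      qed
    qed (rule fin, auto)
  qed
qed

lemma L2_dense:
  fixes S :: "('a::euclidean_space, 'b::euclidean_space) L2 set" and W :: "'a set set"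
  assumes S: "subspace S" "closed S"
    and W: "topological_basis W" "countable W"
    and ind: "\<And>F e. finite F \<Longrightarrow> F \<subseteq> W \<Longrightarrow> emeasure lebesgue (\<Union>F) < \<infinity> \<Longrightarrow> e \<in> Basis \<Longrightarrow>
      indicator_L2 (\<Union>F) e \<in> S"
  shows "S = UNIV"
proof -
  have leb: "indicator_L2 A e \<in> S"
    if A: "A \<in> sets lebesgue" "emeasure lebesgue A < \<infinity>" and e: "e \<in> Basis" for A e
  proof -
    obtain C N N' where C: "A = C \<union> N" "N \<subseteq> N'" "N' \<in> null_sets lborel" "C \<in> sets lborel"
      using A(1) by (rule sets_completionE)
    have Cb: "C \<in> sets borel" "C \<in> sets lebesgue" using C(4) by auto
    have fin: "emeasure lebesgue C < \<infinity>"
      using emeasure_mono[of C A lebesgue] C(1) A by (auto intro: le_less_trans)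
    have "AE x in lborel. x \<notin> N'" by (rule AE_not_in[OF C(3)])
    then have "AE x in lebesgue. x \<notin> N'" by (rule AE_completion)
    then have "AE x in lebesgue. indicator A x *\<^sub>R e = (indicator C x *\<^sub>R e :: 'b)"
      by eventually_elim (use C(1,2) in \<open>auto simp: indicator_def\<close>)
    then have eq: "indicator_L2 A e = indicator_L2 C e"
      unfolding indicator_L2_def by (intro abs_L2_eqI sq_integrable_indicator A fin Cb)
    have "(\<lambda>n. indicator_L2 (C \<inter> ball 0 (real n)) e) \<longlonglongrightarrow> indicator_L2 C e"
    proof (rule indicator_L2_lim[OF _ Cb(2) fin])
      show "C \<inter> ball 0 (real n) \<in> sets lebesgue" for n using Cb by auto
      show "incseq (\<lambda>n. C \<inter> ball 0 (real n))" by (rule incseq_SucI) auto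
      show "C = (\<Union>n. C \<inter> ball 0 (real n))"
        using reals_Archimedean2 by fastforce
    qed
    moreover have "indicator_L2 (C \<inter> ball 0 (real n)) e \<in> S" for n
      by (rule borel_indicator_L2_dense[OF S W _ Cb(1)]) (rule ind[OF _ _ _ e])
    ultimately show ?thesis
      unfolding eq by (blast intro: closed_sequentially[OF S(2), of "\<lambda>n. indicator_L2 (C \<inter> ball 0 (real n)) e"])
  qed
  have leb': "indicator_L2 A y \<in> S"
    if A: "A \<in> sets lebesgue" "emeasure lebesgue A < \<infinity>" for A y
  proof -
    have "indicator A x *\<^sub>R y = (\<Sum>e\<in>Basis. (y \<bullet> e) *\<^sub>R (indicator A x *\<^sub>R e))" for x :: 'a
      by (cases "x \<in> A") (simp_all add: euclidean_representation)
    then have "indicator_L2 A y = abs_L2 (\<lambda>x. \<Sum>e\<in>Basis. (y \<bullet> e) *\<^sub>R (indicator A x *\<^sub>R e))"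
      unfolding indicator_L2_def by (intro arg_cong[of _ _ abs_L2] ext)
    also have "\<dots> = (\<Sum>e\<in>Basis. abs_L2 (\<lambda>x. (y \<bullet> e) *\<^sub>R (indicator A x *\<^sub>R e)))"
      by (rule conjunct2[OF abs_L2_sum]) (intro sq_integrable_scaleR sq_integrable_indicator A)
    also have "\<dots> = (\<Sum>e\<in>Basis. (y \<bullet> e) *\<^sub>R indicator_L2 A e)"
      unfolding indicator_L2_def
      by (intro sum.cong refl abs_L2_scaleR sq_integrable_indicator A)
    also have "\<dots> \<in> S"
      by (intro subspace_sum subspace_scale S leb A)
    finally show ?thesis .
  qed
  have "u \<in> S" for u
  proof -
    define f where "f = rep_L2 u"
    have f: "f \<in> borel_measurable lebesgue" "integrable lebesgue (\<lambda>x. (norm (f x))\<^sup>2)"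
      using sq_integrable_rep[of u] by (auto simp: sq_integrable_def f_def)
    obtain s where s: "\<And>i. simple_function lebesgue (s i)"
      "\<And>x. (\<lambda>i. s i x) \<longlonglongrightarrow> f x" "\<And>i x. dist (s i x) 0 \<le> 2 * dist (f x) 0"
      using borel_measurable_implies_sequence_metric[OF f(1), of 0] by auto
    have w: "integrable lebesgue (\<lambda>x. (2 * norm (f x))\<^sup>2)"
      using f(2) by (simp add: power_mult_distrib)
    have sm: "s i \<in> borel_measurable lebesgue" for i
      by (rule borel_measurable_simple_function[OF s(1)])
    note dom = abs_L2_dominated[OF sm f(1) w _ s(2)]
    have bound: "norm (s i x) \<le> 2 * norm (f x)" for i x
      using s(3)[of i x] by simp
    have "abs_L2 (s i) \<in> S" for i
    proof -
      have fin: "finite (range (s i))"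
        using simple_functionD(1)[OF s(1)[of i]] by simp
      define Z where "Z y = s i -` {y}" for y
      have Zm: "Z y \<in> sets lebesgue" for y
        using simple_functionD(2)[OF s(1)[of i], of "{y}"] by (simp add: Z_def)
      have Zfin: "emeasure lebesgue (Z y) < \<infinity>" if "y \<noteq> 0" for y
      proof -
        have "integrable lebesgue (\<lambda>x. (norm (s i x))\<^sup>2)"
          using dom(1)[OF bound, of i] by (simp add: sq_integrable_def)
        then have "(\<integral>\<^sup>+x. ennreal ((norm (s i x))\<^sup>2) \<partial>lebesgue) < \<infinity>"
          by (simp add: integrable_iff_bounded)
        moreover have "(\<integral>\<^sup>+x. ennreal ((norm y)\<^sup>2) * indicator (Z y) x \<partial>lebesgue) \<le>
            (\<integral>\<^sup>+x. ennreal ((norm (s i x))\<^sup>2) \<partial>lebesgue)"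
          by (rule nn_integral_mono) (auto simp: Z_def indicator_def)
        ultimately have "ennreal ((norm y)\<^sup>2) * emeasure lebesgue (Z y) < \<infinity>"
          using Zm by (simp add: nn_integral_cmult_indicator)
        then show ?thesis
          using that by (auto simp: ennreal_mult_less_top)
      qed
      have "s i = (\<lambda>x. \<Sum>y\<in>range (s i) - {0}. indicator (Z y) x *\<^sub>R y)"
      proof
        fix x
        have "(\<Sum>y\<in>range (s i) - {0}. indicator (Z y) x *\<^sub>R y) =
            (\<Sum>y\<in>range (s i) - {0}. if y = s i x then y else 0)"
          by (rule sum.cong) (auto simp: Z_def indicator_def)
        also have "\<dots> = s i x" using fin by (simp add: sum.delta)
        finally show "s i x = (\<Sum>y\<in>range (s i) - {0}. indicator (Z y) x *\<^sub>R y)" by simp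
      qed
      then have "abs_L2 (s i) = abs_L2 (\<lambda>x. \<Sum>y\<in>range (s i) - {0}. indicator (Z y) x *\<^sub>R y)"
        by (rule arg_cong)
      also have "\<dots> = (\<Sum>y\<in>range (s i) - {0}. indicator_L2 (Z y) y)"
        unfolding indicator_L2_def
        by (rule conjunct2[OF abs_L2_sum]) (auto intro!: sq_integrable_indicator Zm Zfin)
      also have "\<dots> \<in> S"
        by (intro subspace_sum S leb' Zm Zfin) auto
      finally show ?thesis .
    qed
    then have "abs_L2 f \<in> S"
      by (rule closed_sequentially[OF S(2) _ dom(3)[OF bound]])
    then show ?thesis by (simp add: f_def abs_rep_L2)
  qed
  then show ?thesis by auto
qed

instance L2 :: (euclidean_space, euclidean_space) second_countable_topology
proof
  obtain W :: "'a set set" where W: "countable W" "topological_basis W"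
    using ex_countable_basis by blast
  define B :: "('a, 'b) L2 set" where
    "B = (\<lambda>(F, e). indicator_L2 (\<Union>F) e) ` ({F. finite F \<and> F \<subseteq> W} \<times> Basis)"
  have "countable B"
    unfolding B_def using W(1)
    by (intro countable_image countable_SIGMA countable_Collect_finite_subset) (auto simp: countable_finite)
  moreover have "closure (span B) = UNIV"
  proof (rule L2_dense[OF _ closed_closure W(2,1)])
    show "subspace (closure (span B))" by (intro subspace_closure subspace_span)
    show "indicator_L2 (\<Union>F) e \<in> closure (span B)"
      if "finite F" "F \<subseteq> W" "e \<in> Basis" for F e
    proof -
      have "indicator_L2 (\<Union>F) e \<in> B" using that by (auto simp: B_def)
      then show ?thesis using span_base closure_subset by blast
    qed
  qed
  ultimately obtain D :: "('a, 'b) L2 set" where "countable D" "closure D = UNIV"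
    by (rule countable_span_dense)
  then show "\<exists>B :: ('a, 'b) L2 set set. countable B \<and> open = generate_topology B"
    by (rule countable_dense_imp_subbasis)
qed


section \<open>Bounded Lipschitz domains, test functions and the Sobolev space\<close>

definition bounded_lipschitz_domain :: "(real^'n) set \<Rightarrow> bool" where
  "bounded_lipschitz_domain \<Omega> \<longleftrightarrow>
     open \<Omega> \<and> connected \<Omega> \<and> \<Omega> \<noteq> {} \<and> bounded \<Omega> \<and>
     (\<forall>p\<in>frontier \<Omega>. \<exists>r>0. \<exists>e. norm e = 1 \<and>
        (\<exists>L. \<exists>\<gamma>. L-lipschitz_on UNIV \<gamma> \<and>
          (\<forall>x\<in>ball p r. x \<in> \<Omega> \<longleftrightarrow> (x - p) \<bullet> e > (\<gamma> (x - p - ((x - p) \<bullet> e) *\<^sub>R e) :: real))))"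

primrec C_k :: "nat \<Rightarrow> (real^'n \<Rightarrow> real) \<Rightarrow> bool" where
  "C_k 0 f \<longleftrightarrow> continuous_on UNIV f"
| "C_k (Suc k) f \<longleftrightarrow> (\<exists>g. (\<forall>x. GDERIV f x :> g x) \<and> (\<forall>i. C_k k (\<lambda>x. g x $ i)))"

definition test_functions :: "(real^'n) set \<Rightarrow> (real^'n \<Rightarrow> real) set" where
  "test_functions \<Omega> = {\<phi>. (\<forall>k. C_k k \<phi>) \<and>
     compact (closure {x. \<phi> x \<noteq> 0}) \<and> closure {x. \<phi> x \<noteq> 0} \<subseteq> \<Omega>}"

definition gradient :: "(real^'n \<Rightarrow> real) \<Rightarrow> real^'n \<Rightarrow> real^'n" where
  "gradient \<phi> x = (THE D. GDERIV \<phi> x :> D)"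

text \<open>\<open>L\<^sup>2(\<Omega>)\<close> is identified, by extension by zero, with a subspace of \<open>L\<^sup>2\<close> of the whole space.\<close>

definition L2_on :: "(real^'n) set \<Rightarrow> (real^'n, real) L2 set" where
  "L2_on \<Omega> = {f. AE x in lebesgue. x \<notin> \<Omega> \<longrightarrow> rep_L2 f x = 0}"

text \<open>
  An element \<open>u\<close> of \<open>H\<^sup>1\<^sub>0(\<Omega>)\<close> is represented by the pair \<open>(u, \<nabla>u)\<close>, again extended by zero;
  the second component is the weak gradient and hence determined by the first.
  The norm of the product type is then the norm of \<open>H\<^sup>1\<close>, the seminorm of \<open>v\<close> is
  \<open>norm (snd v)\<close>, and the embedding of \<open>V\<close> into \<open>H\<close> is \<open>fst\<close>.
\<close>

type_synonym 'n sobolev = "(real^'n, real) L2 \<times> (real^'n, real^'n) L2"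

definition H10 :: "(real^'n) set \<Rightarrow> 'n::finite sobolev set" where
  "H10 \<Omega> = closure ((\<lambda>\<phi>. (abs_L2 \<phi>, abs_L2 (gradient \<phi>))) ` test_functions \<Omega>)"


section \<open>Bilinear forms\<close>

type_synonym 'n form = "'n sobolev \<Rightarrow> 'n sobolev \<Rightarrow> real"

definition Linf_symmetric_field :: "(real^'n) set \<Rightarrow> (real^'n \<Rightarrow> real^'n^'n) \<Rightarrow> bool" where
  "Linf_symmetric_field \<Omega> A \<longleftrightarrow>
     A \<in> borel_measurable (lebesgue_on \<Omega>) \<and>
     (\<exists>M. AE x in lebesgue_on \<Omega>. norm (A x) \<le> M) \<and>
     (AE x in lebesgue_on \<Omega>. transpose (A x) = A x)"

definition diffusion_form ::
    "(real^'n) set \<Rightarrow> (real^'n \<Rightarrow> real^'n^'n) \<Rightarrow> 'n::finite form" where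
  "diffusion_form \<Omega> A w v =
     (\<integral>x. (A x *v rep_L2 (snd w) x) \<bullet> rep_L2 (snd v) x \<partial>lebesgue_on \<Omega>)"

definition bilinear_on :: "'v::real_vector set \<Rightarrow> ('v \<Rightarrow> 'v \<Rightarrow> real) \<Rightarrow> bool" where
  "bilinear_on V a \<longleftrightarrow>
     (\<forall>u\<in>V. \<forall>v\<in>V. \<forall>w\<in>V. a (u + v) w = a u w + a v w \<and> a w (u + v) = a w u + a w v) \<and>
     (\<forall>c. \<forall>v\<in>V. \<forall>w\<in>V. a (c *\<^sub>R v) w = c * a v w \<and> a v (c *\<^sub>R w) = c * a v w)"

definition symmetric_on :: "'v set \<Rightarrow> ('v \<Rightarrow> 'v \<Rightarrow> real) \<Rightarrow> bool" where
  "symmetric_on V a \<longleftrightarrow> (\<forall>v\<in>V. \<forall>w\<in>V. a v w = a w v)"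

definition bounded_on :: "'v::real_normed_vector set \<Rightarrow> ('v \<Rightarrow> 'v \<Rightarrow> real) \<Rightarrow> bool" where
  "bounded_on V a \<longleftrightarrow> (\<exists>C>0. \<forall>v\<in>V. \<forall>w\<in>V. \<bar>a v w\<bar> \<le> C * norm v * norm w)"

definition coercive_on :: "'n::finite sobolev set \<Rightarrow> 'n form \<Rightarrow> bool" where
  "coercive_on V a \<longleftrightarrow> (\<exists>\<beta>>0. \<forall>v\<in>V. a v v \<ge> \<beta> * (norm (snd v))\<^sup>2)"


section \<open>The extended state space\<close>

text \<open>
  Elements of \<open>\<K>\<close> are represented by functions, to be identified when they agree \<open>\<nu>\<close>-almost
  everywhere (see \<open>eq_W\<close> below).  Since the Sobolev type is second countable, Borel measurability
  is strong measurability.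
\<close>

definition K_space :: "(real^'n) set \<Rightarrow> 'n::finite form \<Rightarrow> real measure \<Rightarrow> (real \<Rightarrow> 'n sobolev) set" where
  "K_space \<Omega> a1 \<nu> = {\<zeta> \<in> borel_measurable \<nu>.
     (\<forall>l\<in>space \<nu>. \<zeta> l \<in> H10 \<Omega>) \<and> integrable \<nu> (\<lambda>l. a1 (\<zeta> l) (\<zeta> l))}"

definition inner_K ::
    "'n::finite form \<Rightarrow> real measure \<Rightarrow> (real \<Rightarrow> 'n sobolev) \<Rightarrow> (real \<Rightarrow> 'n sobolev) \<Rightarrow> real" where
  "inner_K a1 \<nu> \<zeta> \<eta> = (\<integral>l. a1 (\<zeta> l) (\<eta> l) \<partial>\<nu>)"

type_synonym 'n state = "(real^'n, real) L2 \<times> (real \<Rightarrow> 'n sobolev)"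

definition W_space :: "(real^'n) set \<Rightarrow> 'n::finite form \<Rightarrow> real measure \<Rightarrow> 'n state set" where
  "W_space \<Omega> a1 \<nu> = L2_on \<Omega> \<times> K_space \<Omega> a1 \<nu>"

definition inner_W :: "'n::finite form \<Rightarrow> real measure \<Rightarrow> 'n state \<Rightarrow> 'n state \<Rightarrow> real" where
  "inner_W a1 \<nu> X Y = fst X \<bullet> fst Y + inner_K a1 \<nu> (snd X) (snd Y)"

definition norm_W :: "'n::finite form \<Rightarrow> real measure \<Rightarrow> 'n state \<Rightarrow> real" where
  "norm_W a1 \<nu> X = sqrt (inner_W a1 \<nu> X X)"

definition eq_W :: "real measure \<Rightarrow> 'h \<times> (real \<Rightarrow> 'v) \<Rightarrow> 'h \<times> (real \<Rightarrow> 'v) \<Rightarrow> bool" where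
  "eq_W \<nu> X Y \<longleftrightarrow> fst X = fst Y \<and> (AE l in \<nu>. snd X l = snd Y l)"

text \<open>
  The operator norm takes values in the extended reals, so that it is infinite
  (and not an arbitrary number) for an unbounded operator.
\<close>

definition opnorm_W ::
    "(real^'n) set \<Rightarrow> 'n::finite form \<Rightarrow> real measure \<Rightarrow> ('n state \<Rightarrow> 'n state) \<Rightarrow> ennreal" where
  "opnorm_W \<Omega> a1 \<nu> T =
     (SUP Y\<in>{Y \<in> W_space \<Omega> a1 \<nu>. norm_W a1 \<nu> Y \<le> 1}. ennreal (norm_W a1 \<nu> (T Y)))"


section \<open>The generator and its resolvent\<close>

definition J_op :: "real measure \<Rightarrow> (real \<Rightarrow> 'n::finite sobolev) \<Rightarrow> 'n sobolev" where
  "J_op \<nu> \<zeta> = (\<integral>l. \<zeta> l \<partial>\<nu>)"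

definition E_op :: "'n sobolev \<Rightarrow> real \<Rightarrow> 'n sobolev" where
  "E_op u = (\<lambda>_. u)"

definition Lambda_op :: "(real \<Rightarrow> 'n::finite sobolev) \<Rightarrow> real \<Rightarrow> 'n sobolev" where
  "Lambda_op \<zeta> = (\<lambda>l. l *\<^sub>R \<zeta> l)"

text \<open>
  A functional \<open>\<phi> \<in> V'\<close> belongs to \<open>H\<close> if it is \<open>v \<mapsto> \<langle>f, v\<rangle>\<^sub>H\<close> for some \<open>f \<in> H\<close>,
  which is unique because \<open>V\<close> is dense in \<open>H\<close>.
\<close>

definition represents_on ::
    "(real^'n) set \<Rightarrow> ('n::finite sobolev \<Rightarrow> real) \<Rightarrow> (real^'n, real) L2 \<Rightarrow> bool" where
  "represents_on \<Omega> \<phi> f \<longleftrightarrow> f \<in> L2_on \<Omega> \<and> (\<forall>v\<in>H10 \<Omega>. \<phi> v = f \<bullet> fst v)"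

definition in_H :: "(real^'n) set \<Rightarrow> ('n::finite sobolev \<Rightarrow> real) \<Rightarrow> bool" where
  "in_H \<Omega> \<phi> \<longleftrightarrow> (\<exists>f. represents_on \<Omega> \<phi> f)"

definition as_H :: "(real^'n) set \<Rightarrow> ('n::finite sobolev \<Rightarrow> real) \<Rightarrow> (real^'n, real) L2" where
  "as_H \<Omega> \<phi> = (THE f. represents_on \<Omega> \<phi> f)"

text \<open>The functional \<open>A\<^sub>0 u + A\<^sub>1 J \<zeta> \<in> V'\<close>.\<close>

definition stress ::
    "'n::finite form \<Rightarrow> 'n form \<Rightarrow> real measure \<Rightarrow> 'n sobolev \<times> (real \<Rightarrow> 'n sobolev) \<Rightarrow> 'n sobolev \<Rightarrow> real" where
  "stress a0 a1 \<nu> X = (\<lambda>v. a0 (fst X) v + a1 (J_op \<nu> (snd X)) v)"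

definition gen_dom ::
    "(real^'n) set \<Rightarrow> 'n::finite form \<Rightarrow> 'n form \<Rightarrow> real measure \<Rightarrow>
     ('n sobolev \<times> (real \<Rightarrow> 'n sobolev)) set" where
  "gen_dom \<Omega> a0 a1 \<nu> = {X \<in> H10 \<Omega> \<times> K_space \<Omega> a1 \<nu>.
     in_H \<Omega> (stress a0 a1 \<nu> X) \<and> E_op (fst X) - Lambda_op (snd X) \<in> K_space \<Omega> a1 \<nu>}"

definition gen ::
    "(real^'n) set \<Rightarrow> 'n::finite form \<Rightarrow> 'n form \<Rightarrow> real measure \<Rightarrow>
     'n sobolev \<times> (real \<Rightarrow> 'n sobolev) \<Rightarrow> 'n state" where
  "gen \<Omega> a0 a1 \<nu> X =
     (- as_H \<Omega> (stress a0 a1 \<nu> X), E_op (fst X) - Lambda_op (snd X))"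

text \<open>The inclusion of \<open>V \<times> \<K>\<close>, and in particular of the domain of the generator, into \<open>\<W>\<close>.\<close>

definition incl_W :: "'n::finite sobolev \<times> (real \<Rightarrow> 'n sobolev) \<Rightarrow> 'n state" where
  "incl_W X = (fst (fst X), snd X)"

definition densely_defined ::
    "(real^'n) set \<Rightarrow> 'n::finite form \<Rightarrow> 'n form \<Rightarrow> real measure \<Rightarrow> bool" where
  "densely_defined \<Omega> a0 a1 \<nu> \<longleftrightarrow>
     (\<forall>Y\<in>W_space \<Omega> a1 \<nu>. \<forall>e>0. \<exists>X\<in>gen_dom \<Omega> a0 a1 \<nu>. norm_W a1 \<nu> (incl_W X - Y) < e)"

definition m_dissipative ::
    "(real^'n) set \<Rightarrow> 'n::finite form \<Rightarrow> 'n form \<Rightarrow> real measure \<Rightarrow> bool" where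
  "m_dissipative \<Omega> a0 a1 \<nu> \<longleftrightarrow>
     (\<forall>X\<in>gen_dom \<Omega> a0 a1 \<nu>. inner_W a1 \<nu> (gen \<Omega> a0 a1 \<nu> X) (incl_W X) \<le> 0) \<and>
     (\<forall>Y\<in>W_space \<Omega> a1 \<nu>. \<exists>X\<in>gen_dom \<Omega> a0 a1 \<nu>. eq_W \<nu> (incl_W X - gen \<Omega> a0 a1 \<nu> X) Y)"

definition I_minus_gen_injective ::
    "(real^'n) set \<Rightarrow> 'n::finite form \<Rightarrow> 'n form \<Rightarrow> real measure \<Rightarrow> bool" where
  "I_minus_gen_injective \<Omega> a0 a1 \<nu> \<longleftrightarrow>
     (\<forall>X\<in>gen_dom \<Omega> a0 a1 \<nu>. \<forall>X'\<in>gen_dom \<Omega> a0 a1 \<nu>.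
        eq_W \<nu> (incl_W X - gen \<Omega> a0 a1 \<nu> X) (incl_W X' - gen \<Omega> a0 a1 \<nu> X') \<longrightarrow> eq_W \<nu> X X')"

text \<open>The operator \<open>(I - \<A>)\<^sup>-\<^sup>1\<close>, where the choice only concerns representatives of the \<open>\<K>\<close> component.\<close>

definition resolvent ::
    "(real^'n) set \<Rightarrow> 'n::finite form \<Rightarrow> 'n form \<Rightarrow> real measure \<Rightarrow> 'n state \<Rightarrow> 'n state" where
  "resolvent \<Omega> a0 a1 \<nu> Y =
     incl_W (SOME X. X \<in> gen_dom \<Omega> a0 a1 \<nu> \<and> eq_W \<nu> (incl_W X - gen \<Omega> a0 a1 \<nu> X) Y)"

definition perturbed_form :: "'n::finite form \<Rightarrow> 'n form \<Rightarrow> real \<Rightarrow> 'n form" where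
  "perturbed_form a0 av \<epsilon> = (\<lambda>w v. a0 w v + \<epsilon> * av w v)"

end

theory Submission
  imports Defs
begin

text \<open>
  Write \<open>V = H\<^sup>1\<^sub>0(\<Omega>)\<close> and \<open>H = L\<^sup>2(\<Omega>)\<close>.  The equation \<open>(I - \<A>)(u, \<zeta>) = (f, \<eta>)\<close> can be solved for the
  memory component pointwise in \<open>\<lambda>\<close>: \<open>\<zeta> = (u + \<eta>) / (1 + \<lambda>)\<close>.  What remains is a problem for \<open>u\<close> in
  \<open>V\<close> with the symmetric form \<open>\<langle>u, v\<rangle>\<^sub>H + a\<^sub>0(u, v) + m a\<^sub>1(u, v)\<close>, where \<open>m = \<integral> 1 / (1 + \<lambda>) d\<nu> > 0\<close>
  because \<open>\<nu>\<close> is finite and non-zero.  The term \<open>m a\<^sub>1\<close> makes this form coercive although \<open>a\<^sub>0\<close> need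
  not be, so Lax-Milgram yields the range condition (\<open>resolvent_solvable\<close>) and uniqueness.
  Dissipativity is the cancellation of the two coupling terms (\<open>gen_dissipative\<close>).

  The energy \<open>q(v) = \<parallel>v\<parallel>\<^sub>H\<^sup>2 + m a\<^sub>1(v, v)\<close> contains neither \<open>a\<^sub>0\<close> nor \<open>\<epsilon>\<close>, it dominates \<open>\<alpha> \<parallel>v\<parallel>\<^sub>V\<^sup>2\<close> for some
  \<open>\<alpha> > 0\<close>, and it controls everything.  Young's inequality gives \<open>q(u\<^sub>\<epsilon>) \<le> \<parallel>(f, \<eta>)\<parallel>\<^sup>2\<close>
  (\<open>resolvent_energy_le\<close>).  The difference \<open>d = u\<^sub>\<epsilon> - u\<^sub>0\<close> satisfies the unperturbed equation with right-hand
  side \<open>- \<epsilon> a\<^sub>v(u\<^sub>\<epsilon>, \<cdot>)\<close>, hence \<open>q(d) \<le> \<epsilon> C\<^sub>v \<parallel>u\<^sub>\<epsilon>\<parallel> \<parallel>d\<parallel> \<le> \<epsilon> (C\<^sub>v / \<alpha>) \<surd>q(u\<^sub>\<epsilon>) \<surd>q(d)\<close>.  Since the memory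
  components differ by \<open>d / (1 + \<lambda>)\<close>, the difference of the resolvents has norm at most \<open>\<surd>q(d)\<close>, and
  \<open>C\<^sub>v / \<alpha>\<close> is the required constant (\<open>resolvent_perturbation\<close>).

  Density of the domain (\<open>gen_densely_defined\<close>) is shown by approximation.  Both \<open>u\<close> and
  \<open>\<eta>\<close> are easily approximated; the condition that \<open>A\<^sub>0 u + A\<^sub>1 J \<zeta>\<close> belongs to \<open>H\<close> is then enforced by a
  small change of \<open>\<zeta>\<close>, which is possible because \<open>H\<close> is dense in \<open>V'\<close> (\<open>regular_elements_dense\<close>).

  These arguments rest on four facts about the Sobolev space: the Poincare inequality, so that \<open>a\<^sub>1\<close>
  controls the full norm of \<open>V\<close> and elements of \<open>\<K>\<close> are Bochner integrable; the density of \<open>V\<close> in \<open>H\<close>; the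
  injectivity of \<open>V \<rightarrow> H\<close>, that is, that the gradient component is determined by the function; and the
  boundedness of the diffusion forms.  The Poincare inequality and the injectivity use integration by parts
  for test functions; the density, and again the injectivity, use that test functions separate the points
  of \<open>L\<^sup>2(\<Omega>)\<close>, for which smooth bump functions are constructed explicitly.
\<close>

section \<open>Symmetric coercive forms on closed subspaces\<close>

lemma bilinear_onD:
  assumes "bilinear_on V a" "u \<in> V" "v \<in> V" "w \<in> V"
  shows "a (u + v) w = a u w + a v w" "a w (u + v) = a w u + a w v"
    "a (c *\<^sub>R v) w = c * a v w" "a v (c *\<^sub>R w) = c * a v w"
  using assms by (auto simp: bilinear_on_def)

lemma bilinear_on_diff:
  assumes "bilinear_on V a" "subspace V" "u \<in> V" "v \<in> V" "w \<in> V"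
  shows "a (u - v) w = a u w - a v w" "a w (u - v) = a w u - a w v"
proof -
  have m: "- v \<in> V" using assms by (simp add: subspace_neg)
  show "a (u - v) w = a u w - a v w"
    using bilinear_onD(1)[OF assms(1) assms(3) m assms(5)]
      bilinear_onD(3)[OF assms(1,4,4,5), of "-1"] by simp
  show "a w (u - v) = a w u - a w v"
    using bilinear_onD(2)[OF assms(1) assms(3) m assms(5)]
      bilinear_onD(4)[OF assms(1,4,5,4), of "-1"] bilinear_onD(4)[OF assms(1) assms(5) assms(5) assms(4), of "-1"]
    by simp
qed

lemma bounded_bilinear_imp_on:
  assumes "bounded_bilinear a"
  shows "bilinear_on V a" "bounded_on V a"
proof -
  interpret bounded_bilinear a by fact
  show "bilinear_on V a"
    by (auto simp: bilinear_on_def add_left add_right scaleR_left scaleR_right)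
  obtain K where "K > 0" "\<And>x y. norm (a x y) \<le> norm x * norm y * K"
    using pos_bounded by blast
  then show "bounded_on V a"
    unfolding bounded_on_def by (intro exI[of _ K]) (auto simp: mult_ac)
qed

text \<open>
  For a symmetric form the equation \<open>b u v = F v\<close> is the Euler equation of the energy
  \<open>b v v - 2 * F v\<close>.  By the parallelogram identity a minimising sequence is Cauchy, and the
  first variation of the energy vanishes along it in the limit.
\<close>

lemma symmetric_lax_milgram:
  fixes V :: "'a::{real_inner, complete_space} set"
  assumes V: "subspace V" "closed V"
    and b: "bilinear_on V b" "symmetric_on V b" "bounded_on V b"
    and c: "c > 0" "\<And>v. v \<in> V \<Longrightarrow> c * (norm v)\<^sup>2 \<le> b v v"
    and F: "\<And>u v. u \<in> V \<Longrightarrow> v \<in> V \<Longrightarrow> F (u + v) = F u + F v"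
      "\<And>r v. v \<in> V \<Longrightarrow> F (r *\<^sub>R v) = r * F v" "\<And>v. v \<in> V \<Longrightarrow> \<bar>F v\<bar> \<le> K * norm v"
  shows "\<exists>u\<in>V. \<forall>v\<in>V. b u v = F v"
proof -
  define \<Phi> where "\<Phi> v = b v v - 2 * F v" for v
  obtain C where C: "C > 0" "\<And>v w. v \<in> V \<Longrightarrow> w \<in> V \<Longrightarrow> \<bar>b v w\<bar> \<le> C * norm v * norm w"
    using b(3) unfolding bounded_on_def by blast
  note bD = bilinear_onD[OF b(1)]
  have sym: "b v w = b w v" if "v \<in> V" "w \<in> V" for v w
    using b(2) that by (simp add: symmetric_on_def)
  have line: "\<Phi> (u + t *\<^sub>R v) = \<Phi> u + 2 * t * (b u v - F v) + t\<^sup>2 * b v v"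
    if "u \<in> V" "v \<in> V" for u v t
  proof -
    have tv: "t *\<^sub>R v \<in> V" using that V(1) by (simp add: subspace_scale)
    have utv: "u + t *\<^sub>R v \<in> V" using that(1) tv V(1) by (simp add: subspace_add)
    have "b (u + t *\<^sub>R v) (u + t *\<^sub>R v) = b u u + t * b u v + t * b v u + t * (t * b v v)"
      using bD(1)[OF that(1) tv utv] bD(2)[OF that(1) tv that(1)] bD(2)[OF that(1) tv tv]
        bD(3)[OF that(2,2,1), of t] bD(4)[OF that(1,1,2), of t] bD(3)[OF that(2,2) tv, of t]
        bD(4)[OF that(2,2,2), of t] by (simp add: algebra_simps)
    then show ?thesis
      using F(1)[OF that(1) tv] F(2)[OF that(2), of t] sym[OF that]
      by (simp add: \<Phi>_def algebra_simps power2_eq_square)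
  qed
  have bdd: "- (K\<^sup>2 / c) \<le> \<Phi> v" if "v \<in> V" for v
  proof -
    have "0 \<le> (c * norm v - K)\<^sup>2" by simp
    then have "0 \<le> (c * (norm v)\<^sup>2 - 2 * (K * norm v) + K\<^sup>2 / c) * c"
      using c(1) by (simp add: power2_eq_square algebra_simps)
    then have "0 \<le> c * (norm v)\<^sup>2 - 2 * (K * norm v) + K\<^sup>2 / c"
      using c(1) by (simp add: zero_le_mult_iff)
    then show ?thesis
      using c(2)[OF that] F(3)[OF that] by (simp add: \<Phi>_def abs_le_iff)
  qed
  have zero: "0 \<in> V" using V(1) by (rule subspace_0)
  define I where "I = Inf (\<Phi> ` V)"
  have I_le: "I \<le> \<Phi> v" if "v \<in> V" for v
    unfolding I_def using that bdd by (intro cInf_lower bdd_belowI2[of _ "- (K\<^sup>2 / c)"]) auto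
  have "\<exists>v\<in>V. \<Phi> v < I + 1 / real (Suc n)" for n
  proof -
    have "Inf (\<Phi> ` V) < I + 1 / real (Suc n)" by (simp add: I_def)
    then show ?thesis
      using cInf_lessD[of "\<Phi> ` V"] zero by blast
  qed
  then obtain u where u: "\<And>n. u n \<in> V" "\<And>n. \<Phi> (u n) < I + 1 / real (Suc n)"
    by metis
  \<comment> \<open>The parallelogram identity, with the midpoint written as \<open>u n + d / 2\<close>.\<close>
  have close: "c * (norm (u m - u n))\<^sup>2 \<le> 2 / real (Suc m) + 2 / real (Suc n)" for m n
  proof -
    define d where "d = u m - u n"
    have d: "d \<in> V" using u(1) V(1) by (simp add: d_def subspace_diff)
    have mid: "u n + (1/2) *\<^sub>R d \<in> V" using u(1) d V(1) by (simp add: subspace_add subspace_scale)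
    have "\<Phi> (u m) = \<Phi> (u n) + 2 * (b (u n) d - F d) + b d d"
      using line[OF u(1)[of n] d, of 1] by (simp add: d_def)
    moreover have "\<Phi> (u n + (1/2) *\<^sub>R d) = \<Phi> (u n) + (b (u n) d - F d) + b d d / 4"
      using line[OF u(1)[of n] d, of "1/2"] by (simp add: power2_eq_square)
    ultimately have "b d d = 2 * \<Phi> (u m) + 2 * \<Phi> (u n) - 4 * \<Phi> (u n + (1/2) *\<^sub>R d)"
      by simp
    then have "b d d \<le> 2 * (1 / real (Suc m)) + 2 * (1 / real (Suc n))"
      using u(2)[of m] u(2)[of n] I_le[OF mid] by linarith
    then show ?thesis using c(2)[OF d] by (simp add: d_def)
  qed
  have "Cauchy u"
  proof (rule metric_CauchyI)
    fix e :: real assume e: "0 < e"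
    obtain N where N: "4 / (c * e\<^sup>2) < real N" using reals_Archimedean2 by blast
    have "dist (u m) (u n) < e" if "m \<ge> N" "n \<ge> N" for m n
    proof -
      have ce: "0 < c * e\<^sup>2" using c(1) e by simp
      have "2 / real (Suc k) < c * e\<^sup>2 / 2" if "k \<ge> N" for k
      proof -
        have "4 / (c * e\<^sup>2) < real (Suc k)" using N that by linarith
        then have "4 < real (Suc k) * (c * e\<^sup>2)" using ce by (simp only: pos_divide_less_eq)
        then show ?thesis by (simp add: field_simps)
      qed
      then have "c * (norm (u m - u n))\<^sup>2 < c * e\<^sup>2"
        using close[of m n] that by (smt (verit, best) field_sum_of_halves)
      then have "(norm (u m - u n))\<^sup>2 < e\<^sup>2" using c(1) by simp
      then show ?thesis using e by (simp add: dist_norm power2_less_imp_less)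
    qed
    then show "\<exists>M. \<forall>m\<ge>M. \<forall>n\<ge>M. dist (u m) (u n) < e" by blast
  qed
  then obtain x where x: "u \<longlonglongrightarrow> x"
    using Cauchy_convergent convergent_def by blast
  have xV: "x \<in> V" by (rule closed_sequentially[OF V(2) u(1) x])
  have "b x v = F v" if v: "v \<in> V" for v
  proof -
    have "(\<lambda>n. b (u n - x) v) \<longlonglongrightarrow> 0"
    proof (rule Lim_null_comparison)
      show "\<forall>\<^sub>F n in sequentially. norm (b (u n - x) v) \<le> C * norm (u n - x) * norm v"
        using C(2)[OF subspace_diff[OF V(1) u(1) xV] v] by (auto intro!: always_eventually)
      have "(\<lambda>n. C * norm (u n - x) * norm v) \<longlonglongrightarrow> C * norm (x - x) * norm v"
        by (intro tendsto_intros x)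
      then show "(\<lambda>n. C * norm (u n - x) * norm v) \<longlonglongrightarrow> 0" by simp
    qed
    then have bl: "(\<lambda>n. b (u n) v) \<longlonglongrightarrow> b x v"
      using bilinear_on_diff(1)[OF b(1) V(1) u(1) xV v] by (simp add: LIM_zero_iff)
    have ineq: "0 \<le> 2 * t * (b x v - F v) + t\<^sup>2 * b v v" for t
    proof (rule LIMSEQ_le[OF tendsto_const])
      have "(\<lambda>n. 2 * t * (b (u n) v - F v) + t\<^sup>2 * b v v + 1 / real (Suc n)) \<longlonglongrightarrow>
          2 * t * (b x v - F v) + t\<^sup>2 * b v v + 0"
        using LIMSEQ_inverse_real_of_nat by (intro tendsto_intros bl) (simp add: inverse_eq_divide)
      then show "(\<lambda>n. 2 * t * (b (u n) v - F v) + t\<^sup>2 * b v v + 1 / real (Suc n)) \<longlonglongrightarrow>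
          2 * t * (b x v - F v) + t\<^sup>2 * b v v" by simp
      have "0 \<le> 2 * t * (b (u n) v - F v) + t\<^sup>2 * b v v + 1 / real (Suc n)" for n
      proof -
        have "u n + t *\<^sub>R v \<in> V" using u(1) v V(1) by (simp add: subspace_add subspace_scale)
        then show ?thesis
          using I_le[of "u n + t *\<^sub>R v"] line[OF u(1)[of n] v, of t] u(2)[of n] by linarith
      qed
      then show "\<exists>N. \<forall>n\<ge>N. 0 \<le> 2 * t * (b (u n) v - F v) + t\<^sup>2 * b v v + 1 / real (Suc n)" by blast
    qed
    define B where "B = b v v + 1"
    define D where "D = b x v - F v"
    have "0 \<le> c * (norm v)\<^sup>2" using c(1) by simp
    then have B: "B > 0" "b v v \<le> B"
      using c(2)[OF v] by (auto simp: B_def)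
    \<comment> \<open>The quadratic \<open>2 * t * D + t\<^sup>2 * B\<close> takes the value \<open>- D\<^sup>2 / B\<close> at \<open>t = - D / B\<close>.\<close>
    have "0 \<le> 2 * (- D / B) * D + (- D / B)\<^sup>2 * b v v"
      using ineq[of "- D / B"] by (simp add: D_def)
    also have "\<dots> \<le> 2 * (- D / B) * D + (- D / B)\<^sup>2 * B"
      using B by (intro add_left_mono mult_left_mono) auto
    also have "\<dots> = - (D\<^sup>2 / B)"
      using B by (simp add: power2_eq_square field_simps)
    finally have "D\<^sup>2 \<le> 0" using B by (simp add: divide_le_0_iff)
    then show ?thesis by (simp add: D_def)
  qed
  then show ?thesis using xV by blast
qed

text \<open>Taking the inner product for the form gives the orthogonal projection.\<close>

lemma orthogonal_projection_exists:
  fixes V :: "'a::{real_inner, complete_space} set"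
  assumes "subspace V" "closed V"
  shows "\<exists>p\<in>V. \<forall>v\<in>V. (x - p) \<bullet> v = 0"
proof -
  have "\<exists>p\<in>V. \<forall>v\<in>V. p \<bullet> v = x \<bullet> v"
  proof (rule symmetric_lax_milgram[OF assms, where c = 1 and K = "norm x"])
    show "bilinear_on V (\<bullet>)" "bounded_on V (\<bullet>)"
      by (rule bounded_bilinear_imp_on[OF bounded_bilinear_inner])+
    show "symmetric_on V (\<bullet>)" by (simp add: symmetric_on_def inner_commute)
    show "\<bar>x \<bullet> v\<bar> \<le> norm x * norm v" for v by (rule Cauchy_Schwarz_ineq2)
  qed (auto simp: inner_add_right power2_norm_eq_inner)
  then show ?thesis by (metis inner_diff_left right_minus_eq)
qed

section \<open>Smooth functions with compact support\<close>

lemma C_k_SucD: "C_k (Suc k) f \<Longrightarrow> C_k k f"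
proof (induction k arbitrary: f)
  case 0
  then show ?case
    by (auto simp: gderiv_def continuous_on_eq_continuous_within
        intro: has_derivative_continuous)
next
  case (Suc k)
  then obtain g where "\<forall>x. GDERIV f x :> g x" "\<forall>i. C_k (Suc k) (\<lambda>x. g x $ i)" by auto
  with Suc.IH show ?case by auto
qed

lemma C_k_const: "C_k k (\<lambda>x :: real^'n. c)"
proof (induction k arbitrary: c)
  case (Suc k)
  have "\<forall>i. C_k k (\<lambda>x :: real^'n. (0 :: real^'n) $ i)" using Suc by simp
  then show ?case
    by (simp only: C_k.simps) (intro exI[of _ "\<lambda>x. 0"] conjI allI GDERIV_const, auto)
qed simp

lemma C_k_component: "C_k k (\<lambda>x :: real^'n. x $ i)"
proof (cases k)
  case (Suc j)
  have "GDERIV (\<lambda>x. x $ i) x :> axis i 1" for x :: "real^'n"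
    by (simp add: gderiv_def inner_axis bounded_linear_imp_has_derivative bounded_linear_vec_nth)
  then show ?thesis
    unfolding Suc by (simp only: C_k.simps) (intro exI[of _ "\<lambda>x. axis i 1"], auto intro: C_k_const)
qed (simp add: continuous_on_component)

lemma C_k_add: "C_k k f \<Longrightarrow> C_k k g \<Longrightarrow> C_k k (\<lambda>x. f x + g x)"
proof (induction k arbitrary: f g)
  case (Suc k)
  then obtain f' g' where "\<forall>x. GDERIV f x :> f' x" "\<forall>i. C_k k (\<lambda>x. f' x $ i)"
    "\<forall>x. GDERIV g x :> g' x" "\<forall>i. C_k k (\<lambda>x. g' x $ i)" by auto
  then show ?case
    using Suc.IH by (auto intro!: exI[of _ "\<lambda>x. f' x + g' x"] GDERIV_add)
qed (simp add: continuous_on_add)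

lemma C_k_mult: "C_k k f \<Longrightarrow> C_k k g \<Longrightarrow> C_k k (\<lambda>x. f x * g x)"
proof (induction k arbitrary: f g)
  case (Suc k)
  then obtain f' g' where fg: "\<forall>x. GDERIV f x :> f' x" "\<forall>i. C_k k (\<lambda>x. f' x $ i)"
    "\<forall>x. GDERIV g x :> g' x" "\<forall>i. C_k k (\<lambda>x. g' x $ i)" by auto
  have "C_k k f" "C_k k g" using Suc.prems C_k_SucD by auto
  with fg show ?case
    using Suc.IH by (auto intro!: exI[of _ "\<lambda>x. f x *\<^sub>R g' x + g x *\<^sub>R f' x"] GDERIV_mult C_k_add)
qed (simp add: continuous_on_mult)

lemma C_k_cmult: "C_k k f \<Longrightarrow> C_k k (\<lambda>x. c * f x)"
  by (intro C_k_mult C_k_const)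

lemma C_k_diff: "C_k k f \<Longrightarrow> C_k k g \<Longrightarrow> C_k k (\<lambda>x. f x - g x)"
  using C_k_add[OF _ C_k_cmult[of k g "-1"]] by simp

lemma C_k_sum: "(\<And>i. i \<in> I \<Longrightarrow> C_k k (f i)) \<Longrightarrow> C_k k (\<lambda>x. \<Sum>i\<in>I. f i x)"
  by (induction I rule: infinite_finite_induct) (auto intro: C_k_const C_k_add)

lemma C_k_prod: "(\<And>i. i \<in> I \<Longrightarrow> C_k k (f i)) \<Longrightarrow> C_k k (\<lambda>x. \<Prod>i\<in>I. f i x)"
  by (induction I rule: infinite_finite_induct) (auto intro: C_k_const C_k_mult)

lemma C_k_power: "C_k k f \<Longrightarrow> C_k k (\<lambda>x. f x ^ n)"
  by (induction n) (auto intro: C_k_const C_k_mult)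

text \<open>
  The functions \<open>p(1/x) exp(-1/x)\<close>, extended by zero to \<open>x \<le> 0\<close>, are closed under differentiation;
  this makes each of them infinitely differentiable.
\<close>

definition flat_exp :: "real poly \<Rightarrow> real \<Rightarrow> real" where
  "flat_exp p x = (if x \<le> 0 then 0 else poly p (1 / x) * exp (- (1 / x)))"

lemma flat_exp_tendsto_0: "(flat_exp p \<longlongrightarrow> 0) (at 0)"
proof -
  have "((\<lambda>y. \<Sum>i\<le>degree p. coeff p i * (y ^ i / exp y)) \<longlongrightarrow> (\<Sum>i\<le>degree p. coeff p i * 0)) at_top"
    by (intro tendsto_sum tendsto_mult tendsto_const tendsto_power_div_exp_0)
  then have "((\<lambda>y. poly p y * exp (- y)) \<longlongrightarrow> 0) at_top"
    by (simp add: poly_altdef sum_distrib_right exp_minus divide_inverse mult.assoc)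
  then have "((\<lambda>x. poly p (inverse x) * exp (- inverse x)) \<longlongrightarrow> 0) (at_right 0)"
    by (rule filterlim_compose[OF _ filterlim_inverse_at_top_right])
  then have "(flat_exp p \<longlongrightarrow> 0) (at_right 0)"
    by (rule Lim_transform_eventually)
      (auto simp: flat_exp_def eventually_at_filter inverse_eq_divide intro: always_eventually)
  moreover have "(flat_exp p \<longlongrightarrow> 0) (at_left 0)"
    by (rule Lim_transform_eventually[OF tendsto_const])
      (auto simp: flat_exp_def eventually_at_filter intro: always_eventually)
  ultimately show ?thesis by (simp add: filterlim_at_split)
qed

lemma flat_exp_deriv:
  "(flat_exp p has_real_derivative flat_exp ([:0, 0, 1:] * (p - pderiv p)) x) (at x)"
proof -
  consider "x > 0" | "x < 0" | "x = 0" by linarith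
  then show ?thesis
  proof cases
    case 1
    have "((\<lambda>x. poly p (1 / x) * exp (- (1 / x))) has_real_derivative
        flat_exp ([:0, 0, 1:] * (p - pderiv p)) x) (at x)"
      using 1
      by (auto intro!: derivative_eq_intros DERIV_chain2[OF poly_DERIV] simp: flat_exp_def field_simps power2_eq_square)
    then show ?thesis
      by (rule has_field_derivative_transform_within_open[of _ _ _ "{0<..}"]) (use 1 in \<open>auto simp: flat_exp_def\<close>)
  next
    case 2
    have "((\<lambda>x. 0) has_real_derivative flat_exp ([:0, 0, 1:] * (p - pderiv p)) x) (at x)"
      using 2 by (simp add: flat_exp_def)
    then show ?thesis
      by (rule has_field_derivative_transform_within_open[of _ _ _ "{..<0}"]) (use 2 in \<open>auto simp: flat_exp_def\<close>)
  next
    case 3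
    have "(\<lambda>h. (flat_exp p (0 + h) - flat_exp p 0) / h) = flat_exp ([:0, 1:] * p)"
      by (auto simp: flat_exp_def fun_eq_iff)
    then show ?thesis
      using flat_exp_tendsto_0[of "[:0, 1:] * p"] unfolding 3 DERIV_def by (simp add: flat_exp_def)
  qed
qed

lemma C_k_flat_exp: "C_k k g \<Longrightarrow> C_k k (\<lambda>x. flat_exp p (g x))"
proof (induction k arbitrary: p g)
  case 0
  have "continuous_on UNIV (flat_exp p)"
    using flat_exp_deriv by (meson DERIV_isCont continuous_at_imp_continuous_on)
  then show ?case
    using 0 continuous_on_compose2[of UNIV "flat_exp p" UNIV g] by simp
next
  case (Suc k)
  then obtain g' where g': "\<forall>x. GDERIV g x :> g' x" "\<forall>i. C_k k (\<lambda>x. g' x $ i)" by auto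
  have "C_k k g" using Suc.prems by (rule C_k_SucD)
  with g' Suc.IH show ?case
    by (auto intro!: exI[of _ "\<lambda>x. flat_exp ([:0, 0, 1:] * (p - pderiv p)) (g x) *\<^sub>R g' x"]
        GDERIV_DERIV_compose[OF _ flat_exp_deriv] C_k_mult simp del: mult_pCons_left)
qed

lemma test_functions_mono: "G \<subseteq> \<Omega> \<Longrightarrow> test_functions G \<subseteq> test_functions \<Omega>"
  by (auto simp: test_functions_def)

lemma test_functionsI:
  assumes "\<And>k. C_k k \<phi>" "\<And>x. x \<notin> K \<Longrightarrow> \<phi> x = 0" "compact K" "K \<subseteq> \<Omega>"
  shows "\<phi> \<in> test_functions \<Omega>"
proof -
  have "closure {x. \<phi> x \<noteq> 0} \<subseteq> K"
    using assms(2,3) by (intro closure_minimal compact_imp_closed) auto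
  then show ?thesis
    using assms compact_Int_closed[OF assms(3) closed_closure, of "{x. \<phi> x \<noteq> 0}"]
    by (auto simp: test_functions_def Int_absorb1)
qed

lemma bump_function_exists:
  fixes c :: "real^'n"
  assumes r: "r > 0" "cball c r \<subseteq> \<Omega>"
  shows "\<exists>\<phi>\<in>test_functions \<Omega>. (\<forall>x. 0 \<le> \<phi> x \<and> \<phi> x \<le> 1) \<and> (\<forall>x\<in>ball c r. 0 < \<phi> x)"
proof -
  define g where "g x = r\<^sup>2 - (\<Sum>i\<in>UNIV. (x $ i - c $ i)\<^sup>2)" for x
  have g: "g x = r\<^sup>2 - (dist c x)\<^sup>2" for x
  proof -
    have "(dist c x)\<^sup>2 = (norm (x - c))\<^sup>2" by (simp add: dist_norm norm_minus_commute)
    also have "\<dots> = (\<Sum>i\<in>UNIV. (x $ i - c $ i)\<^sup>2)"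
      by (simp add: norm_vec_def L2_set_def sum_nonneg)
    finally show ?thesis by (simp add: g_def)
  qed
  have pos: "g x > 0 \<longleftrightarrow> x \<in> ball c r" for x
    unfolding g using r(1) power_strict_mono[of "dist c x" r 2] power2_less_imp_less[of "dist c x" r]
    by auto
  have "(\<lambda>x. flat_exp 1 (g x)) \<in> test_functions \<Omega>"
  proof (rule test_functionsI)
    show "C_k k (\<lambda>x. flat_exp 1 (g x))" for k
      unfolding g_def by (intro C_k_flat_exp C_k_diff C_k_const C_k_sum C_k_power C_k_component)
    show "flat_exp 1 (g x) = 0" if "x \<notin> cball c r" for x
      using pos[of x] that by (auto simp: flat_exp_def)
  qed (use r in auto)
  moreover have "0 \<le> flat_exp 1 t \<and> flat_exp 1 t \<le> 1" "0 < t \<Longrightarrow> 0 < flat_exp 1 t" for t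
    by (auto simp: flat_exp_def)
  ultimately show ?thesis
    using pos by (intro bexI[of _ "\<lambda>x. flat_exp 1 (g x)"]) auto
qed

text \<open>
  If \<open>\<psi>\<^sub>0, \<psi>\<^sub>1, \<dots>\<close> are bump functions with values in \<open>[0, 1]\<close> whose positivity sets exhaust \<open>G\<close>, then
  \<open>1 - (\<Prod>j<n. (1 - \<psi>\<^sub>j)\<^sup>n)\<close> tends to one at every point of \<open>G\<close>.
\<close>

lemma test_functions_approx_indicator:
  fixes G :: "(real^'n) set"
  assumes "open G"
  obtains \<phi> where "\<And>n. \<phi> n \<in> test_functions G" "\<And>n x. 0 \<le> \<phi> n x \<and> \<phi> n x \<le> indicator G x"
    "\<And>x. (\<lambda>n. \<phi> n x) \<longlonglongrightarrow> indicator G x"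
proof (cases "G = {}")
  case True
  have "(\<lambda>_. 0) \<in> test_functions G"
    by (rule test_functionsI[of _ "{}"]) (auto intro: C_k_const)
  then show ?thesis using True by (intro that[of "\<lambda>_ _. 0"]) auto
next
  case False
  define B where "B = {\<psi> \<in> test_functions G. \<forall>x. 0 \<le> \<psi> x \<and> \<psi> x \<le> 1}"
  define P where "P \<psi> = {x. 0 < \<psi> x}" for \<psi> :: "real^'n \<Rightarrow> real"
  have "open (P \<psi>)" if "\<psi> \<in> B" for \<psi>
  proof -
    have "continuous_on UNIV \<psi>"
      using that by (auto simp: B_def test_functions_def dest: spec[of _ 0])
    then show ?thesis
      unfolding P_def by (intro open_Collect_less) auto
  qed
  then have "openin (top_of_set UNIV) S" if "S \<in> P ` B" for S
    using that by auto
  then obtain \<F> where \<F>: "\<F> \<subseteq> P ` B" "countable \<F>" "\<Union>\<F> = \<Union>(P ` B)"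
    by (rule Lindelof_openin)
  obtain B' where B': "B' \<subseteq> B" "countable B'" "\<F> = P ` B'"
    using \<F>(1,2) countable_subset_image[of \<F> P B] by auto
  have cover: "\<exists>\<psi>\<in>B'. 0 < \<psi> x" if "x \<in> G" for x
  proof -
    obtain r where "r > 0" "cball x r \<subseteq> G"
      using assms \<open>x \<in> G\<close> by (meson open_contains_cball)
    then obtain \<psi> where "\<psi> \<in> B" "x \<in> P \<psi>"
      using bump_function_exists[of r x G] by (auto simp: B_def P_def)
    then show ?thesis using \<F>(3) B'(3) by (auto simp: P_def)
  qed
  then have ne: "B' \<noteq> {}" using False by blast
  define \<psi> where "\<psi> = from_nat_into B'"
  have \<psi>: "\<psi> j \<in> B" for j
    unfolding \<psi>_def using from_nat_into[OF ne] B'(1) by blast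
  have \<psi>01: "0 \<le> \<psi> j x" "\<psi> j x \<le> 1" for j x
    using \<psi>[of j] by (auto simp: B_def)
  define K where "K j = closure {x. \<psi> j x \<noteq> 0}" for j
  have K: "compact (K j)" "K j \<subseteq> G" "x \<notin> K j \<Longrightarrow> \<psi> j x = 0" for j x
    using \<psi>[of j] closure_subset[of "{x. \<psi> j x \<noteq> 0}"] by (auto simp: B_def test_functions_def K_def)
  define \<phi> where "\<phi> n x = 1 - (\<Prod>j<n. (1 - \<psi> j x) ^ n)" for n x
  have prod01: "0 \<le> (\<Prod>j<n. (1 - \<psi> j x) ^ n)" "(\<Prod>j<n. (1 - \<psi> j x) ^ n) \<le> 1" for n x
    using \<psi>01 by (auto intro!: prod_nonneg prod_le_1 power_le_one)
  show ?thesis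
  proof (rule that[of \<phi>])
    show "\<phi> n \<in> test_functions G" for n
    proof (rule test_functionsI)
      show "C_k k (\<phi> n)" for k
        unfolding \<phi>_def using \<psi>
        by (intro C_k_diff C_k_prod C_k_power C_k_const) (auto simp: B_def test_functions_def)
      show "\<phi> n x = 0" if "x \<notin> (\<Union>j<n. K j)" for x
        using that K(3) by (simp add: \<phi>_def)
    qed (use K in auto)
    show "0 \<le> \<phi> n x \<and> \<phi> n x \<le> indicator G x" for n x
    proof (cases "x \<in> G")
      case True
      then show ?thesis using prod01[of x n] by (simp add: \<phi>_def)
    next
      case False
      then have "\<psi> j x = 0" for j using K by blast
      then show ?thesis using False by (simp add: \<phi>_def)
    qed
    show "(\<lambda>n. \<phi> n x) \<longlonglongrightarrow> indicator G x" for x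
    proof (cases "x \<in> G")
      case True
      then obtain j where j: "0 < \<psi> j x"
        using cover from_nat_into_surj[OF B'(2)] unfolding \<psi>_def by metis
      have "(\<lambda>n. \<Prod>j<n. (1 - \<psi> j x) ^ n) \<longlonglongrightarrow> 0"
      proof (rule tendsto_sandwich[OF _ _ tendsto_const])
        show "\<forall>\<^sub>F n in sequentially. 0 \<le> (\<Prod>j<n. (1 - \<psi> j x) ^ n)"
          using prod01 by (auto intro: always_eventually)
        show "\<forall>\<^sub>F n in sequentially. (\<Prod>j<n. (1 - \<psi> j x) ^ n) \<le> (1 - \<psi> j x) ^ n"
          using eventually_gt_at_top[of j]
        proof eventually_elim
          case (elim n)
          have "(\<Prod>i<n. (1 - \<psi> i x) ^ n) = (1 - \<psi> j x) ^ n * (\<Prod>i\<in>{..<n} - {j}. (1 - \<psi> i x) ^ n)"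
            using elim by (intro prod.remove) auto
          also have "\<dots> \<le> (1 - \<psi> j x) ^ n * 1"
            using \<psi>01 by (intro mult_left_mono prod_le_1) (auto intro!: power_le_one)
          finally show ?case by simp
        qed
        show "(\<lambda>n. (1 - \<psi> j x) ^ n) \<longlonglongrightarrow> 0"
          using j \<psi>01[of j x] by (intro LIMSEQ_realpow_zero) auto
      qed
      from tendsto_diff[OF tendsto_const[of 1] this] show ?thesis
        using True by (simp add: \<phi>_def)
    next
      case False
      then have "\<psi> j x = 0" for j using K by blast
      then show ?thesis using False by (simp add: \<phi>_def)
    qed
  qed
qed

section \<open>Gradients of test functions and integration by parts\<close>

lemma gradient_eq: "GDERIV f x :> D \<Longrightarrow> gradient f x = D"
  unfolding gradient_def
proof (rule the_equality)
  fix D' assume "GDERIV f x :> D" "GDERIV f x :> D'"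
  then have "(\<lambda>h. h \<bullet> D) = (\<lambda>h. h \<bullet> D')"
    unfolding gderiv_def by (rule has_derivative_unique)
  then have "h \<bullet> D = h \<bullet> D'" for h by (rule fun_cong)
  then have "(D - D') \<bullet> (D - D') = 0" by (simp add: inner_diff_right)
  then show "D' = D" by simp
qed

lemma GDERIV_gradient: "C_k (Suc 0) f \<Longrightarrow> GDERIV f x :> gradient f x"
  using gradient_eq by (metis C_k.simps(2))

lemma continuous_gradient:
  assumes "C_k (Suc 0) f"
  shows "continuous_on UNIV (gradient f)"
proof -
  obtain g where g: "\<And>x. GDERIV f x :> g x" "\<And>i. continuous_on UNIV (\<lambda>x. g x $ i)"
    using assms by auto
  have "gradient f = (\<lambda>x. \<chi> i. g x $ i)"
    using gradient_eq[OF g(1)] by (simp add: fun_eq_iff)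
  then show ?thesis
    using continuous_on_vec_lambda[OF g(2)] by (simp only:)
qed

lemma gradient_add:
  "C_k (Suc 0) f \<Longrightarrow> C_k (Suc 0) g \<Longrightarrow> gradient (\<lambda>x. f x + g x) = (\<lambda>x. gradient f x + gradient g x)"
  by (intro ext gradient_eq GDERIV_add GDERIV_gradient)

lemma gradient_mult:
  "C_k (Suc 0) f \<Longrightarrow> C_k (Suc 0) g \<Longrightarrow>
    gradient (\<lambda>x. f x * g x) = (\<lambda>x. f x *\<^sub>R gradient g x + g x *\<^sub>R gradient f x)"
  by (intro ext gradient_eq GDERIV_mult GDERIV_gradient)

lemma gradient_cmult:
  assumes "C_k (Suc 0) f"
  shows "gradient (\<lambda>x. c * f x) = (\<lambda>x. c *\<^sub>R gradient f x)"
proof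
  fix x
  have "GDERIV (\<lambda>x. c * f x) x :> c *\<^sub>R gradient f x + f x *\<^sub>R 0"
    by (intro GDERIV_mult GDERIV_const GDERIV_gradient assms)
  then show "gradient (\<lambda>x. c * f x) x = c *\<^sub>R gradient f x"
    using gradient_eq by fastforce
qed

lemma test_functionsD:
  assumes "\<phi> \<in> test_functions \<Omega>"
  shows "C_k k \<phi>" "continuous_on UNIV \<phi>" "GDERIV \<phi> x :> gradient \<phi> x"
    "continuous_on UNIV (gradient \<phi>)"
proof -
  show *: "C_k k \<phi>" for k using assms by (simp add: test_functions_def)
  show "continuous_on UNIV \<phi>" using *[of 0] by simp
  show "GDERIV \<phi> x :> gradient \<phi> x" by (rule GDERIV_gradient[OF *])
  show "continuous_on UNIV (gradient \<phi>)" by (rule continuous_gradient[OF *])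
qed

lemma test_function_support:
  assumes "\<phi> \<in> test_functions \<Omega>"
  obtains K where "compact K" "K \<subseteq> \<Omega>" "\<And>x. x \<notin> K \<Longrightarrow> \<phi> x = 0" "\<And>x. x \<notin> K \<Longrightarrow> gradient \<phi> x = 0"
proof
  define K where "K = closure {x. \<phi> x \<noteq> 0}"
  show "compact K" "K \<subseteq> \<Omega>" using assms by (auto simp: test_functions_def K_def)
  show zero: "\<phi> x = 0" if "x \<notin> K" for x
    using that closure_subset[of "{x. \<phi> x \<noteq> 0}"] by (auto simp: K_def)
  show "gradient \<phi> x = 0" if "x \<notin> K" for x
  proof (rule gradient_eq)
    have "open (- K)" unfolding K_def by (intro open_Compl closed_closure)
    have "FDERIV (\<lambda>x. 0) x :> (\<lambda>h. h \<bullet> 0)"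
      by simp
    then show "GDERIV \<phi> x :> 0"
      unfolding gderiv_def
      by (rule has_derivative_transform_within_open[OF _ \<open>open (- K)\<close>]) (use that zero in auto)
  qed
qed

lemma test_functions_mult:
  assumes "\<phi> \<in> test_functions \<Omega>" "\<And>k. C_k k \<psi>"
  shows "(\<lambda>x. \<phi> x * \<psi> x) \<in> test_functions \<Omega>"
proof -
  obtain K where K: "compact K" "K \<subseteq> \<Omega>" "\<And>x. x \<notin> K \<Longrightarrow> \<phi> x = 0"
    using test_function_support[OF assms(1)] by metis
  show ?thesis
    by (rule test_functionsI[of _ K])
      (use K assms(2) test_functionsD(1)[OF assms(1)] in \<open>auto intro: C_k_mult\<close>)
qed

lemma test_functions_add:
  assumes "\<phi> \<in> test_functions \<Omega>" "\<psi> \<in> test_functions \<Omega>"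
  shows "(\<lambda>x. \<phi> x + \<psi> x) \<in> test_functions \<Omega>"
proof -
  obtain K where K: "compact K" "K \<subseteq> \<Omega>" "\<And>x. x \<notin> K \<Longrightarrow> \<phi> x = 0"
    using test_function_support[OF assms(1)] by metis
  obtain L where L: "compact L" "L \<subseteq> \<Omega>" "\<And>x. x \<notin> L \<Longrightarrow> \<psi> x = 0"
    using test_function_support[OF assms(2)] by metis
  show ?thesis
    by (rule test_functionsI[of _ "K \<union> L"])
      (use K L test_functionsD(1)[OF assms(1)] test_functionsD(1)[OF assms(2)] in \<open>auto intro: C_k_add\<close>)
qed

lemma test_functions_cmult: "\<phi> \<in> test_functions \<Omega> \<Longrightarrow> (\<lambda>x. c * \<phi> x) \<in> test_functions \<Omega>"
  using test_functions_mult[of \<phi> \<Omega> "\<lambda>_. c", OF _ C_k_const] by (simp add: mult.commute)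

lemma borel_measurable_lebesgue_continuous:
  fixes f :: "'a::euclidean_space \<Rightarrow> 'b::topological_space"
  shows "continuous_on UNIV f \<Longrightarrow> f \<in> borel_measurable lebesgue"
  by (simp add: measurable_completion borel_measurable_continuous_onI)

lemma compact_support_bounded:
  fixes f :: "'a::euclidean_space \<Rightarrow> 'b::real_normed_vector"
  assumes "continuous_on UNIV f" "compact K" "\<And>x. x \<notin> K \<Longrightarrow> f x = 0"
  obtains M where "M \<ge> 0" "\<And>x. norm (f x) \<le> indicator K x * M"
proof -
  have "bounded (f ` K)"
    using assms(1,2) by (intro compact_imp_bounded compact_continuous_image) (auto elim: continuous_on_subset)
  then obtain M where "\<And>x. x \<in> K \<Longrightarrow> norm (f x) \<le> M" by (auto simp: bounded_iff)
  then have "norm (f x) \<le> indicator K x * \<bar>M\<bar>" for x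
    using assms(3)[of x] by (cases "x \<in> K") (auto intro: order_trans[OF _ abs_ge_self])
  then show ?thesis by (intro that[of "\<bar>M\<bar>"]) auto
qed

lemma compact_support_integrable:
  fixes f :: "'a::euclidean_space \<Rightarrow> 'b::euclidean_space"
  assumes "continuous_on UNIV f" "compact K" "\<And>x. x \<notin> K \<Longrightarrow> f x = 0"
  shows "integrable lebesgue f" "sq_integrable f"
proof -
  obtain M where M: "M \<ge> 0" "\<And>x. norm (f x) \<le> indicator K x * M"
    using compact_support_bounded[OF assms] by blast
  have K: "K \<in> sets lebesgue" "emeasure lebesgue K < \<infinity>"
    using assms(2) emeasure_compact_finite[of K] by (auto simp: borel_compact)
  note meas = borel_measurable_lebesgue_continuous[OF assms(1)]
  show "integrable lebesgue f"
    by (rule Bochner_Integration.integrable_bound[of _ "\<lambda>x. indicator K x * M"])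
      (use K M meas in \<open>auto intro: integrable_real_indicator\<close>)
  show "sq_integrable f"
    by (rule sq_integrable_bound[OF meas indicator_sq_integrable[OF K, of M]])
      (use M in \<open>auto intro!: power_mono\<close>)
qed

lemma test_function_sq_integrable:
  assumes "\<phi> \<in> test_functions \<Omega>"
  shows "sq_integrable \<phi>" "sq_integrable (gradient \<phi>)" "integrable lebesgue \<phi>" "integrable lebesgue (gradient \<phi>)"
proof -
  obtain K where K: "compact K" "\<And>x. x \<notin> K \<Longrightarrow> \<phi> x = 0" "\<And>x. x \<notin> K \<Longrightarrow> gradient \<phi> x = 0"
    using test_function_support[OF assms] by metis
  show "sq_integrable \<phi>" "sq_integrable (gradient \<phi>)" "integrable lebesgue \<phi>" "integrable lebesgue (gradient \<phi>)"
    using compact_support_integrable[OF test_functionsD(2)[OF assms] K(1,2)]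
      compact_support_integrable[OF test_functionsD(4)[OF assms] K(1,3)] by auto
qed

text \<open>
  The integral is invariant under translation, so the difference quotients of a test function have
  integral zero; they converge to the directional derivative under a common bounded, compactly
  supported majorant.
\<close>

lemma integral_gradient_eq_0:
  fixes \<phi> :: "real^'n \<Rightarrow> real"
  assumes \<phi>: "\<phi> \<in> test_functions \<Omega>"
  shows "(\<integral>x. gradient \<phi> x \<bullet> e \<partial>lebesgue) = 0"
proof -
  note cont = test_functionsD(2)[OF \<phi>] test_functionsD(4)[OF \<phi>]
  obtain K where K: "compact K" "\<And>x. x \<notin> K \<Longrightarrow> \<phi> x = 0" "\<And>x. x \<notin> K \<Longrightarrow> gradient \<phi> x = 0"
    using test_function_support[OF \<phi>] by metis
  obtain M where M: "M \<ge> 0" "\<And>x. norm (gradient \<phi> x) \<le> indicator K x * M"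
    using compact_support_bounded[OF cont(2) K(1,3)] by blast
  have M': "norm (gradient \<phi> x) \<le> M" for x
    using M(1) M(2)[of x] by (cases "x \<in> K") auto
  have lip: "\<bar>\<phi> y - \<phi> x\<bar> \<le> M * norm (y - x)" for x y
  proof -
    have "norm (\<phi> y - \<phi> x) \<le> M * norm (y - x)"
    proof (rule differentiable_bound[of UNIV])
      show "FDERIV \<phi> z :> (\<lambda>h. h \<bullet> gradient \<phi> z)" for z
        using test_functionsD(3)[OF \<phi>, of z] by (simp add: gderiv_def)
      show "onorm (\<lambda>h. h \<bullet> gradient \<phi> z) \<le> M" for z
      proof (rule onorm_le)
        fix h
        have "norm (h \<bullet> gradient \<phi> z) \<le> norm h * norm (gradient \<phi> z)"
          using Cauchy_Schwarz_ineq2 by simp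
        also have "\<dots> \<le> norm h * M" by (intro mult_left_mono M') auto
        finally show "norm (h \<bullet> gradient \<phi> z) \<le> M * norm h" by (simp add: mult.commute)
      qed
    qed auto
    then show ?thesis by simp
  qed
  obtain R where R: "\<And>x. x \<in> K \<Longrightarrow> norm x \<le> R"
    using compact_imp_bounded[OF K(1)] by (auto simp: bounded_iff)
  define t where "t n = 1 / real (Suc n)" for n
  have t: "t n > 0" "t n \<le> 1" "t n \<noteq> 0" for n by (auto simp: t_def)
  have t0: "t \<longlonglongrightarrow> 0"
    unfolding t_def using LIMSEQ_inverse_real_of_nat by (simp add: inverse_eq_divide)
  define B where "B = cball (0 :: real^'n) (R + norm e)"
  define q where "q n x = (\<phi> (t n *\<^sub>R e + x) - \<phi> x) / t n" for n x
  have cont_shift: "continuous_on UNIV (\<lambda>x. \<phi> (c + x))" for c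
    by (intro continuous_on_compose2[OF cont(1)] continuous_intros) auto
  have q_bound: "norm (q n x) \<le> indicator B x * (M * norm e)" for n x
  proof (cases "x \<in> B")
    case True
    have "\<bar>\<phi> (t n *\<^sub>R e + x) - \<phi> x\<bar> \<le> M * (t n * norm e)"
      using lip[of "t n *\<^sub>R e + x" x] t[of n] by simp
    then show ?thesis using t[of n] True by (simp add: q_def field_simps)
  next
    case False
    then have x: "R + norm e < norm x" by (simp add: B_def)
    have "norm (t n *\<^sub>R e) \<le> norm e" using t[of n] by (simp add: mult_left_le_one_le)
    then have "R < norm (t n *\<^sub>R e + x)"
      using x norm_triangle_ineq2[of x "- (t n *\<^sub>R e)"] by (simp add: add.commute)
    then have "t n *\<^sub>R e + x \<notin> K" "x \<notin> K"
      using R x norm_ge_zero[of e] by fastforce+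
    then show ?thesis using K(2) False by (simp add: q_def)
  qed
  have q_lim: "(\<lambda>n. q n x) \<longlonglongrightarrow> gradient \<phi> x \<bullet> e" for x
  proof -
    have "((\<lambda>s. \<phi> (s *\<^sub>R e + x)) has_derivative (\<lambda>s. (s *\<^sub>R e) \<bullet> gradient \<phi> (0 *\<^sub>R e + x))) (at 0)"
      by (rule has_derivative_compose[of "\<lambda>s. s *\<^sub>R e + x" "\<lambda>s. s *\<^sub>R e" 0 UNIV \<phi>])
        (use test_functionsD(3)[OF \<phi>] in \<open>auto simp: gderiv_def intro!: derivative_eq_intros\<close>)
    then have "DERIV (\<lambda>s. \<phi> (s *\<^sub>R e + x)) 0 :> gradient \<phi> x \<bullet> e"
      by (simp add: has_field_derivative_def inner_commute mult_commute_abs)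
    then have "((\<lambda>s. (\<phi> (s *\<^sub>R e + x) - \<phi> x) / s) \<longlongrightarrow> gradient \<phi> x \<bullet> e) (at 0)"
      by (simp add: DERIV_def)
    moreover have "filterlim t (at 0) sequentially"
      using t t0 by (auto simp: filterlim_at less_imp_neq[symmetric] intro!: always_eventually)
    ultimately show ?thesis
      unfolding q_def by (rule filterlim_compose)
  qed
  have int: "integrable lebesgue \<phi>" by (rule test_function_sq_integrable[OF \<phi>])
  have shift: "integrable lebesgue (\<lambda>x. \<phi> (c + x))" "(\<integral>x. \<phi> (c + x) \<partial>lebesgue) = (\<integral>x. \<phi> x \<partial>lebesgue)" for c
  proof -
    have [measurable]: "\<phi> \<in> borel_measurable borel" "(\<lambda>x. \<phi> (c + x)) \<in> borel_measurable borel"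
      using cont(1) cont_shift by (auto intro: borel_measurable_continuous_onI)
    have "integrable lborel \<phi>" using int by (simp add: integrable_completion)
    then have "integrable (distr lborel borel ((+) c)) \<phi>" by (simp add: lborel_distr_plus)
    then have "integrable lborel (\<lambda>x. \<phi> (c + x))" by (subst (asm) integrable_distr_eq) auto
    then show "integrable lebesgue (\<lambda>x. \<phi> (c + x))" by (simp add: integrable_completion)
    have "(\<integral>x. \<phi> x \<partial>lborel) = (\<integral>x. \<phi> x \<partial>distr lborel borel ((+) c))" by (simp add: lborel_distr_plus)
    also have "\<dots> = (\<integral>x. \<phi> (c + x) \<partial>lborel)" by (rule integral_distr) auto
    finally show "(\<integral>x. \<phi> (c + x) \<partial>lebesgue) = (\<integral>x. \<phi> x \<partial>lebesgue)" by (simp add: integral_completion)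
  qed
  have q0: "integral\<^sup>L lebesgue (q n) = 0" for n
    unfolding q_def by (simp add: shift int)
  have "(\<lambda>n. integral\<^sup>L lebesgue (q n)) \<longlonglongrightarrow> (\<integral>x. gradient \<phi> x \<bullet> e \<partial>lebesgue)"
  proof (rule integral_dominated_convergence[where w = "\<lambda>x. indicator B x * (M * norm e)"])
    show "(\<lambda>x. gradient \<phi> x \<bullet> e) \<in> borel_measurable lebesgue"
      by (intro borel_measurable_lebesgue_continuous continuous_intros cont)
    show "q n \<in> borel_measurable lebesgue" for n
      unfolding q_def by (intro borel_measurable_lebesgue_continuous continuous_intros cont_shift cont) (use t in auto)
    show "integrable lebesgue (\<lambda>x. indicator B x * (M * norm e))"
      using emeasure_compact_finite[of B] by (simp add: B_def integrable_real_indicator)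
  qed (use q_lim q_bound in auto)
  then show ?thesis unfolding q0 by (simp add: LIMSEQ_const_iff)
qed

lemma integration_by_parts:
  fixes \<phi> \<psi> :: "real^'n \<Rightarrow> real"
  assumes \<phi>: "\<phi> \<in> test_functions \<Omega>" and \<psi>: "\<psi> \<in> test_functions \<Omega>'"
  shows "(\<integral>x. \<psi> x * (gradient \<phi> x \<bullet> e) \<partial>lebesgue) = - (\<integral>x. \<phi> x * (gradient \<psi> x \<bullet> e) \<partial>lebesgue)"
proof -
  have prod: "(\<lambda>x. \<phi> x * \<psi> x) \<in> test_functions \<Omega>"
    by (intro test_functions_mult \<phi> test_functionsD(1)[OF \<psi>])
  have int: "integrable lebesgue (\<lambda>x. g x \<bullet> (f x *\<^sub>R e))"
    if f: "f \<in> test_functions A" and g: "sq_integrable g" for f :: "real^'n \<Rightarrow> real" and g and A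
  proof (rule sq_integrable_inner[OF g])
    obtain K where K: "compact K" "\<And>x. x \<notin> K \<Longrightarrow> f x = 0"
      using test_function_support[OF f] by metis
    show "sq_integrable (\<lambda>x. f x *\<^sub>R e)"
      by (rule compact_support_integrable[OF _ K(1)])
        (use K test_functionsD(2)[OF f] in \<open>auto intro!: continuous_intros\<close>)
  qed
  have "0 = (\<integral>x. \<phi> x * (gradient \<psi> x \<bullet> e) + \<psi> x * (gradient \<phi> x \<bullet> e) \<partial>lebesgue)"
    using integral_gradient_eq_0[OF prod, of e]
    by (simp add: gradient_mult test_functionsD(1)[OF \<phi>] test_functionsD(1)[OF \<psi>] inner_add_left
        del: C_k.simps)
  also have "\<dots> = (\<integral>x. \<phi> x * (gradient \<psi> x \<bullet> e) \<partial>lebesgue) + (\<integral>x. \<psi> x * (gradient \<phi> x \<bullet> e) \<partial>lebesgue)"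
    using int[OF \<phi> test_function_sq_integrable(2)[OF \<psi>]] int[OF \<psi> test_function_sq_integrable(2)[OF \<phi>]]
    by (intro Bochner_Integration.integral_add) auto
  finally show ?thesis by simp
qed

section \<open>The Sobolev space\<close>

lemma inner_abs_L2:
  assumes "sq_integrable f" "sq_integrable g"
  shows "abs_L2 f \<bullet> abs_L2 g = (\<integral>x. f x \<bullet> g x \<partial>lebesgue)"
  unfolding inner_L2_def
proof (rule integral_cong_AE)
  show "AE x in lebesgue. rep_L2 (abs_L2 f) x \<bullet> rep_L2 (abs_L2 g) x = f x \<bullet> g x"
    using rep_abs_L2[OF assms(1)] rep_abs_L2[OF assms(2)] by eventually_elim simp
qed (use sq_integrable_inner[OF assms] in \<open>auto intro: borel_measurable_inner rep_measurable_L2\<close>)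

lemma inner_rep_abs_L2:
  "sq_integrable g \<Longrightarrow> f \<bullet> abs_L2 g = (\<integral>x. rep_L2 f x \<bullet> g x \<partial>lebesgue)"
  using inner_abs_L2[OF sq_integrable_rep] by (simp add: abs_rep_L2)

lemma norm_abs_L2_sq:
  "sq_integrable f \<Longrightarrow> (norm (abs_L2 f))\<^sup>2 = (\<integral>x. (norm (f x))\<^sup>2 \<partial>lebesgue)"
  by (simp add: power2_norm_eq_inner inner_abs_L2)

lemma norm_L2_sq: "(norm f)\<^sup>2 = (\<integral>x. (norm (rep_L2 f x))\<^sup>2 \<partial>lebesgue)"
  by (simp add: power2_norm_eq_inner inner_L2_def)

lemma integrable_norm_rep_L2: "integrable lebesgue (\<lambda>x. (norm (rep_L2 f x))\<^sup>2)"
  using sq_integrable_rep[of f] by (simp add: sq_integrable_def)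

definition outer_part ::
    "'a::euclidean_space set \<Rightarrow> ('a, 'b::euclidean_space) L2 \<Rightarrow> ('a, 'b) L2" where
  "outer_part \<Omega> g = abs_L2 (\<lambda>x. indicator (- \<Omega>) x *\<^sub>R rep_L2 g x)"

text \<open>
  A pointwise condition on representatives is awkward in limits.  Expressed by orthogonality
  to everything supported outside \<open>\<Omega>\<close>, it visibly defines a closed subspace.
\<close>

lemma L2_vanishing_outside_eq:
  fixes \<Omega> :: "'a::euclidean_space set"
  assumes "\<Omega> \<in> sets lebesgue"
  shows "{f :: ('a, 'b::euclidean_space) L2. AE x in lebesgue. x \<notin> \<Omega> \<longrightarrow> rep_L2 f x = 0} =
    {f. \<forall>g. f \<bullet> outer_part \<Omega> g = 0}"
proof -
  have [measurable]: "- \<Omega> \<in> sets lebesgue" using sets.compl_sets[OF assms(1)] by (simp add: Compl_eq_Diff_UNIV)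
  have sq: "sq_integrable (\<lambda>x. indicator (- \<Omega>) x *\<^sub>R rep_L2 g x)" for g :: "('a, 'b) L2"
  proof (rule sq_integrable_bound[OF _ integrable_norm_rep_L2[of g]])
    have [measurable]: "rep_L2 g \<in> borel_measurable lebesgue" by (rule rep_measurable_L2)
    show "(\<lambda>x. indicator (- \<Omega>) x *\<^sub>R rep_L2 g x) \<in> borel_measurable lebesgue" by measurable
  qed (auto simp: indicator_def)
  have inner: "f \<bullet> outer_part \<Omega> g = (\<integral>x. rep_L2 f x \<bullet> (indicator (- \<Omega>) x *\<^sub>R rep_L2 g x) \<partial>lebesgue)"
    for f g :: "('a, 'b) L2"
    unfolding outer_part_def by (rule inner_rep_abs_L2[OF sq])
  show ?thesis
  proof (intro set_eqI iffI; clarsimp)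
    fix f g :: "('a, 'b) L2"
    assume "AE x in lebesgue. x \<notin> \<Omega> \<longrightarrow> rep_L2 f x = 0"
    then show "f \<bullet> outer_part \<Omega> g = 0"
      unfolding inner by (intro integral_eq_zero_AE) (auto elim!: eventually_mono simp: indicator_def)
  next
    fix f :: "('a, 'b) L2"
    assume "\<forall>g. f \<bullet> outer_part \<Omega> g = 0"
    then have 0: "(\<integral>x. rep_L2 f x \<bullet> (indicator (- \<Omega>) x *\<^sub>R rep_L2 f x) \<partial>lebesgue) = 0"
      unfolding inner by blast
    have "integrable lebesgue (\<lambda>x. rep_L2 f x \<bullet> (indicator (- \<Omega>) x *\<^sub>R rep_L2 f x))"
      by (rule sq_integrable_inner[OF sq_integrable_rep sq])
    then have "AE x in lebesgue. rep_L2 f x \<bullet> (indicator (- \<Omega>) x *\<^sub>R rep_L2 f x) = 0"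
      using 0 by (subst (asm) integral_nonneg_eq_0_iff_AE) auto
    then show "AE x in lebesgue. x \<notin> \<Omega> \<longrightarrow> rep_L2 f x = 0"
      by (rule eventually_mono) (auto simp: indicator_def)
  qed
qed

lemma L2_vanishing_outside_subspace:
  fixes \<Omega> :: "'a::euclidean_space set"
  assumes "\<Omega> \<in> sets lebesgue"
  shows "subspace {f :: ('a, 'b::euclidean_space) L2. AE x in lebesgue. x \<notin> \<Omega> \<longrightarrow> rep_L2 f x = 0}"
    "closed {f :: ('a, 'b) L2. AE x in lebesgue. x \<notin> \<Omega> \<longrightarrow> rep_L2 f x = 0}"
proof -
  show "subspace {f :: ('a, 'b) L2. AE x in lebesgue. x \<notin> \<Omega> \<longrightarrow> rep_L2 f x = 0}"
    unfolding L2_vanishing_outside_eq[OF assms] by (rule subspaceI) (auto simp: inner_add_left)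
  show "closed {f :: ('a, 'b) L2. AE x in lebesgue. x \<notin> \<Omega> \<longrightarrow> rep_L2 f x = 0}"
    unfolding L2_vanishing_outside_eq[OF assms]
    by (intro closed_Collect_all closed_Collect_eq continuous_on_inner continuous_on_id continuous_on_const)
qed

lemma L2_on_subspace: "open \<Omega> \<Longrightarrow> subspace (L2_on \<Omega>)"
  unfolding L2_on_def by (rule L2_vanishing_outside_subspace) auto

text \<open>
  Indicators of open subsets of \<open>\<Omega>\<close> are limits of test functions, and indicators of open sets span a
  dense subspace.  Where an open set leaves \<open>\<Omega>\<close>, the vanishing of \<open>f\<close> takes over.
\<close>

lemma test_functions_separate:
  fixes \<Omega> :: "(real^'n) set" and f :: "(real^'n, 'b::euclidean_space) L2"
  assumes "open \<Omega>" and f: "AE x in lebesgue. x \<notin> \<Omega> \<longrightarrow> rep_L2 f x = 0"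
    and orth: "\<And>\<phi> e. \<phi> \<in> test_functions \<Omega> \<Longrightarrow> e \<in> Basis \<Longrightarrow> f \<bullet> abs_L2 (\<lambda>x. \<phi> x *\<^sub>R e) = 0"
  shows "f = 0"
proof -
  define S where "S = {g. f \<bullet> g = 0}"
  have S: "subspace S" "closed S"
    unfolding S_def by (auto intro!: subspaceI closed_Collect_eq continuous_intros simp: inner_add_right)
  obtain W :: "(real^'n) set set" where W: "countable W" "topological_basis W"
    using ex_countable_basis by blast
  have "S = UNIV"
  proof (rule L2_dense[OF S W(2,1)])
    fix F :: "(real^'n) set set" and e :: 'b
    assume F: "finite F" "F \<subseteq> W" "emeasure lebesgue (\<Union>F) < \<infinity>" and e: "e \<in> Basis"
    define G where "G = \<Union>F \<inter> \<Omega>"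
    have op: "open (\<Union>F)" using F(2) topological_basis_open[OF W(2)] by (intro open_Union) blast
    then have "open G" using assms(1) by (simp add: G_def open_Int)
    have fin: "emeasure lebesgue G < \<infinity>"
      using emeasure_mono[of G "\<Union>F" lebesgue] F(3) op by (auto simp: G_def intro: le_less_trans)
    have Gm: "G \<in> sets lebesgue" "\<Union>F \<in> sets lebesgue" using op \<open>open G\<close> by auto
    obtain \<phi> where \<phi>: "\<And>n. \<phi> n \<in> test_functions G" "\<And>n x. 0 \<le> \<phi> n x \<and> \<phi> n x \<le> indicator G x"
      "\<And>x. (\<lambda>n. \<phi> n x) \<longlonglongrightarrow> indicator G x"
      using test_functions_approx_indicator[OF \<open>open G\<close>] by blast
    have "(\<lambda>n. abs_L2 (\<lambda>x. \<phi> n x *\<^sub>R e)) \<longlonglongrightarrow> abs_L2 (\<lambda>x. indicator G x *\<^sub>R e)"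
    proof (rule abs_L2_dominated(3)[OF _ _ indicator_sq_integrable[OF Gm(1) fin, of "norm e"]])
      show "(\<lambda>x. \<phi> n x *\<^sub>R e) \<in> borel_measurable lebesgue" for n
        by (intro borel_measurable_lebesgue_continuous continuous_intros test_functionsD(2)[OF \<phi>(1)])
      show "(\<lambda>x. indicator G x *\<^sub>R e) \<in> borel_measurable lebesgue" using Gm by measurable
      show "norm (\<phi> n x *\<^sub>R e) \<le> indicator G x * norm e" for n x
        using \<phi>(2)[of n x] by (simp add: mult_right_mono)
      show "(\<lambda>n. \<phi> n x *\<^sub>R e) \<longlonglongrightarrow> indicator G x *\<^sub>R e" for x by (intro tendsto_intros \<phi>(3))
    qed
    note lim = this
    have "abs_L2 (\<lambda>x. \<phi> n x *\<^sub>R e) \<in> S" for n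
      unfolding S_def using orth[OF _ e] \<phi>(1)[of n] test_functions_mono[of G \<Omega>] by (auto simp: G_def)
    then have "indicator_L2 G e \<in> S"
      unfolding indicator_L2_def by (rule closed_sequentially[OF S(2) _ lim])
    moreover have "f \<bullet> indicator_L2 (\<Union>F) e = f \<bullet> indicator_L2 G e"
      unfolding indicator_L2_def inner_rep_abs_L2[OF sq_integrable_indicator[OF Gm(1) fin]]
        inner_rep_abs_L2[OF sq_integrable_indicator[OF Gm(2) F(3)]]
    proof (rule integral_cong_AE)
      show "AE x in lebesgue. rep_L2 f x \<bullet> (indicator (\<Union>F) x *\<^sub>R e) = rep_L2 f x \<bullet> (indicator G x *\<^sub>R e)"
        using f by eventually_elim (auto simp: G_def indicator_def)
    qed (use Gm in measurable)
    ultimately show "indicator_L2 (\<Union>F) e \<in> S" by (simp add: S_def)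
  qed
  then have "f \<in> S" by simp
  then show ?thesis by (simp add: S_def)
qed

definition sobolev_embed :: "(real^'n \<Rightarrow> real) \<Rightarrow> 'n::finite sobolev" where
  "sobolev_embed \<phi> = (abs_L2 \<phi>, abs_L2 (gradient \<phi>))"

lemma H10_eq: "H10 \<Omega> = closure (sobolev_embed ` test_functions \<Omega>)"
  by (simp add: H10_def sobolev_embed_def[abs_def])

lemma H10_closed: "closed (H10 \<Omega>)"
  by (simp add: H10_eq)

lemma sobolev_embed_in_H10: "\<phi> \<in> test_functions \<Omega> \<Longrightarrow> sobolev_embed \<phi> \<in> H10 \<Omega>"
  unfolding H10_eq by (intro set_mp[OF closure_subset] imageI)

text \<open>Closed conditions on \<open>H\<^sup>1\<^sub>0\<close> need only be checked on test functions.\<close>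

lemma H10_induct:
  assumes "v \<in> H10 \<Omega>" "closed {v. P v}" "\<And>\<phi>. \<phi> \<in> test_functions \<Omega> \<Longrightarrow> P (sobolev_embed \<phi>)"
  shows "P v"
proof -
  have "H10 \<Omega> \<subseteq> {v. P v}"
    unfolding H10_eq using assms(2,3) by (intro closure_minimal) auto
  then show ?thesis using assms(1) by auto
qed

lemma H10_subspace:
  fixes \<Omega> :: "(real^'n) set"
  shows "subspace (H10 \<Omega>)"
  unfolding H10_eq
proof (rule subspace_closure, rule subspaceI)
  have z: "(\<lambda>_. 0) \<in> test_functions \<Omega>"
    by (rule test_functionsI[of _ "{}"]) (auto intro: C_k_const)
  have "gradient (\<lambda>_ :: real^'n. 0) = (\<lambda>_. 0)" by (intro ext gradient_eq GDERIV_const)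
  then have "sobolev_embed (\<lambda>_. 0) = (0 :: 'n sobolev)" by (simp only: sobolev_embed_def zero_L2_def zero_prod_def)
  then show "0 \<in> sobolev_embed ` test_functions \<Omega>" using z by (rule image_eqI[OF sym])
next
  fix x y assume "x \<in> sobolev_embed ` test_functions \<Omega>" "y \<in> sobolev_embed ` test_functions \<Omega>"
  then obtain \<phi> \<psi> where xy: "\<phi> \<in> test_functions \<Omega>" "\<psi> \<in> test_functions \<Omega>"
    "x = sobolev_embed \<phi>" "y = sobolev_embed \<psi>" by auto
  have "sobolev_embed (\<lambda>x. \<phi> x + \<psi> x) = x + y"
    using xy test_function_sq_integrable[OF xy(1)] test_function_sq_integrable[OF xy(2)]
    by (simp add: sobolev_embed_def gradient_add test_functionsD(1) abs_L2_add del: C_k.simps)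
  then show "x + y \<in> sobolev_embed ` test_functions \<Omega>"
    using test_functions_add[OF xy(1,2)] by (metis image_eqI)
next
  fix c x assume "x \<in> sobolev_embed ` test_functions \<Omega>"
  then obtain \<phi> where x: "\<phi> \<in> test_functions \<Omega>" "x = sobolev_embed \<phi>" by auto
  have "sobolev_embed (\<lambda>x. c * \<phi> x) = c *\<^sub>R x"
    using x test_function_sq_integrable[OF x(1)] abs_L2_scaleR[of \<phi> c]
    by (simp add: sobolev_embed_def gradient_cmult test_functionsD(1) abs_L2_scaleR del: C_k.simps)
  then show "c *\<^sub>R x \<in> sobolev_embed ` test_functions \<Omega>"
    using test_functions_cmult[OF x(1)] by (metis image_eqI)
qed

lemma test_function_vanishes_outside:
  fixes f :: "real^'n \<Rightarrow> 'b::euclidean_space"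
  assumes "sq_integrable f" "\<And>x. x \<notin> \<Omega> \<Longrightarrow> f x = 0"
  shows "AE x in lebesgue. x \<notin> \<Omega> \<longrightarrow> rep_L2 (abs_L2 f) x = 0"
  using rep_abs_L2[OF assms(1)] by eventually_elim (use assms(2) in auto)

lemma H10_vanishes_outside:
  assumes "open \<Omega>" "v \<in> H10 \<Omega>"
  shows "fst v \<in> L2_on \<Omega>" "AE x in lebesgue. x \<notin> \<Omega> \<longrightarrow> rep_L2 (snd v) x = 0"
proof -
  have \<Omega>: "\<Omega> \<in> sets lebesgue" using assms(1) by auto
  have sub: "\<phi> x = 0" "gradient \<phi> x = 0" if "\<phi> \<in> test_functions \<Omega>" "x \<notin> \<Omega>" for \<phi> x
    using that by (auto elim!: test_function_support)
  have cl: "closed {v. f v \<in> S}" if "closed S" "continuous_on UNIV f" for S and f :: "'a sobolev \<Rightarrow> ('c::topological_space)"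
    using closed_vimage[OF that] by (simp add: vimage_def)
  show "fst v \<in> L2_on \<Omega>"
  proof (rule H10_induct[OF assms(2)])
    show "closed {v :: 'a sobolev. fst v \<in> L2_on \<Omega>}"
      unfolding L2_on_def by (intro cl L2_vanishing_outside_subspace \<Omega> continuous_intros)
    show "fst (sobolev_embed \<phi>) \<in> L2_on \<Omega>" if "\<phi> \<in> test_functions \<Omega>" for \<phi>
      using test_function_vanishes_outside[OF test_function_sq_integrable(1)[OF that] sub(1)[OF that]]
      by (simp add: L2_on_def sobolev_embed_def)
  qed
  have "snd v \<in> {f. AE x in lebesgue. x \<notin> \<Omega> \<longrightarrow> rep_L2 f x = 0}"
  proof (rule H10_induct[OF assms(2)])
    show "closed {v :: 'a sobolev. snd v \<in> {f. AE x in lebesgue. x \<notin> \<Omega> \<longrightarrow> rep_L2 f x = 0}}"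
      by (intro cl L2_vanishing_outside_subspace \<Omega> continuous_intros)
    show "snd (sobolev_embed \<phi>) \<in> {f. AE x in lebesgue. x \<notin> \<Omega> \<longrightarrow> rep_L2 f x = 0}"
      if "\<phi> \<in> test_functions \<Omega>" for \<phi>
      using test_function_vanishes_outside[OF test_function_sq_integrable(2)[OF that] sub(2)[OF that]]
      by (simp add: sobolev_embed_def)
  qed
  then show "AE x in lebesgue. x \<notin> \<Omega> \<longrightarrow> rep_L2 (snd v) x = 0" by simp
qed

lemma H10_weak_gradient:
  fixes \<Omega> :: "(real^'n) set"
  assumes "v \<in> H10 \<Omega>" "\<psi> \<in> test_functions \<Omega>"
  shows "snd v \<bullet> abs_L2 (\<lambda>x. \<psi> x *\<^sub>R e) = - (fst v \<bullet> abs_L2 (\<lambda>x. gradient \<psi> x \<bullet> e))"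
proof (rule H10_induct[OF assms(1)])
  show "closed {v. snd v \<bullet> abs_L2 (\<lambda>x. \<psi> x *\<^sub>R e) = - (fst v \<bullet> abs_L2 (\<lambda>x. gradient \<psi> x \<bullet> e))}"
    by (intro closed_Collect_eq continuous_intros)
  fix \<phi> assume \<phi>: "\<phi> \<in> test_functions \<Omega>"
  obtain K where K: "compact K" "\<And>x. x \<notin> K \<Longrightarrow> \<psi> x = 0" "\<And>x. x \<notin> K \<Longrightarrow> gradient \<psi> x = 0"
    using test_function_support[OF assms(2)] by metis
  have "sq_integrable (\<lambda>x. \<psi> x *\<^sub>R e)"
    by (rule compact_support_integrable[OF _ K(1)])
      (use K test_functionsD(2)[OF assms(2)] in \<open>auto intro!: continuous_intros\<close>)
  moreover have "sq_integrable (\<lambda>x. gradient \<psi> x \<bullet> e)"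
    by (rule compact_support_integrable[OF _ K(1)])
      (use K test_functionsD(4)[OF assms(2)] in \<open>auto intro!: continuous_intros\<close>)
  ultimately show "snd (sobolev_embed \<phi>) \<bullet> abs_L2 (\<lambda>x. \<psi> x *\<^sub>R e) =
      - (fst (sobolev_embed \<phi>) \<bullet> abs_L2 (\<lambda>x. gradient \<psi> x \<bullet> e))"
    using integration_by_parts[OF \<phi> assms(2), of e] test_function_sq_integrable[OF \<phi>]
    by (simp add: sobolev_embed_def inner_abs_L2)
qed

text \<open>The weak gradient is determined by the function, so \<open>V\<close> embeds into \<open>H\<close>.\<close>

lemma H10_eq_0:
  fixes \<Omega> :: "(real^'n) set"
  assumes "open \<Omega>" "v \<in> H10 \<Omega>" "fst v = 0"
  shows "v = 0"
proof -
  have "snd v = 0"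
    by (rule test_functions_separate[OF assms(1) H10_vanishes_outside(2)[OF assms(1,2)]])
      (use H10_weak_gradient[OF assms(2)] assms(3) in simp)
  then show ?thesis using assms(3) by (simp add: prod_eq_iff)
qed

text \<open>
  Integrating \<open>\<partial>\<^sub>i (x\<^sub>i \<phi>\<^sup>2) = \<phi>\<^sup>2 + 2 x\<^sub>i \<phi> \<partial>\<^sub>i \<phi>\<close> shows \<open>\<parallel>\<phi>\<parallel>\<^sup>2 = - 2 \<integral> x\<^sub>i \<phi> \<partial>\<^sub>i \<phi>\<close>, and \<open>\<bar>x\<^sub>i\<bar>\<close> is
  bounded on the domain.
\<close>

lemma poincare_H10:
  fixes \<Omega> :: "(real^'n) set"
  assumes R: "R > 0" "\<And>x. x \<in> \<Omega> \<Longrightarrow> norm x \<le> R" and v: "v \<in> H10 \<Omega>"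
  shows "norm (fst v) \<le> 2 * R * norm (snd v)"
proof (rule H10_induct[OF v])
  show "closed {v :: 'n sobolev. norm (fst v) \<le> 2 * R * norm (snd v)}"
    by (intro closed_Collect_le continuous_intros)
  fix \<phi> assume \<phi>: "\<phi> \<in> test_functions \<Omega>"
  define i :: 'n where "i = (SOME i. True)"
  define e where "e = axis i (1 :: real)"
  note grad = test_functionsD(3)[OF \<phi>]
  have x\<phi>: "(\<lambda>x. \<phi> x * x $ i) \<in> test_functions \<Omega>"
    by (intro test_functions_mult \<phi> C_k_component)
  have gx: "gradient (\<lambda>x. x $ i) = (\<lambda>x. e)"
    by (intro ext gradient_eq)
      (simp add: gderiv_def e_def inner_axis bounded_linear_imp_has_derivative bounded_linear_vec_nth)
  have gx\<phi>: "gradient (\<lambda>x. \<phi> x * x $ i) x \<bullet> e = \<phi> x + x $ i * (gradient \<phi> x \<bullet> e)" for x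
    using gradient_mult[OF test_functionsD(1)[OF \<phi>] C_k_component, of i]
    by (simp add: gx inner_add_left del: C_k.simps) (simp add: e_def inner_axis_axis)
  note int = test_function_sq_integrable[OF \<phi>] test_function_sq_integrable[OF x\<phi>]
  have ge: "sq_integrable (\<lambda>x. gradient f x \<bullet> e)" if f: "f \<in> test_functions \<Omega>" for f
  proof -
    obtain K where K: "compact K" "\<And>x. x \<notin> K \<Longrightarrow> gradient f x = 0"
      using test_function_support[OF f] by metis
    show ?thesis
      by (rule compact_support_integrable[OF _ K(1)])
        (use K test_functionsD(4)[OF f] in \<open>auto intro!: continuous_intros\<close>)
  qed
  define A where "A = (\<integral>x. (\<phi> x)\<^sup>2 \<partial>lebesgue)"
  define B where "B = (\<integral>x. (norm (gradient \<phi> x))\<^sup>2 \<partial>lebesgue)"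
  define I where "I = (\<integral>x. (\<phi> x * x $ i) * (gradient \<phi> x \<bullet> e) \<partial>lebesgue)"
  have iA: "integrable lebesgue (\<lambda>x. (\<phi> x)\<^sup>2)"
    using sq_integrable_inner[OF int(1) int(1)] by (simp add: power2_eq_square)
  have iB: "integrable lebesgue (\<lambda>x. (norm (gradient \<phi> x))\<^sup>2)"
    using int(2) by (simp add: sq_integrable_def)
  have iI: "integrable lebesgue (\<lambda>x. (\<phi> x * x $ i) * (gradient \<phi> x \<bullet> e))"
    using sq_integrable_inner[OF int(5) ge[OF \<phi>]] by simp
  have "I = - (\<integral>x. \<phi> x * (\<phi> x + x $ i * (gradient \<phi> x \<bullet> e)) \<partial>lebesgue)"
    using integration_by_parts[OF \<phi> x\<phi>, of e] by (simp only: I_def gx\<phi>)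
  also have "(\<integral>x. \<phi> x * (\<phi> x + x $ i * (gradient \<phi> x \<bullet> e)) \<partial>lebesgue) =
      (\<integral>x. (\<phi> x)\<^sup>2 + (\<phi> x * x $ i) * (gradient \<phi> x \<bullet> e) \<partial>lebesgue)"
    by (simp add: algebra_simps power2_eq_square)
  also have "\<dots> = A + I" unfolding A_def I_def by (rule Bochner_Integration.integral_add[OF iA iI])
  finally have AI: "A = - 2 * I" by simp
  have "- 2 * I = (\<integral>x. - 2 * ((\<phi> x * x $ i) * (gradient \<phi> x \<bullet> e)) \<partial>lebesgue)"
    by (simp add: I_def)
  also have "\<dots> \<le> (\<integral>x. (1/2) * (\<phi> x)\<^sup>2 + 2 * R\<^sup>2 * (norm (gradient \<phi> x))\<^sup>2 \<partial>lebesgue)"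
  proof (rule integral_mono)
    fix x
    show "- 2 * ((\<phi> x * x $ i) * (gradient \<phi> x \<bullet> e)) \<le> (1/2) * (\<phi> x)\<^sup>2 + 2 * R\<^sup>2 * (norm (gradient \<phi> x))\<^sup>2"
    proof (cases "x \<in> \<Omega>")
      case True
      have "\<bar>x $ i\<bar> \<le> R" using R(2)[OF True] component_le_norm_cart[of x i] by simp
      moreover have "\<bar>gradient \<phi> x \<bullet> e\<bar> \<le> norm (gradient \<phi> x)"
        using component_le_norm_cart[of "gradient \<phi> x" i] by (simp add: e_def inner_axis)
      ultimately have "\<bar>x $ i * (gradient \<phi> x \<bullet> e)\<bar> \<le> R * norm (gradient \<phi> x)"
        unfolding abs_mult using R(1) by (intro mult_mono) auto
      then have "(x $ i * (gradient \<phi> x \<bullet> e))\<^sup>2 \<le> (R * norm (gradient \<phi> x))\<^sup>2"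
        by (rule power2_le_iff_abs_le[THEN iffD2, rotated]) (use R(1) in simp)
      \<comment> \<open>Half of this square is \<open>\<phi>\<^sup>2 / 2 + 2 \<phi> y + 2 y\<^sup>2\<close> with \<open>y = x\<^sub>i \<partial>\<^sub>i \<phi>\<close>.\<close>
      moreover have "0 \<le> (\<phi> x + 2 * (x $ i * (gradient \<phi> x \<bullet> e)))\<^sup>2" by simp
      ultimately show ?thesis
        by (simp add: power2_eq_square algebra_simps)
    next
      case False
      then have "\<phi> x = 0" using \<phi> by (auto elim!: test_function_support)
      then show ?thesis by simp
    qed
  qed (use iA iB iI in auto)
  also have "\<dots> = (1/2) * A + 2 * R\<^sup>2 * B"
    using iA iB by (simp add: A_def B_def)
  finally have "A \<le> 4 * R\<^sup>2 * B" using AI by (simp add: mult_ac)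
  then have "(norm (abs_L2 \<phi>))\<^sup>2 \<le> (2 * R * norm (abs_L2 (gradient \<phi>)))\<^sup>2"
    using int by (simp add: A_def B_def norm_abs_L2_sq power_mult_distrib)
  then have "norm (abs_L2 \<phi>) \<le> 2 * R * norm (abs_L2 (gradient \<phi>))"
    by (rule power2_le_imp_le) (use R(1) in simp)
  then show "norm (fst (sobolev_embed \<phi>)) \<le> 2 * R * norm (snd (sobolev_embed \<phi>))"
    by (simp add: sobolev_embed_def)
qed

lemma poincare_H10_norm:
  fixes \<Omega> :: "(real^'n) set"
  assumes "bounded \<Omega>"
  obtains C where "C > 0" "\<And>v. v \<in> H10 \<Omega> \<Longrightarrow> (norm v)\<^sup>2 \<le> C * (norm (snd v))\<^sup>2"
proof -
  obtain R where R: "R > 0" "\<And>x. x \<in> \<Omega> \<Longrightarrow> norm x \<le> R"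
    using assms by (auto simp: bounded_pos)
  have "(norm v)\<^sup>2 \<le> ((2 * R)\<^sup>2 + 1) * (norm (snd v))\<^sup>2" if "v \<in> H10 \<Omega>" for v :: "'n sobolev"
  proof -
    have "(norm (fst v))\<^sup>2 \<le> (2 * R * norm (snd v))\<^sup>2"
      by (intro power_mono poincare_H10[OF R that]) auto
    moreover have "(norm v)\<^sup>2 = (norm (fst v))\<^sup>2 + (norm (snd v))\<^sup>2"
      by (simp add: norm_prod_def)
    ultimately show ?thesis by (simp add: power_mult_distrib algebra_simps)
  qed
  moreover have "(2 * R)\<^sup>2 + 1 > 0" by (simp add: add_nonneg_pos)
  ultimately show ?thesis by (rule that[rotated])
qed

lemma H10_separates:
  assumes "open \<Omega>" "f \<in> L2_on \<Omega>" "\<And>v. v \<in> H10 \<Omega> \<Longrightarrow> f \<bullet> fst v = 0"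
  shows "f = 0"
proof (rule test_functions_separate[OF assms(1)])
  show "f \<bullet> abs_L2 (\<lambda>x. \<phi> x *\<^sub>R e) = 0" if "\<phi> \<in> test_functions \<Omega>" "e \<in> Basis" for \<phi> and e :: real
    using assms(3)[OF sobolev_embed_in_H10[OF that(1)]] that(2) by (simp add: sobolev_embed_def)
qed (use assms(2) in \<open>simp add: L2_on_def\<close>)

lemma H10_dense_in_L2:
  fixes \<Omega> :: "(real^'n) set"
  assumes "open \<Omega>" "f \<in> L2_on \<Omega>" "e > 0"
  shows "\<exists>v\<in>H10 \<Omega>. norm (fst v - f) < e"
proof -
  define S where "S = closure (fst ` H10 \<Omega>)"
  have "subspace (fst ` H10 \<Omega>)"
    by (intro linear_subspace_image H10_subspace bounded_linear.linear bounded_linear_fst)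
  then have S: "subspace S" "closed S" unfolding S_def by (auto intro: subspace_closure)
  have "closed (L2_on \<Omega>)"
    unfolding L2_on_def by (rule L2_vanishing_outside_subspace) (use assms(1) in auto)
  then have "S \<subseteq> L2_on \<Omega>"
    unfolding S_def using H10_vanishes_outside(1)[OF assms(1)] by (intro closure_minimal) auto
  obtain p where p: "p \<in> S" "\<And>v. v \<in> S \<Longrightarrow> (f - p) \<bullet> v = 0"
    using orthogonal_projection_exists[OF S] by blast
  have "f - p = 0"
  proof (rule H10_separates[OF assms(1)])
    show "f - p \<in> L2_on \<Omega>"
      using \<open>S \<subseteq> L2_on \<Omega>\<close> p(1) assms(2) L2_on_subspace[OF assms(1)] by (auto intro: subspace_diff)
    show "(f - p) \<bullet> fst v = 0" if "v \<in> H10 \<Omega>" for v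
      using that closure_subset[of "fst ` H10 \<Omega>"] by (intro p(2)) (auto simp: S_def)
  qed
  then have "f \<in> S" using p(1) by simp
  then show ?thesis
    unfolding S_def closure_approachable using assms(3) by (auto simp: dist_norm)
qed

section \<open>Diffusion forms\<close>

text \<open>
  For a bilinear map the quadratic bound self-improves to a product bound by homogeneity.  This replaces
  the Cauchy-Schwarz inequality for integrals in the estimate of the diffusion form.
\<close>

lemma bounded_bilinearI_quadratic:
  fixes b :: "'a::real_normed_vector \<Rightarrow> 'b::real_normed_vector \<Rightarrow> real"
  assumes add: "\<And>x x' y. b (x + x') y = b x y + b x' y" "\<And>x y y'. b x (y + y') = b x y + b x y'"
    and scale: "\<And>r x y. b (r *\<^sub>R x) y = r * b x y" "\<And>r x y. b x (r *\<^sub>R y) = r * b x y"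
    and bound: "\<And>x y. \<bar>b x y\<bar> \<le> C * ((norm x)\<^sup>2 + (norm y)\<^sup>2)"
  shows "bounded_bilinear b"
proof
  have "norm (b x y) \<le> norm x * norm y * (2 * C)" for x y
  proof (cases "x = 0 \<or> y = 0")
    case True
    then show ?thesis using scale(1)[of 0 x y] scale(2)[of x 0 y] by auto
  next
    case False
    then have "b x y = norm x * norm y * b (sgn x) (sgn y)"
      by (simp add: sgn_div_norm scale field_simps)
    moreover have "\<bar>b (sgn x) (sgn y)\<bar> \<le> 2 * C"
      using bound[of "sgn x" "sgn y"] False by (simp add: norm_sgn)
    ultimately show ?thesis by (simp add: abs_mult mult_left_mono)
  qed
  then show "\<exists>K. \<forall>x y. norm (b x y) \<le> norm x * norm y * K" by blast
qed (auto simp: add scale)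

lemma bounded_bilinear_matrix_vector:
  "bounded_bilinear ((*v) :: real^'n^'m \<Rightarrow> real^'n \<Rightarrow> real^'m)"
proof -
  have "bilinear ((*v) :: real^'n^'m \<Rightarrow> real^'n \<Rightarrow> real^'m)"
    unfolding bilinear_def
    by (auto intro!: linearI simp: matrix_vector_mult_add_rdistrib matrix_vector_right_distrib
        matrix_vector_mult_scaleR scaleR_matrix_vector_assoc[symmetric])
  then show ?thesis by (simp add: bilinear_conv_bounded_bilinear)
qed

context
  fixes \<Omega> :: "(real^'n) set" and A :: "real^'n \<Rightarrow> real^'n^'n"
  assumes \<Omega>: "open \<Omega>" and A: "Linf_symmetric_field \<Omega> A"
begin

lemma AE_lebesgue_on: "AE x in lebesgue. P x \<Longrightarrow> AE x in lebesgue_on \<Omega>. P x"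
  using \<Omega> by (subst AE_restrict_space_iff) (auto elim: eventually_mono)

lemma diffusion_integrand_measurable:
  "(\<lambda>x. (A x *v rep_L2 (f :: (real^'n, real^'n) L2) x) \<bullet> rep_L2 (g :: (real^'n, real^'n) L2) x) \<in> borel_measurable (lebesgue_on \<Omega>)"
proof -
  have rep: "rep_L2 h \<in> borel_measurable (lebesgue_on \<Omega>)" for h :: "(real^'n, real^'n) L2"
    by (intro measurable_restrict_space1 rep_measurable_L2)
  have "(\<lambda>x. A x *v rep_L2 f x) \<in> borel_measurable (lebesgue_on \<Omega>)"
  proof (rule borel_measurable_continuous_Pair[where H = "(*v)", OF _ rep])
    show "A \<in> borel_measurable (lebesgue_on \<Omega>)" using A by (simp add: Linf_symmetric_field_def)
    show "continuous_on UNIV (\<lambda>p :: (real^'n^'n) \<times> (real^'n). fst p *v snd p)"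
      by (intro bounded_bilinear.continuous_on[OF bounded_bilinear_matrix_vector] continuous_intros)
  qed
  then show ?thesis by (intro borel_measurable_inner rep)
qed

lemma diffusion_integrand_bound:
  obtains C where "C \<ge> 0"
    "\<And>f g :: (real^'n, real^'n) L2. AE x in lebesgue_on \<Omega>. \<bar>(A x *v rep_L2 f x) \<bullet> rep_L2 g x\<bar> \<le> C * ((norm (rep_L2 f x))\<^sup>2 + (norm (rep_L2 g x))\<^sup>2)"
proof -
  obtain M where M: "AE x in lebesgue_on \<Omega>. norm (A x) \<le> M"
    using A by (auto simp: Linf_symmetric_field_def)
  obtain K where K: "K > 0" "\<And>B x. norm ((B :: real^'n^'n) *v x) \<le> norm B * norm x * K"
    using bounded_bilinear.pos_bounded[OF bounded_bilinear_matrix_vector] by blast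
  show ?thesis
  proof (rule that[of "\<bar>M\<bar> * K"])
    fix f g :: "(real^'n, real^'n) L2"
    show "AE x in lebesgue_on \<Omega>. \<bar>(A x *v rep_L2 f x) \<bullet> rep_L2 g x\<bar> \<le> \<bar>M\<bar> * K * ((norm (rep_L2 f x))\<^sup>2 + (norm (rep_L2 g x))\<^sup>2)"
      using M
    proof eventually_elim
      case (elim x)
      define F G where "F = norm (rep_L2 f x)" and "G = norm (rep_L2 g x)"
      have "\<bar>(A x *v rep_L2 f x) \<bullet> rep_L2 g x\<bar> \<le> norm (A x *v rep_L2 f x) * G"
        unfolding G_def by (rule Cauchy_Schwarz_ineq2)
      also have "\<dots> \<le> norm (A x) * F * K * G"
        unfolding F_def by (intro mult_right_mono K) (simp add: G_def)
      also have "\<dots> \<le> \<bar>M\<bar> * F * K * G"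
        using elim K(1) by (intro mult_right_mono) (auto simp: F_def G_def)
      also have "\<dots> = \<bar>M\<bar> * K * (F * G)" by simp
      also have "\<dots> \<le> \<bar>M\<bar> * K * (F\<^sup>2 + G\<^sup>2)"
      proof (rule mult_left_mono)
        have "2 * F * G \<le> F\<^sup>2 + G\<^sup>2" by (rule sum_squares_bound)
        moreover have "0 \<le> F * G" by (simp add: F_def G_def)
        ultimately show "F * G \<le> F\<^sup>2 + G\<^sup>2" by simp
      qed (use K(1) in simp)
      finally show ?case by (simp add: F_def G_def)
    qed
  qed (use K(1) in simp)
qed

lemma integrable_norm_rep_L2_on:
  "integrable (lebesgue_on \<Omega>) (\<lambda>x. (norm (rep_L2 f x))\<^sup>2)"
  "(\<integral>x. (norm (rep_L2 f x))\<^sup>2 \<partial>lebesgue_on \<Omega>) \<le> (norm f)\<^sup>2"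
proof -
  have m: "\<Omega> \<inter> space lebesgue \<in> sets lebesgue" using \<Omega> by auto
  have i: "integrable lebesgue (\<lambda>x. indicator \<Omega> x *\<^sub>R (norm (rep_L2 f x))\<^sup>2)"
    using m by (intro integrable_mult_indicator integrable_norm_rep_L2) auto
  then show "integrable (lebesgue_on \<Omega>) (\<lambda>x. (norm (rep_L2 f x))\<^sup>2)"
    by (simp add: integrable_restrict_space[OF m])
  have "(\<integral>x. (norm (rep_L2 f x))\<^sup>2 \<partial>lebesgue_on \<Omega>) = (\<integral>x. indicator \<Omega> x *\<^sub>R (norm (rep_L2 f x))\<^sup>2 \<partial>lebesgue)"
    by (rule integral_restrict_space[OF m])
  also have "\<dots> \<le> (norm f)\<^sup>2"
    unfolding norm_L2_sq by (rule integral_mono[OF i integrable_norm_rep_L2]) (simp add: indicator_def)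
  finally show "(\<integral>x. (norm (rep_L2 f x))\<^sup>2 \<partial>lebesgue_on \<Omega>) \<le> (norm f)\<^sup>2" .
qed

lemma diffusion_integrand_integrable:
  "integrable (lebesgue_on \<Omega>) (\<lambda>x. (A x *v rep_L2 f x) \<bullet> rep_L2 g x)"
proof -
  obtain C where C: "C \<ge> 0" "\<And>f g :: (real^'n, real^'n) L2. AE x in lebesgue_on \<Omega>.
      \<bar>(A x *v rep_L2 f x) \<bullet> rep_L2 g x\<bar> \<le> C * ((norm (rep_L2 f x))\<^sup>2 + (norm (rep_L2 g x))\<^sup>2)"
    using diffusion_integrand_bound by blast
  show ?thesis
  proof (rule Bochner_Integration.integrable_bound[OF _ diffusion_integrand_measurable])
    show "integrable (lebesgue_on \<Omega>) (\<lambda>x. C * ((norm (rep_L2 f x))\<^sup>2 + (norm (rep_L2 g x))\<^sup>2))"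
      by (intro integrable_mult_right Bochner_Integration.integrable_add integrable_norm_rep_L2_on)
    show "AE x in lebesgue_on \<Omega>. norm ((A x *v rep_L2 f x) \<bullet> rep_L2 g x) \<le>
        norm (C * ((norm (rep_L2 f x))\<^sup>2 + (norm (rep_L2 g x))\<^sup>2))"
      using C(2)[of f g] by eventually_elim (use C(1) in \<open>simp add: abs_mult\<close>)
  qed
qed

lemma diffusion_form_bounded_bilinear: "bounded_bilinear (diffusion_form \<Omega> A)"
proof -
  obtain C where C: "C \<ge> 0" "\<And>f g :: (real^'n, real^'n) L2. AE x in lebesgue_on \<Omega>.
      \<bar>(A x *v rep_L2 f x) \<bullet> rep_L2 g x\<bar> \<le> C * ((norm (rep_L2 f x))\<^sup>2 + (norm (rep_L2 g x))\<^sup>2)"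
    using diffusion_integrand_bound by blast
  note int = diffusion_integrand_integrable
  note meas = diffusion_integrand_measurable
  note mv = bounded_bilinear.add_right[OF bounded_bilinear_matrix_vector]
    bounded_bilinear.scaleR_right[OF bounded_bilinear_matrix_vector]
  show ?thesis
  proof (rule bounded_bilinearI_quadratic[where C = C])
    fix u v w :: "'n sobolev" and r
    have addr: "AE x in lebesgue_on \<Omega>. rep_L2 (snd u + snd v) x = rep_L2 (snd u) x + rep_L2 (snd v) x" for u v :: "'n sobolev"
      by (intro AE_lebesgue_on rep_add_L2)
    have scr: "AE x in lebesgue_on \<Omega>. rep_L2 (r *\<^sub>R snd u) x = r *\<^sub>R rep_L2 (snd u) x" for u :: "'n sobolev"
      by (intro AE_lebesgue_on rep_scaleR_L2)
    show "diffusion_form \<Omega> A (u + v) w = diffusion_form \<Omega> A u w + diffusion_form \<Omega> A v w"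
      unfolding diffusion_form_def snd_add Bochner_Integration.integral_add[OF int int, symmetric]
      by (rule integral_cong_AE[OF meas])
        (use meas addr[of u v] in \<open>auto elim!: eventually_mono simp: mv inner_add_left\<close>)
    show "diffusion_form \<Omega> A w (u + v) = diffusion_form \<Omega> A w u + diffusion_form \<Omega> A w v"
      unfolding diffusion_form_def snd_add Bochner_Integration.integral_add[OF int int, symmetric]
      by (rule integral_cong_AE[OF meas])
        (use meas addr[of u v] in \<open>auto elim!: eventually_mono simp: inner_add_right\<close>)
    show "diffusion_form \<Omega> A (r *\<^sub>R u) w = r * diffusion_form \<Omega> A u w"
      unfolding diffusion_form_def snd_scaleR integral_mult_right_zero[symmetric]
      by (rule integral_cong_AE[OF meas])
        (use meas scr[of u] in \<open>auto elim!: eventually_mono simp: mv\<close>)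
    show "diffusion_form \<Omega> A w (r *\<^sub>R u) = r * diffusion_form \<Omega> A w u"
      unfolding diffusion_form_def snd_scaleR integral_mult_right_zero[symmetric]
      by (rule integral_cong_AE[OF meas])
        (use meas scr[of u] in \<open>auto elim!: eventually_mono\<close>)
    show "\<bar>diffusion_form \<Omega> A u v\<bar> \<le> C * ((norm u)\<^sup>2 + (norm v)\<^sup>2)"
    proof -
      have "\<bar>diffusion_form \<Omega> A u v\<bar> \<le> (\<integral>x. \<bar>(A x *v rep_L2 (snd u) x) \<bullet> rep_L2 (snd v) x\<bar> \<partial>lebesgue_on \<Omega>)"
        unfolding diffusion_form_def by (rule integral_abs_bound)
      also have "\<dots> \<le> (\<integral>x. C * ((norm (rep_L2 (snd u) x))\<^sup>2 + (norm (rep_L2 (snd v) x))\<^sup>2) \<partial>lebesgue_on \<Omega>)"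
        by (intro integral_mono_AE C integrable_abs int integrable_mult_right
            Bochner_Integration.integrable_add integrable_norm_rep_L2_on)
      also have "\<dots> = C * ((\<integral>x. (norm (rep_L2 (snd u) x))\<^sup>2 \<partial>lebesgue_on \<Omega>) + (\<integral>x. (norm (rep_L2 (snd v) x))\<^sup>2 \<partial>lebesgue_on \<Omega>))"
        by (simp add: integrable_norm_rep_L2_on)
      also have "\<dots> \<le> C * ((norm (snd u))\<^sup>2 + (norm (snd v))\<^sup>2)"
        by (intro mult_left_mono add_mono integrable_norm_rep_L2_on C)
      also have "\<dots> \<le> C * ((norm u)\<^sup>2 + (norm v)\<^sup>2)"
        by (intro mult_left_mono add_mono C) (auto simp: norm_prod_def)
      finally show ?thesis .
    qed
  qed
qed

lemma diffusion_form_symmetric: "diffusion_form \<Omega> A u v = diffusion_form \<Omega> A v u"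
  unfolding diffusion_form_def
proof (rule integral_cong_AE[OF diffusion_integrand_measurable diffusion_integrand_measurable])
  have "AE x in lebesgue_on \<Omega>. transpose (A x) = A x" using A by (simp add: Linf_symmetric_field_def)
  then show "AE x in lebesgue_on \<Omega>. (A x *v rep_L2 (snd u) x) \<bullet> rep_L2 (snd v) x = (A x *v rep_L2 (snd v) x) \<bullet> rep_L2 (snd u) x"
  proof eventually_elim
    case (elim x)
    then have "A x *v y = y v* A x" for y by (metis transpose_matrix_vector)
    then have "(A x *v y) \<bullet> z = y \<bullet> (A x *v z)" for y z by (simp add: dot_lmul_matrix)
    then show ?case by (simp add: inner_commute)
  qed
qed

end

section \<open>The memory space\<close>

instance L2 :: (euclidean_space, euclidean_space) banach ..

locale memory_space =
  fixes \<Omega> :: "(real^'n) set" and a1 :: "'n::finite form" and \<nu> :: "real measure"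
  assumes domain_open: "open \<Omega>"
    and a1_bilinear: "bounded_bilinear a1"
    and a1_sym: "\<And>u v. a1 u v = a1 v u"
    and a1_coercive: "\<exists>c>0. \<forall>v\<in>H10 \<Omega>. c * (norm v)\<^sup>2 \<le> a1 v v"
    and sets_nu: "sets \<nu> = sets (restrict_space borel {0..})"
    and mass: "0 < emeasure \<nu> {0..}" "emeasure \<nu> {0..} < \<infinity>"
begin

abbreviation "V \<equiv> H10 \<Omega>"
abbreviation "K \<equiv> K_space \<Omega> a1 \<nu>"
abbreviation "W \<equiv> W_space \<Omega> a1 \<nu>"

sublocale a1: bounded_bilinear a1 by (rule a1_bilinear)

lemma space_nu: "space \<nu> = {0..}"
  using sets_eq_imp_space_eq[OF sets_nu] by (simp add: space_restrict_space)

sublocale finite_measure \<nu>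
  by (rule finite_measureI) (use mass in \<open>auto simp: space_nu\<close>)

lemma borel_measurable_nu: "f \<in> borel_measurable borel \<Longrightarrow> f \<in> borel_measurable \<nu>"
  unfolding measurable_cong_sets[OF sets_nu refl] by (rule measurable_restrict_space1)

lemma a1_nonneg: "v \<in> V \<Longrightarrow> 0 \<le> a1 v v"
  using a1_coercive by (meson mult_nonneg_nonneg less_imp_le order_trans zero_le_power2)

lemma a1_young:
  assumes "u \<in> V" "v \<in> V"
  shows "2 * \<bar>a1 u v\<bar> \<le> a1 u u + a1 v v"
proof -
  have "0 \<le> a1 (u + v) (u + v)" "0 \<le> a1 (u - v) (u - v)"
    using assms H10_subspace by (auto intro!: a1_nonneg subspace_add subspace_diff)
  then show ?thesis
    by (simp add: a1.add_left a1.add_right a1.diff_left a1.diff_right a1_sym[of v u])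
qed

lemma a1_continuous: "continuous_on UNIV (\<lambda>p. a1 (fst p) (snd p))"
  by (intro a1.continuous_on continuous_intros)

lemma K_spaceD:
  assumes "\<zeta> \<in> K"
  shows "\<zeta> \<in> borel_measurable \<nu>" "l \<in> space \<nu> \<Longrightarrow> \<zeta> l \<in> V" "integrable \<nu> (\<lambda>l. a1 (\<zeta> l) (\<zeta> l))"
  using assms by (auto simp: K_space_def)

lemma a1_measurable:
  assumes "\<zeta> \<in> borel_measurable \<nu>" "\<eta> \<in> borel_measurable \<nu>"
  shows "(\<lambda>l. a1 (\<zeta> l) (\<eta> l)) \<in> borel_measurable \<nu>"
  by (rule borel_measurable_continuous_Pair[where H = a1, OF assms a1_continuous])

lemma K_spaceI:
  assumes "\<zeta> \<in> borel_measurable \<nu>" "\<And>l. l \<in> space \<nu> \<Longrightarrow> \<zeta> l \<in> V"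
    "integrable \<nu> h" "\<And>l. l \<in> space \<nu> \<Longrightarrow> a1 (\<zeta> l) (\<zeta> l) \<le> h l"
  shows "\<zeta> \<in> K"
proof -
  have "integrable \<nu> (\<lambda>l. a1 (\<zeta> l) (\<zeta> l))"
  proof (rule Bochner_Integration.integrable_bound[OF assms(3) a1_measurable[OF assms(1,1)]])
    show "AE l in \<nu>. norm (a1 (\<zeta> l) (\<zeta> l)) \<le> norm (h l)"
      by (intro AE_I2) (use assms(2,4) a1_nonneg in \<open>fastforce\<close>)
  qed
  then show ?thesis using assms by (simp add: K_space_def)
qed

lemma K_cross_integrable:
  assumes "\<zeta> \<in> K" "\<eta> \<in> K"
  shows "integrable \<nu> (\<lambda>l. a1 (\<zeta> l) (\<eta> l))"
proof (rule Bochner_Integration.integrable_bound)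
  show "integrable \<nu> (\<lambda>l. a1 (\<zeta> l) (\<zeta> l) + a1 (\<eta> l) (\<eta> l))"
    using assms by (intro Bochner_Integration.integrable_add K_spaceD)
  show "AE l in \<nu>. norm (a1 (\<zeta> l) (\<eta> l)) \<le> norm (a1 (\<zeta> l) (\<zeta> l) + a1 (\<eta> l) (\<eta> l))"
  proof (rule AE_I2)
    fix l assume "l \<in> space \<nu>"
    then show "norm (a1 (\<zeta> l) (\<eta> l)) \<le> norm (a1 (\<zeta> l) (\<zeta> l) + a1 (\<eta> l) (\<eta> l))"
      using a1_young[of "\<zeta> l" "\<eta> l"] K_spaceD(2)[OF assms(1)] K_spaceD(2)[OF assms(2)]
      by (smt (verit, best) real_norm_def)
  qed
qed (intro a1_measurable K_spaceD assms)

lemma K_const: "u \<in> V \<Longrightarrow> (\<lambda>_. u) \<in> K"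
  by (rule K_spaceI[where h = "\<lambda>_. a1 u u"]) auto

lemma K_add:
  assumes "\<zeta> \<in> K" "\<eta> \<in> K"
  shows "(\<lambda>l. \<zeta> l + \<eta> l) \<in> K"
proof (rule K_spaceI)
  show "(\<lambda>l. \<zeta> l + \<eta> l) \<in> borel_measurable \<nu>"
    using K_spaceD(1)[OF assms(1)] K_spaceD(1)[OF assms(2)] by measurable
  show "\<zeta> l + \<eta> l \<in> V" if "l \<in> space \<nu>" for l
    using that assms by (intro subspace_add H10_subspace K_spaceD)
  show "integrable \<nu> (\<lambda>l. a1 (\<zeta> l) (\<zeta> l) + a1 (\<zeta> l) (\<eta> l) + (a1 (\<eta> l) (\<zeta> l) + a1 (\<eta> l) (\<eta> l)))"
    by (intro Bochner_Integration.integrable_add K_cross_integrable assms)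
qed (simp add: a1.add_left a1.add_right)

lemma K_scale:
  assumes "\<zeta> \<in> K" "c \<in> borel_measurable \<nu>" "\<And>l. l \<in> space \<nu> \<Longrightarrow> \<bar>c l\<bar> \<le> C"
  shows "(\<lambda>l. c l *\<^sub>R \<zeta> l) \<in> K"
proof (rule K_spaceI)
  show "(\<lambda>l. c l *\<^sub>R \<zeta> l) \<in> borel_measurable \<nu>"
    using assms(2) K_spaceD(1)[OF assms(1)] by measurable
  show "c l *\<^sub>R \<zeta> l \<in> V" if "l \<in> space \<nu>" for l
    using that assms by (intro subspace_scale H10_subspace K_spaceD)
  show "integrable \<nu> (\<lambda>l. C\<^sup>2 * a1 (\<zeta> l) (\<zeta> l))"
    by (intro integrable_mult_right K_spaceD assms)
  show "a1 (c l *\<^sub>R \<zeta> l) (c l *\<^sub>R \<zeta> l) \<le> C\<^sup>2 * a1 (\<zeta> l) (\<zeta> l)" if "l \<in> space \<nu>" for l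
  proof -
    have "(c l)\<^sup>2 \<le> C\<^sup>2" using assms(3)[OF that] by (metis abs_ge_zero power2_abs power_mono)
    then have "(c l)\<^sup>2 * a1 (\<zeta> l) (\<zeta> l) \<le> C\<^sup>2 * a1 (\<zeta> l) (\<zeta> l)"
      using that by (intro mult_right_mono a1_nonneg K_spaceD assms)
    then show ?thesis by (simp add: a1.scaleR_left a1.scaleR_right power2_eq_square)
  qed
qed

lemma K_diff: "\<zeta> \<in> K \<Longrightarrow> \<eta> \<in> K \<Longrightarrow> (\<lambda>l. \<zeta> l - \<eta> l) \<in> K"
  using K_add[OF _ K_scale[of \<eta> "\<lambda>_. -1" 1]] by simp

text \<open>Integrability in \<open>V\<close> follows from square integrability, because \<open>\<nu>\<close> is finite.\<close>

lemma K_integrable: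
  assumes "\<zeta> \<in> K"
  shows "integrable \<nu> \<zeta>"
proof -
  obtain c where c: "c > 0" "\<And>v. v \<in> V \<Longrightarrow> c * (norm v)\<^sup>2 \<le> a1 v v" using a1_coercive by blast
  show ?thesis
  proof (rule Bochner_Integration.integrable_bound[OF _ K_spaceD(1)[OF assms]])
    show "integrable \<nu> (\<lambda>l. 1 + (1 / c) * a1 (\<zeta> l) (\<zeta> l))"
      by (intro Bochner_Integration.integrable_add integrable_mult_right K_spaceD assms) simp
    show "AE l in \<nu>. norm (\<zeta> l) \<le> norm (1 + (1 / c) * a1 (\<zeta> l) (\<zeta> l))"
    proof (rule AE_I2)
      fix l assume "l \<in> space \<nu>"
      then have "c * (norm (\<zeta> l))\<^sup>2 \<le> a1 (\<zeta> l) (\<zeta> l)" using c(2) K_spaceD(2)[OF assms] by blast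
      then have "(norm (\<zeta> l))\<^sup>2 \<le> (1 / c) * a1 (\<zeta> l) (\<zeta> l)"
        using c(1) by (simp add: field_simps)
      moreover have "2 * norm (\<zeta> l) * 1 \<le> (norm (\<zeta> l))\<^sup>2 + 1\<^sup>2" by (rule sum_squares_bound)
      ultimately show "norm (\<zeta> l) \<le> norm (1 + (1 / c) * a1 (\<zeta> l) (\<zeta> l))"
        using norm_ge_zero[of "\<zeta> l"] by (simp del: norm_ge_zero)
    qed
  qed
qed

lemma a1_J: "\<zeta> \<in> K \<Longrightarrow> a1 (J_op \<nu> \<zeta>) v = (\<integral>l. a1 (\<zeta> l) v \<partial>\<nu>)"
  unfolding J_op_def
  by (rule integral_bounded_linear[OF a1.bounded_linear_left K_integrable, symmetric])

lemma J_add: "\<zeta> \<in> K \<Longrightarrow> \<eta> \<in> K \<Longrightarrow> J_op \<nu> (\<lambda>l. \<zeta> l + \<eta> l) = J_op \<nu> \<zeta> + J_op \<nu> \<eta>"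
  unfolding J_op_def by (intro Bochner_Integration.integral_add K_integrable)

lemma inner_K_nonneg: "\<zeta> \<in> K \<Longrightarrow> 0 \<le> inner_K a1 \<nu> \<zeta> \<zeta>"
  unfolding inner_K_def by (intro integral_nonneg_AE AE_I2 a1_nonneg K_spaceD)

text \<open>Solving \<open>\<zeta> + \<lambda>\<zeta> = w\<close> for \<open>\<zeta>\<close> multiplies by \<open>1 / (1 + \<lambda>)\<close>, whose total mass is positive.\<close>

definition damp :: "real \<Rightarrow> real" where "damp l = 1 / (1 + l)"
definition damp_mass :: real where "damp_mass = (\<integral>l. damp l \<partial>\<nu>)"

lemma damp_bounds: "l \<in> space \<nu> \<Longrightarrow> 0 < damp l" "l \<in> space \<nu> \<Longrightarrow> damp l \<le> 1"
  "l \<in> space \<nu> \<Longrightarrow> \<bar>damp l\<bar> \<le> 1" "l \<in> space \<nu> \<Longrightarrow> \<bar>l * damp l\<bar> \<le> 1"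
  by (auto simp: damp_def space_nu field_simps)

lemma damp_measurable [measurable]: "damp \<in> borel_measurable \<nu>" "(\<lambda>l. l * damp l) \<in> borel_measurable \<nu>"
  unfolding damp_def by (rule borel_measurable_nu, measurable)+

lemma damp_integrable: "integrable \<nu> damp"
  by (rule integrable_const_bound[of _ 1]) (use damp_bounds in auto)

lemma damp_mass_pos: "0 < damp_mass"
proof (rule ccontr)
  have nn: "0 \<le> damp_mass"
    unfolding damp_mass_def by (intro integral_nonneg_AE AE_I2) (use damp_bounds in force)
  assume "\<not> 0 < damp_mass"
  then have "(\<integral>l. damp l \<partial>\<nu>) = 0" using nn by (simp add: damp_mass_def)
  then have "AE l in \<nu>. damp l = 0"
    using damp_integrable damp_bounds(1)
    by (subst (asm) integral_nonneg_eq_0_iff_AE) (auto intro!: AE_I2 less_imp_le)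
  then have "AE l in \<nu>. False"
    using AE_space by eventually_elim (use damp_bounds(1) in force)
  then have "emeasure \<nu> (space \<nu>) = 0"
    using AE_iff_measurable[OF sets.top, of \<nu> "\<lambda>_. False"] by simp
  then show False using mass(1) by (simp add: space_nu)
qed

lemma K_damp: "\<zeta> \<in> K \<Longrightarrow> (\<lambda>l. damp l *\<^sub>R \<zeta> l) \<in> K"
  by (rule K_scale) (use damp_bounds in auto)

lemma K_Lambda_damp: "\<zeta> \<in> K \<Longrightarrow> (\<lambda>l. (l * damp l) *\<^sub>R \<zeta> l) \<in> K"
  by (rule K_scale) (use damp_bounds in auto)

lemma J_damp_const: "J_op \<nu> (\<lambda>l. damp l *\<^sub>R u) = damp_mass *\<^sub>R u"
  unfolding J_op_def damp_mass_def by (simp add: damp_integrable)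

lemma norm_W_sq:
  assumes "X \<in> W"
  shows "(norm_W a1 \<nu> X)\<^sup>2 = (norm (fst X))\<^sup>2 + inner_K a1 \<nu> (snd X) (snd X)"
  using assms inner_K_nonneg[of "snd X"]
  by (auto simp: norm_W_def inner_W_def W_space_def power2_norm_eq_inner)

end

lemma norm_fst_component_le: "norm (fst p) \<le> norm p"
  using norm_fst_le[of "fst p" "snd p"] by simp

lemma inner_fst_le: "\<bar>f \<bullet> fst p\<bar> \<le> norm f * norm p"
  using Cauchy_Schwarz_ineq2[of f "fst p"] mult_left_mono[OF norm_fst_component_le[of p] norm_ge_zero[of f]]
  by (rule order_trans)

context memory_space begin

lemma V_closed_rules: "u \<in> V \<Longrightarrow> v \<in> V \<Longrightarrow> u + v \<in> V" "u \<in> V \<Longrightarrow> v \<in> V \<Longrightarrow> u - v \<in> V"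
    "u \<in> V \<Longrightarrow> r *\<^sub>R u \<in> V"
  using H10_subspace by (auto intro: subspace_add subspace_diff subspace_scale)

lemma norm_W_nonneg: "snd X \<in> K \<Longrightarrow> 0 \<le> norm_W a1 \<nu> X"
  using inner_K_nonneg[of "snd X"] by (simp add: norm_W_def inner_W_def)

lemma a1_add_le: "u \<in> V \<Longrightarrow> v \<in> V \<Longrightarrow> a1 (u + v) (u + v) \<le> 2 * a1 u u + 2 * a1 v v"
  using a1_young[of u v] by (simp add: a1.add_left a1.add_right a1_sym[of v u])

lemma a1_riesz:
  assumes "subspace S" "closed S" "S \<subseteq> V"
    and "\<And>u v. u \<in> S \<Longrightarrow> v \<in> S \<Longrightarrow> F (u + v) = F u + F v"
    "\<And>r v. v \<in> S \<Longrightarrow> F (r *\<^sub>R v) = r * F v" "\<And>v. v \<in> S \<Longrightarrow> \<bar>F v\<bar> \<le> C * norm v"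
  shows "\<exists>u\<in>S. \<forall>v\<in>S. a1 u v = F v"
proof -
  obtain c where c: "c > 0" "\<And>v. v \<in> V \<Longrightarrow> c * (norm v)\<^sup>2 \<le> a1 v v" using a1_coercive by blast
  show ?thesis
    by (rule symmetric_lax_milgram[OF assms(1,2) bounded_bilinear_imp_on(1)[OF a1_bilinear] _
          bounded_bilinear_imp_on(2)[OF a1_bilinear] c(1) _ assms(4-6)])
      (use c(2) assms(3) a1_sym in \<open>auto simp: symmetric_on_def\<close>)
qed

lemma represents_unique:
  assumes "represents_on \<Omega> \<phi> f" "represents_on \<Omega> \<phi> g"
  shows "f = g"
proof -
  have "f - g = 0"
    by (rule H10_separates[OF domain_open])
      (use assms L2_on_subspace[OF domain_open] in \<open>auto simp: represents_on_def inner_diff_left intro: subspace_diff\<close>)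
  then show ?thesis by simp
qed

lemma as_H_eq: "represents_on \<Omega> \<phi> f \<Longrightarrow> as_H \<Omega> \<phi> = f"
  unfolding as_H_def using represents_unique by (intro the_equality)

lemma represents_as_H: "in_H \<Omega> \<phi> \<Longrightarrow> represents_on \<Omega> \<phi> (as_H \<Omega> \<phi>)"
  using as_H_eq by (auto simp: in_H_def)

text \<open>
  The set of all \<open>w\<close> with \<open>A\<^sub>1 w \<in> H\<close> is dense in \<open>V\<close>: an element \<open>v\<close> that is \<open>a\<^sub>1\<close>-orthogonal to
  it is orthogonal to the solution \<open>w\<close> of \<open>A\<^sub>1 w = v\<close>, so that \<open>\<parallel>v\<parallel>\<^sub>H\<^sup>2 = a\<^sub>1 (w, v) = 0\<close>.
\<close>

lemma regular_elements_dense: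
  assumes z: "z \<in> V" and "e > 0"
  shows "\<exists>w\<in>V. in_H \<Omega> (a1 w) \<and> norm (w - z) < e"
proof -
  define D where "D = {w \<in> V. in_H \<Omega> (a1 w)}"
  define S where "S = closure D"
  have L2: "subspace (L2_on \<Omega>)" by (rule L2_on_subspace[OF domain_open])
  have "subspace D"
  proof (rule subspaceI)
    show "0 \<in> D"
      using subspace_0[OF H10_subspace, of \<Omega>] subspace_0[OF L2]
      by (auto simp: D_def in_H_def represents_on_def a1.zero_left)
    show "x + y \<in> D" if xy: "x \<in> D" "y \<in> D" for x y
    proof -
      obtain f g where "represents_on \<Omega> (a1 x) f" "represents_on \<Omega> (a1 y) g"
        using xy by (auto simp: D_def in_H_def)
      then have "represents_on \<Omega> (a1 (x + y)) (f + g)"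
        by (auto simp: represents_on_def a1.add_left inner_add_left subspace_add[OF L2])
      then show ?thesis using xy by (auto simp: D_def in_H_def V_closed_rules)
    qed
    show "r *\<^sub>R x \<in> D" if x: "x \<in> D" for r x
    proof -
      obtain f where "represents_on \<Omega> (a1 x) f" using x by (auto simp: D_def in_H_def)
      then have "represents_on \<Omega> (a1 (r *\<^sub>R x)) (r *\<^sub>R f)"
        by (auto simp: represents_on_def a1.scaleR_left subspace_scale[OF L2])
      then show ?thesis using x by (auto simp: D_def in_H_def V_closed_rules)
    qed
  qed
  then have S: "subspace S" "closed S" unfolding S_def by (auto intro: subspace_closure)
  have SV: "S \<subseteq> V" unfolding S_def by (rule closure_minimal) (auto simp: D_def H10_closed)
  obtain C where C: "\<And>u v. \<bar>a1 u v\<bar> \<le> norm u * norm v * C" using a1.bounded by auto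
  have "\<exists>p\<in>S. \<forall>s\<in>S. a1 p s = a1 z s"
    by (rule a1_riesz[OF S SV, where C = "norm z * C"]) (use C[of z] in \<open>auto simp: a1.add_right a1.scaleR_right mult_ac\<close>)
  then obtain p where p: "p \<in> S" "\<And>s. s \<in> S \<Longrightarrow> a1 p s = a1 z s" by blast
  define v where "v = z - p"
  have v: "v \<in> V" using z p(1) SV by (auto simp: v_def V_closed_rules)
  have "\<exists>w\<in>V. \<forall>\<phi>\<in>V. a1 w \<phi> = fst v \<bullet> fst \<phi>"
  proof (rule a1_riesz[OF H10_subspace H10_closed order_refl, where C = "norm (fst v)"])
    show "\<bar>fst v \<bullet> fst \<phi>\<bar> \<le> norm (fst v) * norm \<phi>" for \<phi> :: "'n sobolev"
      by (rule inner_fst_le)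
  qed (auto simp: inner_add_right)
  then obtain w where w: "w \<in> V" "\<And>\<phi>. \<phi> \<in> V \<Longrightarrow> a1 w \<phi> = fst v \<bullet> fst \<phi>" by blast
  have "represents_on \<Omega> (a1 w) (fst v)"
    using w v H10_vanishes_outside(1)[OF domain_open] by (auto simp: represents_on_def)
  then have "w \<in> S" unfolding S_def using w(1) by (intro set_mp[OF closure_subset]) (auto simp: D_def in_H_def)
  then have "a1 v w = 0" using p(2) by (simp add: v_def a1.diff_left)
  then have "fst v = 0" using w(2)[OF v] by (simp add: a1_sym)
  then have "v = 0" using H10_eq_0[OF domain_open v] by blast
  then have "z \<in> closure D" using p(1) by (simp add: v_def S_def)
  then show ?thesis
    using assms(2) unfolding closure_approachable by (auto simp: D_def dist_norm)
qed

text \<open>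
  The part of the quadratic form of the eliminated resolvent equation that does not depend on \<open>a\<^sub>0\<close>.
  All estimates uniform in \<open>\<epsilon>\<close> are expressed by it.
\<close>

definition energy :: "'n sobolev \<Rightarrow> real" where
  "energy v = (norm (fst v))\<^sup>2 + damp_mass * a1 v v"

lemma energy_nonneg: "v \<in> V \<Longrightarrow> 0 \<le> energy v"
  using a1_nonneg damp_mass_pos by (simp add: energy_def)

lemma energy_coercive: "\<exists>\<alpha>>0. \<forall>v\<in>V. \<alpha> * (norm v)\<^sup>2 \<le> energy v"
proof -
  obtain c where c: "c > 0" "\<And>v. v \<in> V \<Longrightarrow> c * (norm v)\<^sup>2 \<le> a1 v v" using a1_coercive by blast
  have "(damp_mass * c) * (norm v)\<^sup>2 \<le> energy v" if "v \<in> V" for v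
  proof -
    have "damp_mass * (c * (norm v)\<^sup>2) \<le> damp_mass * a1 v v"
      using c(2)[OF that] damp_mass_pos by (intro mult_left_mono) auto
    then show ?thesis by (simp add: energy_def add_increasing)
  qed
  then show ?thesis using c(1) damp_mass_pos by (intro exI[of _ "damp_mass * c"]) auto
qed

lemma damp_sq_integral_le:
  assumes "v \<in> V"
  shows "(\<integral>l. a1 (damp l *\<^sub>R v) (damp l *\<^sub>R v) \<partial>\<nu>) \<le> damp_mass * a1 v v"
proof -
  have "(\<integral>l. a1 (damp l *\<^sub>R v) (damp l *\<^sub>R v) \<partial>\<nu>) \<le> (\<integral>l. damp l * a1 v v \<partial>\<nu>)"
  proof (rule integral_mono)
    show "integrable \<nu> (\<lambda>l. a1 (damp l *\<^sub>R v) (damp l *\<^sub>R v))"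
      by (intro K_spaceD(3) K_damp K_const assms)
    show "integrable \<nu> (\<lambda>l. damp l * a1 v v)" by (intro integrable_mult_left damp_integrable)
    show "a1 (damp l *\<^sub>R v) (damp l *\<^sub>R v) \<le> damp l * a1 v v" if "l \<in> space \<nu>" for l
    proof -
      have "damp l * (damp l * a1 v v) \<le> 1 * (damp l * a1 v v)"
        using damp_bounds[OF that] a1_nonneg[OF assms] by (intro mult_right_mono) auto
      then show ?thesis by (simp add: a1.scaleR_left a1.scaleR_right)
    qed
  qed
  then show ?thesis by (simp add: damp_mass_def)
qed

text \<open>
  Two solutions with the same data have memory components differing by \<open>(u - u') / (1 + \<lambda>)\<close>, and
  \<open>1 / (1 + \<lambda>)\<^sup>2 \<le> 1 / (1 + \<lambda>)\<close>.
\<close>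

lemma norm_W_difference_le:
  assumes "u \<in> V" "u' \<in> V" "\<zeta> \<in> K" "\<zeta>' \<in> K"
    and "AE l in \<nu>. \<zeta> l = damp l *\<^sub>R (u + \<eta> l)" "AE l in \<nu>. \<zeta>' l = damp l *\<^sub>R (u' + \<eta> l)"
  shows "norm_W a1 \<nu> (incl_W (u, \<zeta>) - incl_W (u', \<zeta>')) \<le> sqrt (energy (u - u'))"
proof -
  have d: "u - u' \<in> V" using assms by (simp add: V_closed_rules)
  have "inner_K a1 \<nu> (\<zeta> - \<zeta>') (\<zeta> - \<zeta>') = (\<integral>l. a1 (damp l *\<^sub>R (u - u')) (damp l *\<^sub>R (u - u')) \<partial>\<nu>)"
    unfolding inner_K_def fun_diff_def
  proof (rule integral_cong_AE)
    show "AE l in \<nu>. a1 (\<zeta> l - \<zeta>' l) (\<zeta> l - \<zeta>' l) = a1 (damp l *\<^sub>R (u - u')) (damp l *\<^sub>R (u - u'))"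
      using assms(5,6) by eventually_elim (simp add: scaleR_diff_right scaleR_add_right)
  qed (intro a1_measurable K_spaceD(1) K_diff K_damp K_const assms(3,4) d)+
  also have "\<dots> \<le> damp_mass * a1 (u - u') (u - u')" by (rule damp_sq_integral_le[OF d])
  finally show ?thesis
    by (simp add: norm_W_def inner_W_def incl_W_def energy_def power2_norm_eq_inner)
qed

end

section \<open>The generator and its resolvent\<close>

locale generator = memory_space +
  fixes a0 :: "'a::finite form"
  assumes a0_bilinear: "bilinear_on (H10 \<Omega>) a0"
    and a0_symmetric: "symmetric_on (H10 \<Omega>) a0"
    and a0_bounded: "bounded_on (H10 \<Omega>) a0"
    and a0_nonneg: "\<And>v. v \<in> H10 \<Omega> \<Longrightarrow> 0 \<le> a0 v v"
begin

abbreviation "gen_domain \<equiv> gen_dom \<Omega> a0 a1 \<nu>"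
abbreviation "G \<equiv> gen \<Omega> a0 a1 \<nu>"

lemma E_minus_Lambda: "E_op u - Lambda_op \<zeta> = (\<lambda>l. u - l *\<^sub>R \<zeta> l)"
  by (simp add: fun_eq_iff E_op_def Lambda_op_def)

lemma gen_domD:
  assumes "X \<in> gen_domain"
  shows "fst X \<in> V" "snd X \<in> K" "(\<lambda>l. fst X - l *\<^sub>R snd X l) \<in> K"
    "represents_on \<Omega> (stress a0 a1 \<nu> X) (as_H \<Omega> (stress a0 a1 \<nu> X))"
  using assms represents_as_H by (auto simp: gen_dom_def E_minus_Lambda)

text \<open>
  The coupling terms \<open>a\<^sub>1 (J \<zeta>, u)\<close> and \<open>\<langle>E u, \<zeta>\<rangle>\<close> cancel, leaving \<open>- a\<^sub>0 (u, u) - \<langle>\<Lambda> \<zeta>, \<zeta>\<rangle>\<close>.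
\<close>

lemma gen_dissipative:
  assumes "X \<in> gen_domain"
  shows "inner_W a1 \<nu> (G X) (incl_W X) \<le> 0"
proof -
  note X = gen_domD[OF assms]
  define u \<zeta> where "u = fst X" and "\<zeta> = snd X"
  have u: "u \<in> V" "\<zeta> \<in> K" "(\<lambda>l. u - l *\<^sub>R \<zeta> l) \<in> K" using X by (auto simp: u_def \<zeta>_def)
  have "as_H \<Omega> (stress a0 a1 \<nu> X) \<bullet> fst u = a0 u u + a1 (J_op \<nu> \<zeta>) u"
    using X(4) u(1) by (simp add: represents_on_def stress_def u_def \<zeta>_def)
  also have "a1 (J_op \<nu> \<zeta>) u = (\<integral>l. a1 u (\<zeta> l) \<partial>\<nu>)"
    using a1_J[OF u(2), of u] a1_sym by simp
  finally have H: "as_H \<Omega> (stress a0 a1 \<nu> X) \<bullet> fst u = a0 u u + (\<integral>l. a1 u (\<zeta> l) \<partial>\<nu>)" .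
  have "(\<integral>l. a1 (u - l *\<^sub>R \<zeta> l) (\<zeta> l) \<partial>\<nu>) \<le> (\<integral>l. a1 u (\<zeta> l) \<partial>\<nu>)"
  proof (rule integral_mono)
    show "integrable \<nu> (\<lambda>l. a1 (u - l *\<^sub>R \<zeta> l) (\<zeta> l))" by (rule K_cross_integrable[OF u(3,2)])
    show "integrable \<nu> (\<lambda>l. a1 u (\<zeta> l))" by (rule K_cross_integrable[OF K_const[OF u(1)] u(2)])
    show "a1 (u - l *\<^sub>R \<zeta> l) (\<zeta> l) \<le> a1 u (\<zeta> l)" if "l \<in> space \<nu>" for l
      using that a1_nonneg[OF K_spaceD(2)[OF u(2) that]]
      by (simp add: a1.diff_left a1.scaleR_left space_nu)
  qed
  then show ?thesis
    using H a0_nonneg[OF u(1)]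
    by (simp add: inner_W_def inner_K_def gen_def incl_W_def E_minus_Lambda flip: u_def \<zeta>_def)
qed

text \<open>
  Eliminating \<open>\<zeta> = (u + \<eta>) / (1 + \<lambda>)\<close> from \<open>(I - \<A>)(u, \<zeta>) = (f, \<eta>)\<close> leaves a problem for \<open>u\<close> alone,
  governed by the form below.
\<close>

definition res_form :: "'a sobolev \<Rightarrow> 'a sobolev \<Rightarrow> real" where
  "res_form u v = fst u \<bullet> fst v + a0 u v + damp_mass * a1 u v"

definition res_rhs :: "'a state \<Rightarrow> 'a sobolev \<Rightarrow> real" where
  "res_rhs Y v = fst Y \<bullet> fst v - a1 (J_op \<nu> (\<lambda>l. damp l *\<^sub>R snd Y l)) v"

lemma energy_le_res_form: "v \<in> V \<Longrightarrow> energy v \<le> res_form v v"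
  using a0_nonneg by (simp add: energy_def res_form_def power2_norm_eq_inner)

lemma res_form_bilinear: "bilinear_on V res_form"
  using a0_bilinear
  by (auto simp: bilinear_on_def res_form_def inner_add_left inner_add_right a1.add_left a1.add_right
      a1.scaleR_left a1.scaleR_right algebra_simps)

lemma res_form_symmetric: "symmetric_on V res_form"
  using a0_symmetric a1_sym by (auto simp: symmetric_on_def res_form_def inner_commute)

lemma res_form_bounded: "bounded_on V res_form"
proof -
  obtain C0 where C0: "C0 > 0" "\<And>u v. u \<in> V \<Longrightarrow> v \<in> V \<Longrightarrow> \<bar>a0 u v\<bar> \<le> C0 * norm u * norm v"
    using a0_bounded by (auto simp: bounded_on_def)
  obtain C1 where C1: "C1 > 0" "\<And>u v. \<bar>a1 u v\<bar> \<le> norm u * norm v * C1"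
    using a1.pos_bounded by auto
  have "\<bar>res_form u v\<bar> \<le> (1 + C0 + damp_mass * C1) * norm u * norm v" if "u \<in> V" "v \<in> V" for u v
  proof -
    have "\<bar>fst u \<bullet> fst v\<bar> \<le> norm u * norm v"
      using inner_fst_le[of "fst u" v] mult_right_mono[OF norm_fst_component_le[of u] norm_ge_zero[of v]]
      by (rule order_trans)
    moreover have "\<bar>damp_mass * a1 u v\<bar> \<le> damp_mass * (norm u * norm v * C1)"
      using C1(2)[of u v] damp_mass_pos by (simp add: abs_mult)
    ultimately have "\<bar>res_form u v\<bar> \<le> norm u * norm v + C0 * norm u * norm v + damp_mass * (norm u * norm v * C1)"
      unfolding res_form_def using C0(2)[OF that] by linarith
    then show ?thesis by (simp add: algebra_simps)
  qed
  moreover have "1 + C0 + damp_mass * C1 > 0"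
    using C0(1) C1(1) damp_mass_pos by (simp add: add_pos_pos)
  ultimately show ?thesis unfolding bounded_on_def by blast
qed

lemma resolvent_equation:
  assumes X: "X \<in> gen_domain" and Y: "Y \<in> W" and eq: "eq_W \<nu> (incl_W X - G X) Y"
  shows "AE l in \<nu>. snd X l = damp l *\<^sub>R (fst X + snd Y l)"
    "v \<in> V \<Longrightarrow> res_form (fst X) v = res_rhs Y v"
proof -
  note XD = gen_domD[OF X]
  have \<eta>: "snd Y \<in> K" using Y by (auto simp: W_space_def)
  have "AE l in \<nu>. snd X l - (fst X - l *\<^sub>R snd X l) = snd Y l"
    using eq by (simp add: eq_W_def incl_W_def gen_def E_minus_Lambda)
  then show ae: "AE l in \<nu>. snd X l = damp l *\<^sub>R (fst X + snd Y l)"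
    using AE_space
  proof eventually_elim
    case (elim l)
    then have "fst X + snd Y l = (1 + l) *\<^sub>R snd X l" by (auto simp: algebra_simps)
    then show ?case using elim(2) by (simp add: damp_def space_nu)
  qed
  have "J_op \<nu> (snd X) = J_op \<nu> (\<lambda>l. damp l *\<^sub>R fst X + damp l *\<^sub>R snd Y l)"
    unfolding J_op_def
  proof (rule integral_cong_AE)
    show "AE l in \<nu>. snd X l = damp l *\<^sub>R fst X + damp l *\<^sub>R snd Y l"
      using ae by (simp add: scaleR_add_right)
  qed (intro K_spaceD(1) K_add K_damp K_const XD(1,2) \<eta>)+
  also have "\<dots> = damp_mass *\<^sub>R fst X + J_op \<nu> (\<lambda>l. damp l *\<^sub>R snd Y l)"
    by (simp add: J_add K_damp K_const XD \<eta> J_damp_const)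
  finally have J: "J_op \<nu> (snd X) = damp_mass *\<^sub>R fst X + J_op \<nu> (\<lambda>l. damp l *\<^sub>R snd Y l)" .
  assume v: "v \<in> V"
  have "fst (fst X) + as_H \<Omega> (stress a0 a1 \<nu> X) = fst Y"
    using eq by (simp add: eq_W_def incl_W_def gen_def)
  then have "fst Y \<bullet> fst v = fst (fst X) \<bullet> fst v + as_H \<Omega> (stress a0 a1 \<nu> X) \<bullet> fst v"
    by (simp add: inner_add_left[symmetric])
  also have "as_H \<Omega> (stress a0 a1 \<nu> X) \<bullet> fst v = a0 (fst X) v + a1 (J_op \<nu> (snd X)) v"
    using XD(4) v by (simp add: represents_on_def stress_def)
  finally show "res_form (fst X) v = res_rhs Y v"
    by (simp add: res_form_def res_rhs_def J a1.add_left a1.scaleR_left)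
qed

lemma resolvent_solvable:
  assumes Y: "Y \<in> W"
  shows "\<exists>X\<in>gen_domain. eq_W \<nu> (incl_W X - G X) Y"
proof -
  have \<eta>: "snd Y \<in> K" and f: "fst Y \<in> L2_on \<Omega>" using Y by (auto simp: W_space_def)
  obtain \<alpha> where \<alpha>: "\<alpha> > 0" "\<And>v. v \<in> V \<Longrightarrow> \<alpha> * (norm v)\<^sup>2 \<le> energy v"
    using energy_coercive by blast
  obtain C1 where C1: "C1 > 0" "\<And>u v. \<bar>a1 u v\<bar> \<le> norm u * norm v * C1"
    using a1.pos_bounded by auto
  define j where "j = J_op \<nu> (\<lambda>l. damp l *\<^sub>R snd Y l)"
  have "\<exists>u\<in>V. \<forall>v\<in>V. res_form u v = res_rhs Y v"
  proof (rule symmetric_lax_milgram[OF H10_subspace H10_closed res_form_bilinear res_form_symmetric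
          res_form_bounded \<alpha>(1), where K = "norm (fst Y) + norm j * C1"])
    show "\<alpha> * (norm v)\<^sup>2 \<le> res_form v v" if "v \<in> V" for v
      using \<alpha>(2)[OF that] energy_le_res_form[OF that] by simp
    show "\<bar>res_rhs Y v\<bar> \<le> (norm (fst Y) + norm j * C1) * norm v" for v
    proof -
      have "\<bar>fst Y \<bullet> fst v\<bar> \<le> norm (fst Y) * norm v" by (rule inner_fst_le)
      then show ?thesis
        using C1(2)[of j v] unfolding res_rhs_def j_def[symmetric] by (simp add: algebra_simps)
    qed
  qed (auto simp: res_rhs_def inner_add_right a1.add_right a1.scaleR_right algebra_simps)
  then obtain u where u: "u \<in> V" "\<And>v. v \<in> V \<Longrightarrow> res_form u v = res_rhs Y v" by blast
  define \<zeta> where "\<zeta> l = damp l *\<^sub>R u + damp l *\<^sub>R snd Y l" for l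
  have \<zeta>: "\<zeta> \<in> K" unfolding \<zeta>_def by (intro K_add K_damp K_const u \<eta>)
  have J: "J_op \<nu> \<zeta> = damp_mass *\<^sub>R u + j"
    unfolding \<zeta>_def j_def by (simp add: J_add K_damp K_const u \<eta> J_damp_const)
  have eq: "\<zeta> l - (u - l *\<^sub>R \<zeta> l) = snd Y l" if "l \<in> space \<nu>" for l
  proof -
    have "(1 + l) *\<^sub>R \<zeta> l = u + snd Y l"
      using that by (simp add: \<zeta>_def damp_def space_nu scaleR_add_right)
    then show ?thesis by (simp add: algebra_simps)
  qed
  have rep: "represents_on \<Omega> (stress a0 a1 \<nu> (u, \<zeta>)) (fst Y - fst u)"
    unfolding represents_on_def
  proof
    show "fst Y - fst u \<in> L2_on \<Omega>"
      by (intro subspace_diff L2_on_subspace H10_vanishes_outside domain_open f u)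
    show "\<forall>v\<in>V. stress a0 a1 \<nu> (u, \<zeta>) v = (fst Y - fst u) \<bullet> fst v"
      using u(2) by (simp add: stress_def res_form_def res_rhs_def J a1.add_left a1.scaleR_left
          inner_diff_left flip: j_def) (smt (verit) real_inner_class.inner_commute)
  qed
  have "(\<lambda>l. u - l *\<^sub>R \<zeta> l) \<in> K"
  proof (rule K_spaceI)
    have [measurable]: "\<zeta> \<in> borel_measurable \<nu>" "(\<lambda>l. l) \<in> borel_measurable \<nu>"
      using K_spaceD(1)[OF \<zeta>] by (auto intro: borel_measurable_nu)
    show "(\<lambda>l. u - l *\<^sub>R \<zeta> l) \<in> borel_measurable \<nu>" by measurable
    show "u - l *\<^sub>R \<zeta> l \<in> V" if "l \<in> space \<nu>" for l
      using u(1) K_spaceD(2)[OF \<zeta> that] by (simp add: V_closed_rules)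
    show "integrable \<nu> (\<lambda>l. a1 (\<zeta> l - snd Y l) (\<zeta> l - snd Y l))"
      by (rule K_spaceD(3)[OF K_diff[OF \<zeta> \<eta>]])
    show "a1 (u - l *\<^sub>R \<zeta> l) (u - l *\<^sub>R \<zeta> l) \<le> a1 (\<zeta> l - snd Y l) (\<zeta> l - snd Y l)" if "l \<in> space \<nu>" for l
    proof -
      have "u - l *\<^sub>R \<zeta> l = \<zeta> l - snd Y l" using eq[OF that] by (auto simp: algebra_simps)
      then show ?thesis by simp
    qed
  qed
  then have "(u, \<zeta>) \<in> gen_domain"
    using u(1) \<zeta> rep by (auto simp: gen_dom_def E_minus_Lambda in_H_def)
  moreover have "eq_W \<nu> (incl_W (u, \<zeta>) - G (u, \<zeta>)) Y"
    using eq by (auto simp: eq_W_def incl_W_def gen_def E_minus_Lambda as_H_eq[OF rep])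
  ultimately show ?thesis by blast
qed

lemma gen_m_dissipative: "m_dissipative \<Omega> a0 a1 \<nu>"
  using gen_dissipative resolvent_solvable by (simp add: m_dissipative_def)

lemma incl_minus_gen_in_W:
  assumes "X \<in> gen_domain"
  shows "incl_W X - G X \<in> W"
proof -
  note X = gen_domD[OF assms]
  have "fst (fst X) + as_H \<Omega> (stress a0 a1 \<nu> X) \<in> L2_on \<Omega>"
    using X by (intro subspace_add L2_on_subspace H10_vanishes_outside domain_open) (auto simp: represents_on_def)
  moreover have "snd X - (\<lambda>l. fst X - l *\<^sub>R snd X l) \<in> K"
    using K_diff[OF X(2,3)] by (simp add: fun_diff_def)
  ultimately show ?thesis
    by (simp add: W_space_def mem_Times_iff incl_W_def gen_def E_minus_Lambda)
qed

lemma gen_injective: "I_minus_gen_injective \<Omega> a0 a1 \<nu>"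
  unfolding I_minus_gen_injective_def
proof (intro ballI impI)
  fix X X' assume X: "X \<in> gen_domain" "X' \<in> gen_domain" and eq: "eq_W \<nu> (incl_W X - G X) (incl_W X' - G X')"
  define Y where "Y = incl_W X' - G X'"
  have Y: "Y \<in> W" unfolding Y_def by (rule incl_minus_gen_in_W[OF X(2)])
  have refl: "eq_W \<nu> (incl_W X' - G X') Y" by (simp add: Y_def eq_W_def)
  note E = resolvent_equation[OF X(1) Y eq[folded Y_def]] resolvent_equation[OF X(2) Y refl]
  define d where "d = fst X - fst X'"
  have d: "d \<in> V" using X gen_domD(1) by (simp add: d_def V_closed_rules)
  have "res_form d d = res_form (fst X) d - res_form (fst X') d"
    unfolding d_def using X gen_domD(1) d
    by (intro bilinear_on_diff[OF res_form_bilinear H10_subspace]) (auto simp: d_def)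
  then have "energy d \<le> 0" using E(2,4)[OF d] energy_le_res_form[OF d] by simp
  moreover obtain \<alpha> where "\<alpha> > 0" "\<alpha> * (norm d)\<^sup>2 \<le> energy d" using energy_coercive d by blast
  ultimately have "d = 0"
    by (smt (verit, best) mult_pos_pos norm_eq_zero zero_less_power2)
  then have "fst X = fst X'" by (simp add: d_def)
  moreover have "AE l in \<nu>. snd X l = snd X' l"
    using E(1,3) by eventually_elim (simp add: calculation)
  ultimately show "eq_W \<nu> X X'" by (simp add: eq_W_def)
qed

text \<open>
  Testing the equation for \<open>u\<close> with \<open>u\<close> itself and splitting the right-hand side by Young's inequality
  absorbs half of the energy, whatever \<open>a\<^sub>0\<close> is.
\<close>

lemma resolvent_energy_le:
  assumes X: "X \<in> gen_domain" and Y: "Y \<in> W" and eq: "eq_W \<nu> (incl_W X - G X) Y"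
  shows "energy (fst X) \<le> (norm_W a1 \<nu> Y)\<^sup>2"
proof -
  define u \<eta> where "u = fst X" and "\<eta> = snd Y"
  have \<eta>: "\<eta> \<in> K" using Y by (auto simp: W_space_def \<eta>_def)
  have u: "u \<in> V" using gen_domD(1)[OF X] by (simp add: u_def)
  have "energy u \<le> fst Y \<bullet> fst u - a1 (J_op \<nu> (\<lambda>l. damp l *\<^sub>R \<eta> l)) u"
    using energy_le_res_form[OF u] resolvent_equation(2)[OF X Y eq u] by (simp add: u_def \<eta>_def res_rhs_def)
  moreover have "fst Y \<bullet> fst u \<le> (norm (fst Y))\<^sup>2 / 2 + (norm (fst u))\<^sup>2 / 2"
    using Cauchy_Schwarz_ineq2[of "fst Y" "fst u"] sum_squares_bound[of "norm (fst Y)" "norm (fst u)"] by simp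
  moreover have "- a1 (J_op \<nu> (\<lambda>l. damp l *\<^sub>R \<eta> l)) u = (\<integral>l. - a1 (damp l *\<^sub>R \<eta> l) u \<partial>\<nu>)"
    by (simp add: a1_J K_damp \<eta>)
  ultimately have E: "energy u \<le> (norm (fst Y))\<^sup>2 / 2 + (norm (fst u))\<^sup>2 / 2 + (\<integral>l. - a1 (damp l *\<^sub>R \<eta> l) u \<partial>\<nu>)"
    by linarith
  have "(\<integral>l. - a1 (damp l *\<^sub>R \<eta> l) u \<partial>\<nu>) \<le> (\<integral>l. (1/2) * a1 (\<eta> l) (\<eta> l) + (a1 u u / 2) * damp l \<partial>\<nu>)"
  proof (rule integral_mono)
    show "integrable \<nu> (\<lambda>l. - a1 (damp l *\<^sub>R \<eta> l) u)"
      using K_cross_integrable[OF K_damp[OF \<eta>] K_const[OF u]] by simp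
    show "integrable \<nu> (\<lambda>l. (1/2) * a1 (\<eta> l) (\<eta> l) + (a1 u u / 2) * damp l)"
      by (intro Bochner_Integration.integrable_add integrable_mult_right K_spaceD(3)[OF \<eta>] damp_integrable)
    fix l assume l: "l \<in> space \<nu>"
    have "- a1 (damp l *\<^sub>R \<eta> l) u \<le> damp l * ((a1 (\<eta> l) (\<eta> l) + a1 u u) / 2)"
    proof -
      have "damp l * (- a1 (\<eta> l) u) \<le> damp l * ((a1 (\<eta> l) (\<eta> l) + a1 u u) / 2)"
        using a1_young[OF K_spaceD(2)[OF \<eta> l] u] damp_bounds(1)[OF l] by (intro mult_left_mono) auto
      then show ?thesis by (simp add: a1.scaleR_left)
    qed
    also have "\<dots> = damp l * (a1 (\<eta> l) (\<eta> l) / 2) + (a1 u u / 2) * damp l" by (simp add: algebra_simps)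
    also have "damp l * (a1 (\<eta> l) (\<eta> l) / 2) \<le> 1 * (a1 (\<eta> l) (\<eta> l) / 2)"
      using damp_bounds(2)[OF l] a1_nonneg[OF K_spaceD(2)[OF \<eta> l]] by (intro mult_right_mono) auto
    finally show "- a1 (damp l *\<^sub>R \<eta> l) u \<le> (1/2) * a1 (\<eta> l) (\<eta> l) + (a1 u u / 2) * damp l" by simp
  qed
  also have "\<dots> = inner_K a1 \<nu> \<eta> \<eta> / 2 + damp_mass * a1 u u / 2"
    using K_spaceD(3)[OF \<eta>] damp_integrable by (simp add: inner_K_def damp_mass_def)
  finally have "energy u \<le> (norm (fst Y))\<^sup>2 + inner_K a1 \<nu> \<eta> \<eta>"
    using E by (simp add: energy_def)
  then show ?thesis by (simp add: norm_W_sq[OF Y] u_def \<eta>_def)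
qed

text \<open>
  Given \<open>(f, \<eta>)\<close>, replace \<open>f\<close> by a nearby \<open>u \<in> V\<close> and \<open>\<eta>\<close> by \<open>\<eta> / (1 + \<lambda>/n)\<close>, which \<open>\<Lambda>\<close> maps into \<open>\<K>\<close>.
  The functional \<open>A\<^sub>0 u + A\<^sub>1 J \<eta>\<close> is \<open>A\<^sub>1 z\<close> for some \<open>z \<in> V\<close>; adding a multiple of
  \<open>(w - z) / (1 + \<lambda>)\<close> to the memory component turns it into \<open>A\<^sub>1 w\<close>, where \<open>w\<close> is as close to \<open>z\<close> as
  desired and \<open>A\<^sub>1 w \<in> H\<close>.
\<close>

lemma gen_densely_defined: "densely_defined \<Omega> a0 a1 \<nu>"
  unfolding densely_defined_def
proof (intro ballI allI impI)
  fix Y :: "'a state" and e :: real assume Y: "Y \<in> W" and e: "0 < e"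
  define f \<eta> where "f = fst Y" and "\<eta> = snd Y"
  have \<eta>: "\<eta> \<in> K" and f: "f \<in> L2_on \<Omega>" using Y by (auto simp: W_space_def f_def \<eta>_def)
  obtain u where u: "u \<in> V" "norm (fst u - f) < e / 2"
    using H10_dense_in_L2[OF domain_open f, of "e / 2"] e by auto
  define c where "c n l = 1 / (1 + l / real (Suc n))" for n l
  have c01: "0 < c n l" "c n l \<le> 1" "l * c n l \<le> real (Suc n)" if "l \<in> space \<nu>" for n l
    using that by (auto simp: c_def space_nu field_simps intro: add_pos_nonneg)
  have cm: "c n \<in> borel_measurable \<nu>" "(\<lambda>l. l * c n l) \<in> borel_measurable \<nu>" for n
    unfolding c_def by (rule borel_measurable_nu, measurable)+
  have "(\<lambda>n. \<integral>l. (c n l - 1)\<^sup>2 * a1 (\<eta> l) (\<eta> l) \<partial>\<nu>) \<longlonglongrightarrow> (\<integral>l. 0 \<partial>\<nu>)"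
  proof (rule integral_dominated_convergence[where w = "\<lambda>l. a1 (\<eta> l) (\<eta> l)"])
    show "integrable \<nu> (\<lambda>l. a1 (\<eta> l) (\<eta> l))" by (rule K_spaceD[OF \<eta>])
    show "(\<lambda>l. (c n l - 1)\<^sup>2 * a1 (\<eta> l) (\<eta> l)) \<in> borel_measurable \<nu>" for n
      using cm(1)[of n] a1_measurable[OF K_spaceD(1)[OF \<eta>] K_spaceD(1)[OF \<eta>]] by measurable
    show "AE l in \<nu>. (\<lambda>n. (c n l - 1)\<^sup>2 * a1 (\<eta> l) (\<eta> l)) \<longlonglongrightarrow> 0"
    proof (rule AE_I2)
      fix l :: real
      have "(\<lambda>n. (1 / (1 + l * inverse (real (Suc n))) - 1)\<^sup>2 * a1 (\<eta> l) (\<eta> l)) \<longlonglongrightarrow>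
          (1 / (1 + l * 0) - 1)\<^sup>2 * a1 (\<eta> l) (\<eta> l)"
        by (intro tendsto_intros LIMSEQ_inverse_real_of_nat) auto
      then show "(\<lambda>n. (c n l - 1)\<^sup>2 * a1 (\<eta> l) (\<eta> l)) \<longlonglongrightarrow> 0"
        by (simp add: c_def divide_inverse)
    qed
    show "AE l in \<nu>. norm ((c n l - 1)\<^sup>2 * a1 (\<eta> l) (\<eta> l)) \<le> a1 (\<eta> l) (\<eta> l)" for n
    proof (rule AE_I2)
      fix l assume l: "l \<in> space \<nu>"
      have "\<bar>c n l - 1\<bar> \<le> 1" using c01(1,2)[OF l, of n] by simp
      then have "(c n l - 1)\<^sup>2 \<le> 1" by (simp add: abs_square_le_1)
      then show "norm ((c n l - 1)\<^sup>2 * a1 (\<eta> l) (\<eta> l)) \<le> a1 (\<eta> l) (\<eta> l)"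
        using a1_nonneg[OF K_spaceD(2)[OF \<eta> l]] by (simp add: abs_mult mult_left_le_one_le)
    qed
  qed auto
  then have "(\<lambda>n. \<integral>l. (c n l - 1)\<^sup>2 * a1 (\<eta> l) (\<eta> l) \<partial>\<nu>) \<longlonglongrightarrow> 0" by simp
  then have "\<forall>\<^sub>F n in sequentially. (\<integral>l. (c n l - 1)\<^sup>2 * a1 (\<eta> l) (\<eta> l) \<partial>\<nu>) < e\<^sup>2 / 8"
    by (rule order_tendstoD) (use e in simp)
  then obtain n where n: "(\<integral>l. (c n l - 1)\<^sup>2 * a1 (\<eta> l) (\<eta> l) \<partial>\<nu>) < e\<^sup>2 / 8"
    by (meson eventually_sequentially order_refl)
  define \<eta>' where "\<eta>' l = c n l *\<^sub>R \<eta> l" for l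
  have \<eta>': "\<eta>' \<in> K"
    unfolding \<eta>'_def by (rule K_scale[where C = 1, OF \<eta> cm(1)]) (use c01 in \<open>auto simp: abs_le_iff less_imp_le\<close>)
  have \<Lambda>\<eta>': "(\<lambda>l. (l * c n l) *\<^sub>R \<eta> l) \<in> K"
  proof (rule K_scale[where C = "real (Suc n)", OF \<eta> cm(2)])
    fix l assume l: "l \<in> space \<nu>"
    then have "0 \<le> l * c n l" using c01(1)[OF l, of n] by (simp add: space_nu)
    then show "\<bar>l * c n l\<bar> \<le> real (Suc n)" using c01(3)[OF l, of n] by simp
  qed
  obtain C0 where C0: "C0 > 0" "\<And>u v. u \<in> V \<Longrightarrow> v \<in> V \<Longrightarrow> \<bar>a0 u v\<bar> \<le> C0 * norm u * norm v"
    using a0_bounded by (auto simp: bounded_on_def)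
  obtain C1 where C1: "C1 > 0" "\<And>u v. \<bar>a1 u v\<bar> \<le> norm u * norm v * C1"
    using a1.pos_bounded by auto
  have "\<exists>z\<in>V. \<forall>v\<in>V. a1 z v = a0 u v + a1 (J_op \<nu> \<eta>') v"
  proof (rule a1_riesz[OF H10_subspace H10_closed order_refl, where C = "C0 * norm u + norm (J_op \<nu> \<eta>') * C1"])
    show "\<bar>a0 u v + a1 (J_op \<nu> \<eta>') v\<bar> \<le> (C0 * norm u + norm (J_op \<nu> \<eta>') * C1) * norm v" if "v \<in> V" for v
      using C0(2)[OF u(1) that] C1(2)[of "J_op \<nu> \<eta>'" v] by (simp add: algebra_simps)
  qed (use u(1) bilinear_onD(2,4)[OF a0_bilinear] in \<open>auto simp: a1.add_right a1.scaleR_right algebra_simps\<close>)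
  then obtain z where z: "z \<in> V" "\<And>v. v \<in> V \<Longrightarrow> a1 z v = a0 u v + a1 (J_op \<nu> \<eta>') v" by blast
  \<comment> \<open>Small enough that the correction of the memory component has squared norm at most \<open>e\<^sup>2 / 8\<close>.\<close>
  define \<delta> where "\<delta> = sqrt (damp_mass * e\<^sup>2 / (8 * C1))"
  have \<delta>: "\<delta> > 0" using damp_mass_pos C1(1) e by (simp add: \<delta>_def)
  obtain w where w: "w \<in> V" "in_H \<Omega> (a1 w)" "norm (w - z) < \<delta>"
    using regular_elements_dense[OF z(1) \<delta>] by blast
  \<comment> \<open>Normalised so that \<open>J\<close> maps \<open>\<lambda> \<mapsto> x / (1 + \<lambda>)\<close> to \<open>w - z\<close>.\<close>
  define x where "x = (1 / damp_mass) *\<^sub>R (w - z)"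
  have x: "x \<in> V" using w(1) z(1) by (simp add: x_def V_closed_rules)
  define \<zeta> where "\<zeta> l = \<eta>' l + damp l *\<^sub>R x" for l
  have \<zeta>: "\<zeta> \<in> K" unfolding \<zeta>_def by (intro K_add K_damp K_const \<eta>' x)
  have J: "J_op \<nu> \<zeta> = J_op \<nu> \<eta>' + (w - z)"
    unfolding \<zeta>_def using damp_mass_pos by (simp add: J_add K_damp K_const x \<eta>' J_damp_const) (simp add: x_def)
  have stress: "stress a0 a1 \<nu> (u, \<zeta>) v = a1 w v" if "v \<in> V" for v
    using z(2)[OF that] by (simp add: stress_def J a1.add_left a1.diff_left)
  have "in_H \<Omega> (stress a0 a1 \<nu> (u, \<zeta>))"
    using w(2) stress by (auto simp: in_H_def represents_on_def)
  moreover have "(\<lambda>l. u - l *\<^sub>R \<zeta> l) \<in> K"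
  proof -
    have "(\<lambda>l. u - ((l * c n l) *\<^sub>R \<eta> l + (l * damp l) *\<^sub>R x)) \<in> K"
      by (intro K_diff K_add K_const u \<Lambda>\<eta>' K_Lambda_damp x)
    then show ?thesis by (simp add: \<zeta>_def \<eta>'_def scaleR_add_right)
  qed
  ultimately have "(u, \<zeta>) \<in> gen_domain"
    using u(1) \<zeta> by (simp add: gen_dom_def E_minus_Lambda)
  moreover have "norm_W a1 \<nu> (incl_W (u, \<zeta>) - Y) < e"
  proof -
    have d: "(\<lambda>l. (c n l - 1) *\<^sub>R \<eta> l) \<in> K"
      using K_diff[OF \<eta>' \<eta>] by (simp add: \<eta>'_def scaleR_diff_left)
    have dx: "(\<lambda>l. damp l *\<^sub>R x) \<in> K" by (intro K_damp K_const x)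
    have "inner_K a1 \<nu> (\<zeta> - \<eta>) (\<zeta> - \<eta>) \<le>
        (\<integral>l. 2 * ((c n l - 1)\<^sup>2 * a1 (\<eta> l) (\<eta> l)) + 2 * a1 (damp l *\<^sub>R x) (damp l *\<^sub>R x) \<partial>\<nu>)"
      unfolding inner_K_def
    proof (rule integral_mono)
      show "integrable \<nu> (\<lambda>l. a1 ((\<zeta> - \<eta>) l) ((\<zeta> - \<eta>) l))"
        using K_spaceD(3)[OF K_diff[OF \<zeta> \<eta>]] by simp
      show "integrable \<nu> (\<lambda>l. 2 * ((c n l - 1)\<^sup>2 * a1 (\<eta> l) (\<eta> l)) + 2 * a1 (damp l *\<^sub>R x) (damp l *\<^sub>R x))"
        using K_spaceD(3)[OF d] K_spaceD(3)[OF dx]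
        by (simp add: a1.scaleR_left a1.scaleR_right power2_eq_square mult.assoc)
      fix l assume l: "l \<in> space \<nu>"
      have eq: "(\<zeta> - \<eta>) l = (c n l - 1) *\<^sub>R \<eta> l + damp l *\<^sub>R x"
        by (simp add: \<zeta>_def \<eta>'_def algebra_simps)
      show "a1 ((\<zeta> - \<eta>) l) ((\<zeta> - \<eta>) l) \<le>
          2 * ((c n l - 1)\<^sup>2 * a1 (\<eta> l) (\<eta> l)) + 2 * a1 (damp l *\<^sub>R x) (damp l *\<^sub>R x)"
        using a1_add_le[OF K_spaceD(2)[OF d l] K_spaceD(2)[OF dx l]]
        unfolding eq by (simp add: a1.scaleR_left a1.scaleR_right power2_eq_square mult.assoc)
    qed
    also have "\<dots> = 2 * (\<integral>l. (c n l - 1)\<^sup>2 * a1 (\<eta> l) (\<eta> l) \<partial>\<nu>) + 2 * (\<integral>l. a1 (damp l *\<^sub>R x) (damp l *\<^sub>R x) \<partial>\<nu>)"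
      using K_spaceD(3)[OF d] K_spaceD(3)[OF dx]
      by (simp add: a1.scaleR_left a1.scaleR_right power2_eq_square mult.assoc)
    also have "(\<integral>l. a1 (damp l *\<^sub>R x) (damp l *\<^sub>R x) \<partial>\<nu>) \<le> damp_mass * a1 x x"
      by (rule damp_sq_integral_le[OF x])
    also have "damp_mass * a1 x x = a1 (w - z) (w - z) / damp_mass"
      using damp_mass_pos unfolding x_def a1.scaleR_left a1.scaleR_right by simp
    also have "\<dots> \<le> (norm (w - z))\<^sup>2 * C1 / damp_mass"
      using C1(2)[of "w - z" "w - z"] damp_mass_pos by (intro divide_right_mono) (auto simp: power2_eq_square)
    also have "\<dots> \<le> \<delta>\<^sup>2 * C1 / damp_mass"
      using w(3) C1(1) damp_mass_pos by (intro divide_right_mono mult_right_mono power_mono) auto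
    also have "\<dots> = e\<^sup>2 / 8"
      using damp_mass_pos C1(1) by (simp add: \<delta>_def)
    finally have "inner_K a1 \<nu> (\<zeta> - \<eta>) (\<zeta> - \<eta>) \<le> e\<^sup>2 / 2" using n by linarith
    moreover have "(norm (fst u - f))\<^sup>2 < (e / 2)\<^sup>2"
      using u(2) by (intro power_strict_mono) auto
    moreover have "(e / 2)\<^sup>2 = e\<^sup>2 / 4" "0 < e\<^sup>2"
      using e by (auto simp: power2_eq_square)
    ultimately have "(norm (fst u - f))\<^sup>2 + inner_K a1 \<nu> (\<zeta> - \<eta>) (\<zeta> - \<eta>) < e\<^sup>2"
      by linarith
    then have "sqrt ((norm (fst u - f))\<^sup>2 + inner_K a1 \<nu> (\<zeta> - \<eta>) (\<zeta> - \<eta>)) < e"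
      using e by (intro real_less_lsqrt) auto
    then show ?thesis
      by (simp add: norm_W_def inner_W_def incl_W_def power2_norm_eq_inner f_def \<eta>_def)
  qed
  ultimately show "\<exists>X\<in>gen_domain. norm_W a1 \<nu> (incl_W X - Y) < e" by blast
qed

lemma resolvent_props:
  assumes "Y \<in> W"
  obtains X where "X \<in> gen_domain" "eq_W \<nu> (incl_W X - G X) Y" "resolvent \<Omega> a0 a1 \<nu> Y = incl_W X"
  using resolvent_solvable[OF assms] someI_ex[of "\<lambda>X. X \<in> gen_domain \<and> eq_W \<nu> (incl_W X - G X) Y"]
  unfolding resolvent_def by blast

end

section \<open>Dependence on the perturbation\<close>

lemma perturbed_form_generator:
  assumes "memory_space \<Omega> a1 \<nu>"
    and a: "bilinear_on (H10 \<Omega>) a" "symmetric_on (H10 \<Omega>) a" "bounded_on (H10 \<Omega>) a"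
      "\<And>v. v \<in> H10 \<Omega> \<Longrightarrow> 0 \<le> a v v"
    and b: "bilinear_on (H10 \<Omega>) b" "symmetric_on (H10 \<Omega>) b" "bounded_on (H10 \<Omega>) b"
      "\<And>v. v \<in> H10 \<Omega> \<Longrightarrow> 0 \<le> b v v"
    and "0 \<le> \<epsilon>"
  shows "generator \<Omega> a1 \<nu> (perturbed_form a b \<epsilon>)"
proof -
  interpret memory_space \<Omega> a1 \<nu> by fact
  show ?thesis
  proof
    show "bilinear_on V (perturbed_form a b \<epsilon>)"
      using a(1) b(1) by (auto simp: bilinear_on_def perturbed_form_def algebra_simps)
    show "symmetric_on V (perturbed_form a b \<epsilon>)"
      using a(2) b(2) by (auto simp: symmetric_on_def perturbed_form_def)
    show "0 \<le> perturbed_form a b \<epsilon> v v" if "v \<in> V" for v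
      using a(4)[OF that] b(4)[OF that] assms(10) by (simp add: perturbed_form_def)
    obtain Ca where Ca: "Ca > 0" "\<And>u v. u \<in> V \<Longrightarrow> v \<in> V \<Longrightarrow> \<bar>a u v\<bar> \<le> Ca * norm u * norm v"
      using a(3) by (auto simp: bounded_on_def)
    obtain Cb where Cb: "Cb > 0" "\<And>u v. u \<in> V \<Longrightarrow> v \<in> V \<Longrightarrow> \<bar>b u v\<bar> \<le> Cb * norm u * norm v"
      using b(3) by (auto simp: bounded_on_def)
    have "\<bar>perturbed_form a b \<epsilon> u v\<bar> \<le> (Ca + \<epsilon> * Cb) * norm u * norm v" if "u \<in> V" "v \<in> V" for u v
    proof -
      have "\<bar>\<epsilon> * b u v\<bar> \<le> \<epsilon> * (Cb * norm u * norm v)"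
        using Cb(2)[OF that] assms(10) by (simp add: abs_mult mult_left_mono)
      then have "\<bar>perturbed_form a b \<epsilon> u v\<bar> \<le> Ca * norm u * norm v + \<epsilon> * (Cb * norm u * norm v)"
        unfolding perturbed_form_def using Ca(2)[OF that] by linarith
      then show ?thesis by (simp add: algebra_simps)
    qed
    moreover have "Ca + \<epsilon> * Cb > 0" using Ca(1) Cb(1) assms(10) by (simp add: add_pos_nonneg)
    ultimately show "bounded_on V (perturbed_form a b \<epsilon>)" unfolding bounded_on_def by blast
  qed
qed

text \<open>
  The difference \<open>d = u\<^sub>\<epsilon> - u\<^sub>0\<close> of the first components solves the unperturbed problem with right-hand
  side \<open>- \<epsilon> b (u\<^sub>\<epsilon>, \<cdot>)\<close>.  Testing with \<open>d\<close> bounds its energy by \<open>\<epsilon> C \<parallel>u\<^sub>\<epsilon>\<parallel> \<parallel>d\<parallel>\<close>, and the energy of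
  \<open>u\<^sub>\<epsilon>\<close> is bounded by the data uniformly in \<open>\<epsilon>\<close>.
\<close>

lemma resolvent_perturbation:
  fixes \<Omega> :: "(real^'n) set"
  assumes mem: "memory_space \<Omega> a1 \<nu>"
    and gen: "generator \<Omega> a1 \<nu> (perturbed_form a b \<epsilon>)" "generator \<Omega> a1 \<nu> (perturbed_form a b 0)"
    and b: "\<And>u v. u \<in> H10 \<Omega> \<Longrightarrow> v \<in> H10 \<Omega> \<Longrightarrow> \<bar>b u v\<bar> \<le> C * norm u * norm v"
    and \<alpha>: "\<alpha> > 0" "\<And>v. v \<in> H10 \<Omega> \<Longrightarrow> \<alpha> * (norm v)\<^sup>2 \<le> memory_space.energy a1 \<nu> v"
    and "0 \<le> \<epsilon>" "C > 0" and Y: "Y \<in> W_space \<Omega> a1 \<nu>"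
  shows "norm_W a1 \<nu> (resolvent \<Omega> (perturbed_form a b \<epsilon>) a1 \<nu> Y - resolvent \<Omega> (perturbed_form a b 0) a1 \<nu> Y)
    \<le> C / \<alpha> * \<epsilon> * norm_W a1 \<nu> Y" (is "?D \<le> _")
    and "0 \<le> norm_W a1 \<nu> (resolvent \<Omega> (perturbed_form a b \<epsilon>) a1 \<nu> Y - resolvent \<Omega> (perturbed_form a b 0) a1 \<nu> Y)"
proof -
  interpret memory_space \<Omega> a1 \<nu> by fact
  interpret E: generator \<Omega> a1 \<nu> "perturbed_form a b \<epsilon>" by fact
  interpret Z: generator \<Omega> a1 \<nu> "perturbed_form a b 0" by fact
  obtain X where X: "X \<in> E.gen_domain" "eq_W \<nu> (incl_W X - E.G X) Y" "resolvent \<Omega> (perturbed_form a b \<epsilon>) a1 \<nu> Y = incl_W X"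
    using E.resolvent_props[OF Y] by blast
  obtain X' where X': "X' \<in> Z.gen_domain" "eq_W \<nu> (incl_W X' - Z.G X') Y" "resolvent \<Omega> (perturbed_form a b 0) a1 \<nu> Y = incl_W X'"
    using Z.resolvent_props[OF Y] by blast
  define u u' d where "u = fst X" and "u' = fst X'" and "d = u - u'"
  have u: "u \<in> V" "u' \<in> V" "d \<in> V"
    using E.gen_domD(1)[OF X(1)] Z.gen_domD(1)[OF X'(1)] by (auto simp: u_def u'_def d_def V_closed_rules)
  note eqs = E.resolvent_equation[OF X(1) Y X(2), folded u_def] Z.resolvent_equation[OF X'(1) Y X'(2), folded u'_def]
  have nY: "0 \<le> norm_W a1 \<nu> Y" using Y by (intro norm_W_nonneg) (auto simp: W_space_def)
  have "incl_W X - incl_W X' = (fst u - fst u', snd X - snd X')"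
    by (simp add: incl_W_def u_def u'_def)
  then show "0 \<le> ?D"
    unfolding X(3) X'(3) using K_diff[OF E.gen_domD(2)[OF X(1)] Z.gen_domD(2)[OF X'(1)]]
    by (intro norm_W_nonneg) (simp add: fun_diff_def)
  have bound: "\<alpha> * (norm v * norm w) \<le> sqrt (energy v) * sqrt (energy w)" if "v \<in> V" "w \<in> V" for v w
  proof -
    have "sqrt (\<alpha> * (norm v)\<^sup>2) * sqrt (\<alpha> * (norm w)\<^sup>2) \<le> sqrt (energy v) * sqrt (energy w)"
      using that by (intro mult_mono real_sqrt_le_mono \<alpha>(2))
        (auto intro!: energy_nonneg mult_nonneg_nonneg simp: less_imp_le[OF \<alpha>(1)])
    moreover have "sqrt (\<alpha> * (norm v)\<^sup>2) * sqrt (\<alpha> * (norm w)\<^sup>2) = (sqrt \<alpha> * sqrt \<alpha>) * (norm v * norm w)"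
      by (simp only: real_sqrt_mult real_sqrt_abs abs_norm_cancel mult_ac)
    ultimately show ?thesis using \<alpha>(1) by simp
  qed
  have "Z.res_form d d = Z.res_form u d - Z.res_form u' d"
    unfolding d_def using u by (intro bilinear_on_diff[OF Z.res_form_bilinear H10_subspace]) (auto simp: d_def)
  also have "Z.res_form u d = E.res_form u d - \<epsilon> * b u d"
    unfolding E.res_form_def Z.res_form_def by (simp add: perturbed_form_def)
  also have "E.res_form u d = Z.res_form u' d"
    using eqs(2)[OF u(3)] eqs(4)[OF u(3)] by (simp add: E.res_rhs_def Z.res_rhs_def)
  finally have "Z.res_form d d = - (\<epsilon> * b u d)" by simp
  then have "energy d \<le> \<epsilon> * \<bar>b u d\<bar>"
    using Z.energy_le_res_form[OF u(3)] \<open>0 \<le> \<epsilon>\<close> by (smt (verit) mult_left_mono mult_minus_right)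
  also have "\<dots> \<le> \<epsilon> * (C / \<alpha> * (\<alpha> * (norm u * norm d)))"
    using b[OF u(1,3)] \<alpha>(1) \<open>0 \<le> \<epsilon>\<close> by (intro mult_left_mono) (auto simp: mult.assoc)
  also have "\<dots> \<le> \<epsilon> * (C / \<alpha> * (sqrt (energy u) * sqrt (energy d)))"
    using \<alpha>(1) \<open>0 \<le> \<epsilon>\<close> \<open>C > 0\<close> by (intro mult_left_mono bound u) auto
  also have "\<dots> \<le> \<epsilon> * (C / \<alpha> * (norm_W a1 \<nu> Y * sqrt (energy d)))"
  proof -
    have "sqrt (energy u) \<le> norm_W a1 \<nu> Y"
      using E.resolvent_energy_le[OF X(1) Y X(2)] nY unfolding u_def by (intro real_le_lsqrt) auto
    then show ?thesis
      using \<alpha>(1) \<open>0 \<le> \<epsilon>\<close> \<open>C > 0\<close> energy_nonneg[OF u(3)]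
      by (intro mult_left_mono mult_right_mono) auto
  qed
  finally have "sqrt (energy d) * sqrt (energy d) \<le> (C / \<alpha> * \<epsilon> * norm_W a1 \<nu> Y) * sqrt (energy d)"
    using energy_nonneg[OF u(3)] by (simp add: mult_ac)
  note product_bound = this
  have "sqrt (energy d) \<le> C / \<alpha> * \<epsilon> * norm_W a1 \<nu> Y"
  proof (cases "energy d = 0")
    case True
    then show ?thesis using \<alpha>(1) \<open>0 \<le> \<epsilon>\<close> \<open>C > 0\<close> nY by simp
  next
    case False
    then have "0 < sqrt (energy d)" using energy_nonneg[OF u(3)] by simp
    then show ?thesis by (rule mult_right_le_imp_le[OF product_bound])
  qed
  moreover have "norm_W a1 \<nu> (incl_W (u, snd X) - incl_W (u', snd X')) \<le> sqrt (energy d)"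
    unfolding d_def
    by (rule norm_W_difference_le[OF u(1,2) E.gen_domD(2)[OF X(1)] Z.gen_domD(2)[OF X'(1)] eqs(1,3)])
  ultimately show "?D \<le> C / \<alpha> * \<epsilon> * norm_W a1 \<nu> Y"
    unfolding X(3) X'(3) by (simp add: u_def u'_def)
qed

theorem proposition6p1:
  fixes \<Omega> :: "(real^'n) set"
    and A1 :: "real^'n \<Rightarrow> real^'n^'n"
    and av :: "'n form"
    and \<nu> :: "real measure"
  assumes dim: "CARD('n) \<in> {1, 2, 3}"
    and domain: "bounded_lipschitz_domain \<Omega>"
    and A1_field: "Linf_symmetric_field \<Omega> A1"
    and A1_psd: "AE x in lebesgue_on \<Omega>. \<forall>\<xi>. 0 \<le> (A1 x *v \<xi>) \<bullet> \<xi>"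
    and a1_bounded: "bounded_on (H10 \<Omega>) (diffusion_form \<Omega> A1)"
    and a1_coercive: "coercive_on (H10 \<Omega>) (diffusion_form \<Omega> A1)"
    and nu_borel: "sets \<nu> = sets (restrict_space borel {0..})"
    and nu_mass: "0 < emeasure \<nu> {0..}" "emeasure \<nu> {0..} < \<infinity>"
    and av_bilinear: "bilinear_on (H10 \<Omega>) av"
    and av_symmetric: "symmetric_on (H10 \<Omega>) av"
    and av_bounded: "bounded_on (H10 \<Omega>) av"
    and av_coercive: "coercive_on (H10 \<Omega>) av"
  shows "\<exists>C_res>0. \<forall>A0 :: real^'n \<Rightarrow> real^'n^'n.
    Linf_symmetric_field \<Omega> A0 \<and>
    bounded_on (H10 \<Omega>) (diffusion_form \<Omega> A0) \<and>
    (\<forall>v\<in>H10 \<Omega>. diffusion_form \<Omega> A0 v v \<ge> 0) \<longrightarrow>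
    (let a1 = diffusion_form \<Omega> A1;
         a0 = perturbed_form (diffusion_form \<Omega> A0) av;
         R = (\<lambda>\<epsilon>. resolvent \<Omega> (a0 \<epsilon>) a1 \<nu>)
     in (\<forall>\<epsilon>\<in>{0..1}. densely_defined \<Omega> (a0 \<epsilon>) a1 \<nu> \<and> m_dissipative \<Omega> (a0 \<epsilon>) a1 \<nu> \<and>
           I_minus_gen_injective \<Omega> (a0 \<epsilon>) a1 \<nu>) \<and>
        (\<forall>\<epsilon>\<in>{0..1}. opnorm_W \<Omega> a1 \<nu> (\<lambda>Y. R \<epsilon> Y - R 0 Y) \<le> ennreal (C_res * \<epsilon>)) \<and>
        (\<forall>Y\<in>W_space \<Omega> a1 \<nu>.
           ((\<lambda>\<epsilon>. norm_W a1 \<nu> (R \<epsilon> Y - R 0 Y)) \<longlongrightarrow> 0) (at_right 0)))"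
proof -
  define a1 where "a1 = diffusion_form \<Omega> A1"
  have op: "open \<Omega>" and bd: "bounded \<Omega>"
    using domain by (auto simp: bounded_lipschitz_domain_def)
  obtain P where P: "P > 0" "\<And>v. v \<in> H10 \<Omega> \<Longrightarrow> (norm v)\<^sup>2 \<le> P * (norm (snd v))\<^sup>2"
    using poincare_H10_norm[OF bd] by blast
  have mem: "memory_space \<Omega> a1 \<nu>"
  proof (rule memory_space.intro)
    show "open \<Omega>" by fact
    show "bounded_bilinear a1" unfolding a1_def by (rule diffusion_form_bounded_bilinear[OF op A1_field])
    show "a1 u v = a1 v u" for u v unfolding a1_def by (rule diffusion_form_symmetric[OF op A1_field])
    obtain \<beta> where \<beta>: "\<beta> > 0" "\<And>v. v \<in> H10 \<Omega> \<Longrightarrow> \<beta> * (norm (snd v))\<^sup>2 \<le> a1 v v"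
      using a1_coercive by (auto simp: coercive_on_def a1_def)
    have "\<beta> / P * (norm v)\<^sup>2 \<le> a1 v v" if "v \<in> H10 \<Omega>" for v
    proof -
      have "\<beta> / P * (norm v)\<^sup>2 \<le> \<beta> / P * (P * (norm (snd v))\<^sup>2)"
        using P(2)[OF that] P(1) \<beta>(1) by (intro mult_left_mono) auto
      then show ?thesis using \<beta>(2)[OF that] P(1) by simp
    qed
    then show "\<exists>c>0. \<forall>v\<in>H10 \<Omega>. c * (norm v)\<^sup>2 \<le> a1 v v"
      using \<beta>(1) P(1) by (intro exI[of _ "\<beta> / P"]) auto
  qed (fact nu_borel nu_mass)+
  interpret memory_space \<Omega> a1 \<nu> by (rule mem)
  obtain \<alpha> where \<alpha>: "\<alpha> > 0" "\<And>v. v \<in> H10 \<Omega> \<Longrightarrow> \<alpha> * (norm v)\<^sup>2 \<le> energy v"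
    using energy_coercive by blast
  obtain C where C: "C > 0" "\<And>u v. u \<in> H10 \<Omega> \<Longrightarrow> v \<in> H10 \<Omega> \<Longrightarrow> \<bar>av u v\<bar> \<le> C * norm u * norm v"
    using av_bounded by (auto simp: bounded_on_def)
  have av_nonneg: "0 \<le> av v v" if "v \<in> H10 \<Omega>" for v
    using av_coercive that unfolding coercive_on_def
    by (meson less_imp_le mult_nonneg_nonneg order_trans zero_le_power2)
  show ?thesis
  proof (intro exI[of _ "C / \<alpha>"] conjI allI impI)
    show "C / \<alpha> > 0" using C(1) \<alpha>(1) by simp
    fix A0 :: "real^'n \<Rightarrow> real^'n^'n"
    assume A0: "Linf_symmetric_field \<Omega> A0 \<and> bounded_on (H10 \<Omega>) (diffusion_form \<Omega> A0) \<and>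
      (\<forall>v\<in>H10 \<Omega>. diffusion_form \<Omega> A0 v v \<ge> 0)"
    define a0 where "a0 = perturbed_form (diffusion_form \<Omega> A0) av"
    have bb: "bounded_bilinear (diffusion_form \<Omega> A0)"
      using A0 by (intro diffusion_form_bounded_bilinear[OF op]) auto
    have gen: "generator \<Omega> a1 \<nu> (a0 \<epsilon>)" if "0 \<le> \<epsilon>" for \<epsilon>
      unfolding a0_def
      by (rule perturbed_form_generator[OF mem bounded_bilinear_imp_on(1)[OF bb] _ bounded_bilinear_imp_on(2)[OF bb]
            _ av_bilinear av_symmetric av_bounded av_nonneg that])
        (use A0 diffusion_form_symmetric[OF op, of A0] in \<open>auto simp: symmetric_on_def\<close>)
    define D where "D \<epsilon> Y = norm_W a1 \<nu> (resolvent \<Omega> (a0 \<epsilon>) a1 \<nu> Y - resolvent \<Omega> (a0 0) a1 \<nu> Y)" for \<epsilon> Y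
    have est: "D \<epsilon> Y \<le> C / \<alpha> * \<epsilon> * norm_W a1 \<nu> Y" "0 \<le> D \<epsilon> Y" if "0 \<le> \<epsilon>" "Y \<in> W" for \<epsilon> Y
      using resolvent_perturbation[OF mem gen[OF that(1), unfolded a0_def] gen[OF order_refl, unfolded a0_def]
          C(2) \<alpha> that(1) C(1) that(2)]
      unfolding a0_def D_def by blast+
    have "densely_defined \<Omega> (a0 \<epsilon>) a1 \<nu> \<and> m_dissipative \<Omega> (a0 \<epsilon>) a1 \<nu> \<and> I_minus_gen_injective \<Omega> (a0 \<epsilon>) a1 \<nu>"
      if "\<epsilon> \<in> {0..1}" for \<epsilon>
      using generator.gen_densely_defined generator.gen_m_dissipative generator.gen_injective gen that
      by (metis atLeastAtMost_iff)
    moreover have "opnorm_W \<Omega> a1 \<nu> (\<lambda>Y. resolvent \<Omega> (a0 \<epsilon>) a1 \<nu> Y - resolvent \<Omega> (a0 0) a1 \<nu> Y) \<le> ennreal (C / \<alpha> * \<epsilon>)"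
      if "\<epsilon> \<in> {0..1}" for \<epsilon>
      unfolding opnorm_W_def D_def[symmetric]
    proof (rule SUP_least)
      fix Y assume Y: "Y \<in> {Y \<in> W. norm_W a1 \<nu> Y \<le> 1}"
      have "C / \<alpha> * \<epsilon> * norm_W a1 \<nu> Y \<le> C / \<alpha> * \<epsilon> * 1"
        using Y that C(1) \<alpha>(1) by (intro mult_left_mono) auto
      then show "ennreal (D \<epsilon> Y) \<le> ennreal (C / \<alpha> * \<epsilon>)"
        using est(1)[of \<epsilon> Y] Y that by (intro ennreal_leI) auto
    qed
    moreover have "((\<lambda>\<epsilon>. D \<epsilon> Y) \<longlongrightarrow> 0) (at_right 0)"
      if Y: "Y \<in> W" for Y
    proof (rule tendsto_sandwich)
      show "\<forall>\<^sub>F \<epsilon> in at_right 0. 0 \<le> D \<epsilon> Y"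
        using est(2)[OF _ Y] by (auto simp: eventually_at_filter intro: always_eventually)
      show "\<forall>\<^sub>F \<epsilon> in at_right 0. D \<epsilon> Y \<le> C / \<alpha> * \<epsilon> * norm_W a1 \<nu> Y"
        using est(1)[OF _ Y] by (auto simp: eventually_at_filter intro: always_eventually)
      have "((\<lambda>\<epsilon>. C / \<alpha> * \<epsilon> * norm_W a1 \<nu> Y) \<longlongrightarrow> C / \<alpha> * 0 * norm_W a1 \<nu> Y) (at_right 0)"
        by (intro tendsto_intros)
      then show "((\<lambda>\<epsilon>. C / \<alpha> * \<epsilon> * norm_W a1 \<nu> Y) \<longlongrightarrow> 0) (at_right 0)" by simp
    qed simp
    ultimately show "let a1 = diffusion_form \<Omega> A1;
         a0 = perturbed_form (diffusion_form \<Omega> A0) av;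
         R = (\<lambda>\<epsilon>. resolvent \<Omega> (a0 \<epsilon>) a1 \<nu>)
     in (\<forall>\<epsilon>\<in>{0..1}. densely_defined \<Omega> (a0 \<epsilon>) a1 \<nu> \<and> m_dissipative \<Omega> (a0 \<epsilon>) a1 \<nu> \<and>
           I_minus_gen_injective \<Omega> (a0 \<epsilon>) a1 \<nu>) \<and>
        (\<forall>\<epsilon>\<in>{0..1}. opnorm_W \<Omega> a1 \<nu> (\<lambda>Y. R \<epsilon> Y - R 0 Y) \<le> ennreal (C / \<alpha> * \<epsilon>)) \<and>
        (\<forall>Y\<in>W_space \<Omega> a1 \<nu>.
           ((\<lambda>\<epsilon>. norm_W a1 \<nu> (R \<epsilon> Y - R 0 Y)) \<longlongrightarrow> 0) (at_right 0))"
      unfolding Let_def a0_def[symmetric] a1_def[symmetric] D_def[symmetric] by blast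
  qed
qed

end
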